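(* Let $J$ be a generalized complex structure, with $+i$-eigenbundle $L$, on the standard Courant algebroid $TM\oplus T^*M\to M$. Let $(x^1,\dots,x^n)$ be local coordinates on $M$ identifying an open domain $U$ with the unit ball centered at the origin in $\mathbb{R}^n$. Let $(e_1,\dots,e_{2n})=(\partial_{x^1},\dots,\partial_{x^n},dx^1,\dots,dx^n)$, write $J e_j|_x=\sum_i a^i_j(x)\,e_i|_x$ for $x\in U$ with $a^i_j\in C^\infty(U)$, and set $J_t e_j|_x=\sum_i a^i_j(tx)\,e_i|_x$ for $t\in[0,1]$, $x\in U$. Let $\dot\omega_1\in\Gamma(\wedge^2L^*|_U)$ be given by $\dot\omega_1(v,w)=\langle v,\dot J_1w\rangle$, where $\dot J_1=\frac{d}{dt}J_t|_{t=1}$. If there exists $\beta\in\Gamma(L^*|_U)$ such that $$d_L\beta=\dot\omega_1,\qquad \beta|_0=0\qquad\text{and}\qquad d\beta|_0=0,$$ then $J|_U$ is isomorphic to a constant generalized complex structure.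
   Context: $M$ is a smooth manifold. The standard Courant algebroid $TM\oplus T^*M$ has anchor $\rho(X+\xi)=X$, pairing $\langle X+\xi,Y+\eta\rangle=\frac12(\xi(Y)+\eta(X))$ and bracket $[\![X+\xi,Y+\eta]\!]=[X,Y]+L_X\eta-L_Y\xi+\frac12d(\xi(Y)-\eta(X))$, where $L_X$ is the usual Lie derivative. A generalized complex structure is a vector bundle endomorphism $J$ (over the identity) with $J^2=-\mathrm{id}$, orthogonal for the pairing and integrable: $[\![Jx,Jy]\!]-[\![x,y]\!]-J([\![Jx,y]\!]+[\![x,Jy]\!])=0$ for all sections $x,y$. All structures are extended $\mathbb{C}$-linearly to the complexification. The $+i$-eigenbundle $L$ of $J$ in the complexified bundle is isotropic and closed under the bracket, hence is a complex Lie algebroid with anchor $\rho|_L$ and bracket $[\![\cdot,\cdot]\!]$; $d_L:\Gamma(\wedge^\bullet L^* )\to\Gamma(\wedge^{\bullet+1}L^* )$ is its Lie algebroid differential. A generalized complex structure on $(TM\oplus T^*M)|_U$ is called constant if its matrix in the frame $(e_1,\dots,e_{2n})$ is constant on $U$. Explicitly, $\dot J_1e_j|_x=\sum_{i,l}x^l\frac{\partial a^i_j}{\partial x^l}(x)\,e_i|_x$. The conditions $\beta|_0=0$ and $d\beta|_0=0$ mean that the coefficients of $\beta$ in a smooth local frame of $L^*$ vanish at the origin together with their first-order partial derivatives (i.e. the 1-jet of $\beta$ at the origin vanishes). Two generalized complex structures $J,J'$ on the same Courant algebroid $E$ (here $E=(TM\oplus T^*M)|_U$) are isomorphic if there is an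 automorphism $\phi$ of the Courant algebroid $E$, i.e. a vector bundle automorphism covering a diffeomorphism of the base and preserving pairing, bracket and anchor, with $\phi^{-1}\circ J\circ\phi=J'$.
   Formalization: The isomorphism to a constant structure is proved only after shrinking U to a smaller ball about the origin (from some open set). On all of U the claim fails: on the disc, the symplectic form (1-r^2)^(-2) dx∧dy admits such a β but has infinite area, unlike any constant form. *)

theory Defs
  imports "HOL-Analysis.Analysis"
begin

text \<open>Smooth functions on open subsets of \<open>\<real>\<^sup>n\<close>: all iterated partial derivatives exist and are
  differentiable. The predicates are meant for open \<open>S\<close> only.\<close>

definition pd :: "'n::finite \<Rightarrow> (real^'n \<Rightarrow> 'b::real_normed_vector) \<Rightarrow> real^'n \<Rightarrow> 'b" where
  "pd l f x = frechet_derivative f (at x) (axis l 1)"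

primrec Cdiff :: "nat \<Rightarrow> (real^'n::finite) set \<Rightarrow> (real^'n \<Rightarrow> 'b::real_normed_vector) \<Rightarrow> bool" where
  "Cdiff 0 S f \<longleftrightarrow> continuous_on S f"
| "Cdiff (Suc k) S f \<longleftrightarrow> (\<forall>x\<in>S. f differentiable (at x)) \<and> (\<forall>l. Cdiff k S (pd l f))"

definition smooth_on :: "(real^'n::finite) set \<Rightarrow> (real^'n \<Rightarrow> 'b::real_normed_vector) \<Rightarrow> bool" where
  "smooth_on S f \<longleftrightarrow> (\<forall>k. Cdiff k S f)"


text \<open>The standard Courant algebroid over an open \<open>V \<subseteq> \<real>\<^sup>n\<close>. An element \<open>X + \<xi>\<close> of a fibre is
  its coefficient vector in the frame \<open>\<partial>\<^sub>1, \<dots>, \<partial>\<^sub>n, dx\<^sup>1, \<dots>, dx\<^sup>n\<close>, indexed by \<open>'n + 'n\<close>: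
  \<open>Inl i\<close> is \<open>\<partial>\<^sub>i\<close> and \<open>Inr i\<close> is \<open>dx\<^sup>i\<close>. The scalars \<open>'a\<close> are the reals or, for the
  complexification, the complex numbers; the formulas below are then the bilinear extensions.\<close>

definition anchor :: "'a ^ ('n::finite + 'n) \<Rightarrow> 'a ^ 'n" where
  "anchor u = (\<chi> i. u $ Inl i)"

definition formpart :: "'a ^ ('n::finite + 'n) \<Rightarrow> 'a ^ 'n" where
  "formpart u = (\<chi> i. u $ Inr i)"

definition contract :: "'a::real_normed_field ^ 'n::finite \<Rightarrow> 'a ^ 'n \<Rightarrow> 'a" where
  "contract \<xi> X = (\<Sum>i\<in>UNIV. \<xi> $ i * X $ i)"

definition pairing :: "'a::real_normed_field ^ ('n::finite + 'n) \<Rightarrow> 'a ^ ('n + 'n) \<Rightarrow> 'a" where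
  "pairing u v = (1/2) * (contract (formpart u) (anchor v) + contract (formpart v) (anchor u))"

definition vf_apply ::
  "(real^'n::finite \<Rightarrow> 'a::real_normed_field ^ 'n) \<Rightarrow> (real^'n \<Rightarrow> 'a) \<Rightarrow> real^'n \<Rightarrow> 'a" where
  "vf_apply X g x = (\<Sum>l\<in>UNIV. X x $ l * pd l g x)"

definition lie_bracket ::
  "(real^'n::finite \<Rightarrow> 'a::real_normed_field ^ 'n) \<Rightarrow> (real^'n \<Rightarrow> 'a ^ 'n) \<Rightarrow> real^'n \<Rightarrow> 'a ^ 'n" where
  "lie_bracket X Y x =
     (\<chi> i. vf_apply X (\<lambda>y. Y y $ i) x - vf_apply Y (\<lambda>y. X y $ i) x)"

definition lie_deriv ::
  "(real^'n::finite \<Rightarrow> 'a::real_normed_field ^ 'n) \<Rightarrow> (real^'n \<Rightarrow> 'a ^ 'n) \<Rightarrow> real^'n \<Rightarrow> 'a ^ 'n" where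
  "lie_deriv X \<eta> x =
     (\<chi> i. vf_apply X (\<lambda>y. \<eta> y $ i) x + (\<Sum>l\<in>UNIV. \<eta> x $ l * pd i (\<lambda>y. X y $ l) x))"

definition differential :: "(real^'n::finite \<Rightarrow> 'a::real_normed_field) \<Rightarrow> real^'n \<Rightarrow> 'a ^ 'n" where
  "differential g x = (\<chi> i. pd i g x)"

definition mk_gen :: "'a ^ 'n::finite \<Rightarrow> 'a ^ 'n \<Rightarrow> 'a ^ ('n + 'n)" where
  "mk_gen X \<xi> = (\<chi> i. case i of Inl k \<Rightarrow> X $ k | Inr k \<Rightarrow> \<xi> $ k)"

definition courant_bracket ::
  "(real^'n::finite \<Rightarrow> 'a::real_normed_field ^ ('n + 'n)) \<Rightarrow> (real^'n \<Rightarrow> 'a ^ ('n + 'n)) \<Rightarrow>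
   real^'n \<Rightarrow> 'a ^ ('n + 'n)" where
  "courant_bracket s r x =
     (let X = (\<lambda>y. anchor (s y)); \<xi> = (\<lambda>y. formpart (s y));
          Y = (\<lambda>y. anchor (r y)); \<eta> = (\<lambda>y. formpart (r y))
      in mk_gen (lie_bracket X Y x)
           (lie_deriv X \<eta> x - lie_deriv Y \<xi> x
            + (1/2) *s differential (\<lambda>y. contract (\<xi> y) (Y y) - contract (\<eta> y) (X y)) x))"


text \<open>\<open>J x\<close> is the matrix \<open>(a\<^sup>i\<^sub>j(x))\<close> of the endomorphism in the frame:
  \<open>J x $ i $ j = a\<^sup>i\<^sub>j(x)\<close>.\<close>

definition gc_structure_on ::
  "(real^'n::finite) set \<Rightarrow> (real^'n \<Rightarrow> real ^ ('n + 'n) ^ ('n + 'n)) \<Rightarrow> bool" where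
  "gc_structure_on V J \<longleftrightarrow>
     (\<forall>i j. smooth_on V (\<lambda>x. J x $ i $ j)) \<and>
     (\<forall>x\<in>V. J x ** J x = - mat 1) \<and>
     (\<forall>x\<in>V. \<forall>u v. pairing (J x *v u) (J x *v v) = pairing u v) \<and>
     (\<forall>s r. smooth_on V s \<longrightarrow> smooth_on V r \<longrightarrow>
        (\<forall>x\<in>V. courant_bracket (\<lambda>y. J y *v s y) (\<lambda>y. J y *v r y) x - courant_bracket s r x
          - J x *v (courant_bracket (\<lambda>y. J y *v s y) r x
                    + courant_bracket s (\<lambda>y. J y *v r y) x) = 0))"

definition constant_on_set :: "'p set \<Rightarrow> ('p \<Rightarrow> 'q) \<Rightarrow> bool" where
  "constant_on_set V J \<longleftrightarrow> (\<exists>A. \<forall>x\<in>V. J x = A)"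


text \<open>Smooth manifolds modelled on \<open>\<real>\<^sup>n\<close>, as a topological space with a smooth atlas. The atlas
  need not be maximal, so every coordinate system of the manifold may be assumed to belong
  to it.\<close>

type_synonym ('m, 'n) chart = "'m set \<times> ('m \<Rightarrow> real^'n)"

definition transition ::
  "('m, 'n::finite) chart \<Rightarrow> ('m, 'n) chart \<Rightarrow> real^'n \<Rightarrow> real^'n" where
  "transition c c' = (\<lambda>x. snd c' (inv_into (fst c) (snd c) x))"

definition smooth_manifold :: "'m topology \<Rightarrow> ('m, 'n::finite) chart set \<Rightarrow> bool" where
  "smooth_manifold M \<A> \<longleftrightarrow>
     Hausdorff_space M \<and> second_countable M \<and>
     (\<Union>c\<in>\<A>. fst c) = topspace M \<and>
     (\<forall>c\<in>\<A>. openin M (fst c) \<and> open (snd c ` fst c) \<and>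
        homeomorphic_map (subtopology M (fst c)) (top_of_set (snd c ` fst c)) (snd c)) \<and>
     (\<forall>c\<in>\<A>. \<forall>c'\<in>\<A>. smooth_on (snd c ` (fst c \<inter> fst c')) (transition c c'))"

text \<open>The map induced on \<open>T \<oplus> T\<^sup>*\<close> by a local diffeomorphism with Jacobian \<open>A\<close>: vectors are
  transformed by \<open>A\<close>, covectors by the inverse transpose.\<close>

definition gen_push :: "real^'n^'n::finite \<Rightarrow> real ^ ('n + 'n) \<Rightarrow> real ^ ('n + 'n)" where
  "gen_push A u = mk_gen (A *v anchor u) (transpose (matrix_inv A) *v formpart u)"

text \<open>An endomorphism of \<open>TM \<oplus> T\<^sup>*M\<close> is given by its matrices in the coordinate frames of all
  charts, related by the tensorial transformation law. The pairing and the bracket are natural,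
  so orthogonality and integrability may be tested in charts.\<close>

definition gc_structure_manifold ::
  "('m, 'n::finite) chart set \<Rightarrow>
   (('m, 'n) chart \<Rightarrow> real^'n \<Rightarrow> real ^ ('n + 'n) ^ ('n + 'n)) \<Rightarrow> bool" where
  "gc_structure_manifold \<A> \<J> \<longleftrightarrow>
     (\<forall>c\<in>\<A>. gc_structure_on (snd c ` fst c) (\<J> c)) \<and>
     (\<forall>c\<in>\<A>. \<forall>c'\<in>\<A>. \<forall>x \<in> snd c ` (fst c \<inter> fst c'). \<forall>u.
        let A = matrix (frechet_derivative (transition c c') (at x))
        in \<J> c' (transition c c' x) *v gen_push A u = gen_push A (\<J> c x *v u))"


text \<open>The eigenbundle \<open>L\<close>, sections of \<open>L\<close> and of its dual. A covector on \<open>L\<^sub>x\<close> is represented by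
  a function on the ambient complexified fibre of which only the values on \<open>L\<^sub>x\<close> matter.\<close>

definition cmat :: "real^'k^'k \<Rightarrow> complex^'k^'k::finite" where
  "cmat A = map_matrix complex_of_real A"

definition Lfib :: "real^'k^'k \<Rightarrow> (complex^'k::finite) set" where
  "Lfib A = {v. cmat A *v v = \<i> *s v}"

definition L_section ::
  "(real^'n::finite) set \<Rightarrow> (real^'n \<Rightarrow> real ^ ('n + 'n) ^ ('n + 'n)) \<Rightarrow>
   (real^'n \<Rightarrow> complex ^ ('n + 'n)) \<Rightarrow> bool" where
  "L_section V J \<sigma> \<longleftrightarrow> smooth_on V \<sigma> \<and> (\<forall>x\<in>V. \<sigma> x \<in> Lfib (J x))"

definition covector_on :: "(complex^'k::finite) set \<Rightarrow> (complex^'k \<Rightarrow> complex) \<Rightarrow> bool" where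
  "covector_on S \<alpha> \<longleftrightarrow>
     (\<forall>u\<in>S. \<forall>v\<in>S. \<alpha> (u + v) = \<alpha> u + \<alpha> v) \<and> (\<forall>c. \<forall>v\<in>S. \<alpha> (c *s v) = c * \<alpha> v)"

definition Ldual_section ::
  "(real^'n::finite) set \<Rightarrow> (real^'n \<Rightarrow> real ^ ('n + 'n) ^ ('n + 'n)) \<Rightarrow>
   (real^'n \<Rightarrow> complex ^ ('n + 'n) \<Rightarrow> complex) \<Rightarrow> bool" where
  "Ldual_section V J \<beta> \<longleftrightarrow>
     (\<forall>x\<in>V. covector_on (Lfib (J x)) (\<beta> x)) \<and>
     (\<forall>\<sigma>. L_section V J \<sigma> \<longrightarrow> smooth_on V (\<lambda>x. \<beta> x (\<sigma> x)))"

text \<open>The rank of \<open>L\<close> is half of that of the ambient bundle, so frames are indexed by \<open>'n\<close>.\<close>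

definition Ldual_frame ::
  "(real^'n::finite) set \<Rightarrow> (real^'n \<Rightarrow> real ^ ('n + 'n) ^ ('n + 'n)) \<Rightarrow>
   ('n \<Rightarrow> real^'n \<Rightarrow> complex ^ ('n + 'n) \<Rightarrow> complex) \<Rightarrow> bool" where
  "Ldual_frame W J \<epsilon> \<longleftrightarrow>
     (\<forall>k. Ldual_section W J (\<epsilon> k)) \<and>
     (\<forall>x\<in>W. \<forall>\<alpha>. covector_on (Lfib (J x)) \<alpha> \<longrightarrow>
        (\<exists>!c::complex^'n. \<forall>v\<in>Lfib (J x). \<alpha> v = (\<Sum>k\<in>UNIV. c $ k * \<epsilon> k x v)))"

definition jet1_vanishes_at_0 ::
  "(real^'n::finite) set \<Rightarrow> (real^'n \<Rightarrow> real ^ ('n + 'n) ^ ('n + 'n)) \<Rightarrow>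
   (real^'n \<Rightarrow> complex ^ ('n + 'n) \<Rightarrow> complex) \<Rightarrow> bool" where
  "jet1_vanishes_at_0 V J \<beta> \<longleftrightarrow>
     (\<exists>W \<epsilon> (b :: 'n \<Rightarrow> real^'n \<Rightarrow> complex).
        open W \<and> 0 \<in> W \<and> W \<subseteq> V \<and> Ldual_frame W J \<epsilon> \<and>
        (\<forall>x\<in>W. \<forall>v\<in>Lfib (J x). \<beta> x v = (\<Sum>k\<in>UNIV. b k x * \<epsilon> k x v)) \<and>
        (\<forall>k. b k 0 = 0) \<and>
        (\<forall>k. (b k has_derivative (\<lambda>_. 0)) (at 0)))"

text \<open>The Lie algebroid differential on 1-cochains, evaluated on two sections of \<open>L\<close>.\<close>

definition dL ::
  "(real^'n::finite \<Rightarrow> complex ^ ('n + 'n) \<Rightarrow> complex) \<Rightarrow>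
   (real^'n \<Rightarrow> complex ^ ('n + 'n)) \<Rightarrow> (real^'n \<Rightarrow> complex ^ ('n + 'n)) \<Rightarrow> real^'n \<Rightarrow> complex" where
  "dL \<beta> \<sigma> \<tau> x =
     vf_apply (\<lambda>y. anchor (\<sigma> y)) (\<lambda>y. \<beta> y (\<tau> y)) x
     - vf_apply (\<lambda>y. anchor (\<tau> y)) (\<lambda>y. \<beta> y (\<sigma> y)) x
     - \<beta> x (courant_bracket \<sigma> \<tau> x)"

definition Jt ::
  "(real^'n::finite \<Rightarrow> real ^ ('n + 'n) ^ ('n + 'n)) \<Rightarrow> real \<Rightarrow> real^'n \<Rightarrow> real ^ ('n + 'n) ^ ('n + 'n)"
  where "Jt J t x = J (t *\<^sub>R x)"

definition Jdot1 ::
  "(real^'n::finite \<Rightarrow> real ^ ('n + 'n) ^ ('n + 'n)) \<Rightarrow> real^'n \<Rightarrow> real ^ ('n + 'n) ^ ('n + 'n)" where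
  "Jdot1 J x = vector_derivative (\<lambda>t. Jt J t x) (at 1 within {0..1})"

definition omega_dot1 ::
  "(real^'n::finite \<Rightarrow> real ^ ('n + 'n) ^ ('n + 'n)) \<Rightarrow>
   real^'n \<Rightarrow> complex ^ ('n + 'n) \<Rightarrow> complex ^ ('n + 'n) \<Rightarrow> complex" where
  "omega_dot1 J x v w = pairing v (cmat (Jdot1 J x) *v w)"


text \<open>Isomorphisms from the Courant algebroid over \<open>V\<close> to the one over \<open>V'\<close>: a bundle isomorphism
  with matrices \<open>\<Phi> x\<close> (from the fibre at \<open>x\<close> to the fibre at \<open>f x\<close>) covering a
  diffeomorphism \<open>f\<close>. For \<open>V = V'\<close> these are the automorphisms.\<close>

definition push_section ::
  "(real^'n::finite) set \<Rightarrow> (real^'n \<Rightarrow> real^'n) \<Rightarrow> (real^'n \<Rightarrow> real ^ ('n + 'n) ^ ('n + 'n)) \<Rightarrow>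
   (real^'n \<Rightarrow> real ^ ('n + 'n)) \<Rightarrow> real^'n \<Rightarrow> real ^ ('n + 'n)" where
  "push_section V f \<Phi> s y = \<Phi> (inv_into V f y) *v s (inv_into V f y)"

definition courant_iso ::
  "(real^'n::finite) set \<Rightarrow> (real^'n) set \<Rightarrow> (real^'n \<Rightarrow> real^'n) \<Rightarrow>
   (real^'n \<Rightarrow> real ^ ('n + 'n) ^ ('n + 'n)) \<Rightarrow> bool" where
  "courant_iso V V' f \<Phi> \<longleftrightarrow>
     bij_betw f V V' \<and> smooth_on V f \<and> smooth_on V' (inv_into V f) \<and>
     (\<forall>i j. smooth_on V (\<lambda>x. \<Phi> x $ i $ j)) \<and> (\<forall>x\<in>V. invertible (\<Phi> x)) \<and>
     (\<forall>x\<in>V. \<forall>u v. pairing (\<Phi> x *v u) (\<Phi> x *v v) = pairing u v) \<and>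
     (\<forall>x\<in>V. \<forall>u. anchor (\<Phi> x *v u) = frechet_derivative f (at x) (anchor u)) \<and>
     (\<forall>s r. smooth_on V s \<longrightarrow> smooth_on V r \<longrightarrow>
        (\<forall>y\<in>V'. courant_bracket (push_section V f \<Phi> s) (push_section V f \<Phi> r) y
                = push_section V f \<Phi> (courant_bracket s r) y))"

definition gc_isomorphic ::
  "(real^'n::finite) set \<Rightarrow> (real^'n \<Rightarrow> real ^ ('n + 'n) ^ ('n + 'n)) \<Rightarrow>
   (real^'n) set \<Rightarrow> (real^'n \<Rightarrow> real ^ ('n + 'n) ^ ('n + 'n)) \<Rightarrow> bool" where
  "gc_isomorphic V J V' J' \<longleftrightarrow>
     (\<exists>f \<Phi>. courant_iso V' V f \<Phi> \<and> (\<forall>x\<in>V'. matrix_inv (\<Phi> x) ** J (f x) ** \<Phi> x = J' x))"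

text \<open>Isomorphism to a constant structure is understood after shrinking the neighbourhood \<open>U\<close> of
  the origin to a smaller ball, as for every local normal form obtained from a flow. Over all of \<open>U\<close>
  it fails: on the unit disc, the structure of a symplectic form of infinite area admits a \<open>\<beta>\<close> as
  in the theorem, while every constant structure of symplectic type on the disc has finite area.\<close>

definition isomorphic_to_constant_near_0 ::
  "(real^'n::finite) set \<Rightarrow> (real^'n \<Rightarrow> real ^ ('n + 'n) ^ ('n + 'n)) \<Rightarrow> bool" where
  "isomorphic_to_constant_near_0 U J \<longleftrightarrow>
     (\<exists>r V' J'. 0 < r \<and> ball 0 r \<subseteq> U \<and> open V' \<and> gc_structure_on V' J' \<and> constant_on_set V' J' \<and>
        gc_isomorphic (ball 0 r) J V' J')"

end

theory Submission
  imports Defs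
begin

text \<open>
  Everything is homogeneous under the dilations \<open>x \<mapsto> tx\<close>, so the time-dependent Moser argument
  becomes a single equation for the Euler field \<open>E = \<Sum> x\<^sub>l \<partial>\<^sub>l\<close>. The primitive \<open>\<beta>\<close> corresponds to
  a real section \<open>b = X + \<xi>\<close> of \<open>TM \<oplus> T\<^sup>*M\<close> with vanishing 1-jet at the origin and
  \<open>\<L>\<^sub>b J = - E J\<close>. The section of the deformation at time \<open>t\<close> is \<open>t\<^sup>-\<^sup>2 b(tx)\<close>, its flow is
  \<open>h(tx)/t\<close>, where \<open>E h = h + X \<circ> h\<close>, \<open>h(0) = 0\<close>, \<open>Dh(0) = 1\<close>, and the accompanying \<open>B\<close>-field at
  time \<open>t\<close> is \<open>B(tx)\<close>, where \<open>B = d\<theta>\<close> and \<open>E \<theta>\<^sub>i = \<theta>\<^sub>i + (h\<^sup>*\<xi>)\<^sub>i\<close>. The map \<open>\<Phi>\<close> built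
  from \<open>Dh\<close> and \<open>B\<close> then makes \<open>\<Phi>\<^sup>-\<^sup>1 (J \<circ> h) \<Phi>\<close> constant along rays.

  The equation for \<open>h\<close> is solved by iteration. The iterates are smooth, and their derivatives of
  order \<open>k \<ge> 2\<close> solve linear equations \<open>E W + (k - 1) W = A W + G\<close> with the same small \<open>A\<close>, so they
  converge uniformly on one ball for all \<open>k\<close>.
\<close>

section \<open>Calculus of iterated partial derivatives\<close>

text \<open>The Euler field multiplies homogeneous polynomials of degree k by k, so E - 1
  annihilates the linear ones and the equation for h is resonant exactly in degree 1. This is where
  the 1-jet condition enters: if b vanishes to second order at 0, so do X o h and the pull-back of
  xi, each step of the iteration is solvable, and the linear part of h is free and is set to the
  identity. The same condition makes t^-2 b(tx) smooth down to t = 0. The commutator of d_l and E is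
  d_l, so one derivative turns E - 1 into E and a second one turns it into E + 1. For integers c
  \<ge> 1 the operator E + c has an inverse bounded by 1 in the supremum norm on every ball about 0,
  so higher derivatives never force the ball to shrink. E itself is inverted only up to constants,
  and only for right-hand sides bounded by a multiple of |x|. Hence values and first derivatives
  need a contraction of their own, which together with the smallness of A fixes the radius.\<close>

lemma has_derivative_pd:
  fixes f :: "real^'n::finite \<Rightarrow> 'b::real_normed_vector"
  assumes "f differentiable (at x)"
  shows "(f has_derivative (\<lambda>u. \<Sum>l\<in>UNIV. u $ l *\<^sub>R pd l f x)) (at x)"
proof -
  let ?D = "frechet_derivative f (at x)"
  have D: "(f has_derivative ?D) (at x)"
    using assms by (simp add: frechet_derivative_works)
  then interpret bounded_linear ?D by (rule has_derivative_bounded_linear)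
  have "?D u = (\<Sum>l\<in>UNIV. u $ l *\<^sub>R pd l f x)" for u
  proof -
    have "?D u = ?D (\<Sum>l\<in>UNIV. u $ l *\<^sub>R axis l 1)"
      using basis_expansion[of u] by (simp add: scalar_mult_eq_scaleR)
    also have "\<dots> = (\<Sum>l\<in>UNIV. u $ l *\<^sub>R pd l f x)"
      by (simp add: sum scaleR pd_def)
    finally show ?thesis .
  qed
  then have "?D = (\<lambda>u. \<Sum>l\<in>UNIV. u $ l *\<^sub>R pd l f x)" by blast
  with D show ?thesis by simp
qed

lemma pd_eqI:
  assumes "(f has_derivative D) (at x)"
  shows "pd l f x = D (axis l 1)"
  using frechet_derivative_at[OF assms] by (simp add: pd_def)

lemma pd_cong:
  assumes "open S" "x \<in> S" "\<And>y. y \<in> S \<Longrightarrow> f y = g y"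
  shows "pd l f x = pd l g x"
proof (cases "f differentiable (at x)")
  case True
  then show ?thesis
    using frechet_derivative_transform_within_open[OF True assms(1,2,3)] by (simp add: pd_def)
next
  case False
  \<comment> \<open>\<open>frechet_derivative\<close> is a choice from the maps satisfying this
    predicate, so equal predicates give equal choices even where neither function is
    differentiable.\<close>
  have "(f has_derivative D) (at x) \<longleftrightarrow> (g has_derivative D) (at x)" for D
    using has_derivative_transform_within_open[of f D x UNIV S g]
      has_derivative_transform_within_open[of g D x UNIV S f] assms by metis
  then show ?thesis by (simp add: pd_def frechet_derivative_def)
qed

lemma differentiable_cong_open:
  assumes "open S" "x \<in> S" "\<And>y. y \<in> S \<Longrightarrow> f y = g y" "f differentiable (at x)"
  shows "g differentiable (at x)"
  using assms has_derivative_transform_within_open[of f _ x UNIV S g]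
  unfolding differentiable_def by blast

text \<open>The rules for \<open>pd\<close> hold only where the functions are differentiable, that
  is on S. Every induction over \<open>Cdiff\<close> below therefore replaces a partial derivative
  by an explicit expression on S only; as S is open, this does not affect further
  derivatives.\<close>

lemma Cdiff_cong:
  assumes "open S" "\<And>y. y \<in> S \<Longrightarrow> f y = g y" "Cdiff k S f"
  shows "Cdiff k S g"
  using assms(2,3)
proof (induction k arbitrary: f g)
  case 0
  then show ?case by (simp cong: continuous_on_cong)
next
  case (Suc k)
  have "Cdiff k S (pd l g)" for l
  proof (rule Suc.IH)
    show "pd l f y = pd l g y" if "y \<in> S" for y
      by (rule pd_cong[OF assms(1) that]) (rule Suc.prems(1))
  qed (use Suc.prems in simp)
  moreover have "g differentiable (at x)" if "x \<in> S" for x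
    using differentiable_cong_open[OF assms(1) that, of f g] Suc.prems that by auto
  ultimately show ?case by simp
qed

lemma smooth_on_cong:
  assumes "open S" "\<And>y. y \<in> S \<Longrightarrow> f y = g y" "smooth_on S f"
  shows "smooth_on S g"
  using assms(3) by (simp add: smooth_on_def Cdiff_cong[OF assms(1,2)])

lemma Cdiff_subset: "Cdiff k S f \<Longrightarrow> T \<subseteq> S \<Longrightarrow> Cdiff k T f"
  by (induction k arbitrary: f) (auto intro: continuous_on_subset)

lemma smooth_on_subset: "smooth_on S f \<Longrightarrow> T \<subseteq> S \<Longrightarrow> smooth_on T f"
  using Cdiff_subset[of _ S f T] by (auto simp: smooth_on_def)

lemma Cdiff_SucD: "Cdiff (Suc k) S f \<Longrightarrow> Cdiff k S f"
proof (induction k arbitrary: f)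
  case 0
  then show ?case
    by (auto intro!: differentiable_imp_continuous_on
        simp: differentiable_on_def differentiable_at_withinI)
next
  case (Suc k)
  then have "\<forall>x\<in>S. f differentiable (at x)" "\<And>l. Cdiff (Suc k) S (pd l f)" by auto
  then show ?case using Suc.IH by simp
qed

lemma smooth_on_pd: "smooth_on S f \<Longrightarrow> smooth_on S (pd l f)"
  using Cdiff.simps(2)[of _ S f] by (auto simp: smooth_on_def simp del: Cdiff.simps)

lemma smooth_on_differentiable: "smooth_on S f \<Longrightarrow> x \<in> S \<Longrightarrow> f differentiable (at x)"
  using Cdiff.simps(2)[of 0 S f] by (auto simp: smooth_on_def simp del: Cdiff.simps)

lemma smooth_on_continuous: "smooth_on S f \<Longrightarrow> continuous_on S f"
  using Cdiff.simps(1)[of S f] by (auto simp: smooth_on_def simp del: Cdiff.simps)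

lemma smooth_on_isCont:
  assumes "smooth_on S f" "x \<in> S" shows "isCont f x"
  by (rule differentiable_imp_continuous_within[OF smooth_on_differentiable[OF assms]])

section \<open>Closure of smoothness under linear maps, sums, products and components\<close>

lemma pd_const [simp]: "pd l (\<lambda>x. c) = (\<lambda>x. 0)"
  by (auto simp: pd_def)

lemma Cdiff_const: "Cdiff k S (\<lambda>x. c)"
  by (induction k arbitrary: c) auto

lemma smooth_on_const: "smooth_on S (\<lambda>x. c)"
  by (simp add: smooth_on_def Cdiff_const)

lemma pd_add:
  assumes "f differentiable (at x)" "g differentiable (at x)"
  shows "pd l (\<lambda>x. f x + g x) x = pd l f x + pd l g x"
  using pd_eqI[OF has_derivative_add[OF assms[unfolded frechet_derivative_works]], of l]
  by (simp add: pd_def)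

lemma pd_linear:
  assumes "bounded_linear L" "f differentiable (at x)"
  shows "pd l (\<lambda>x. L (f x)) x = L (pd l f x)"
  using pd_eqI[OF bounded_linear.has_derivative[OF assms(1) assms(2)[unfolded frechet_derivative_works]], of l]
  by (simp add: pd_def)

lemma differentiable_linear:
  assumes "bounded_linear L" "f differentiable (at x)"
  shows "(\<lambda>x. L (f x)) differentiable (at x)"
  by (rule differentiableI[OF bounded_linear.has_derivative[OF assms(1)
        assms(2)[unfolded frechet_derivative_works]]])

lemma pd_mult:
  fixes f g :: "real^'n::finite \<Rightarrow> 'a::real_normed_algebra"
  assumes "f differentiable (at x)" "g differentiable (at x)"
  shows "pd l (\<lambda>x. f x * g x) x = f x * pd l g x + pd l f x * g x"
  using pd_eqI[OF has_derivative_mult[OF assms[unfolded frechet_derivative_works]], of l]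
  by (simp add: pd_def)

lemma pd_sum:
  assumes "\<And>i. i \<in> I \<Longrightarrow> f i differentiable (at x)"
  shows "pd l (\<lambda>x. \<Sum>i\<in>I. f i x) x = (\<Sum>i\<in>I. pd l (f i) x)"
proof -
  have "((\<lambda>x. \<Sum>i\<in>I. f i x) has_derivative (\<lambda>u. \<Sum>i\<in>I. frechet_derivative (f i) (at x) u)) (at x)"
    by (intro has_derivative_sum) (use assms in \<open>simp add: frechet_derivative_works\<close>)
  from pd_eqI[OF this, of l] show ?thesis by (simp add: pd_def)
qed

lemma pd_minus:
  assumes "f differentiable (at x)"
  shows "pd l (\<lambda>x. - f x) x = - pd l f x"
  using pd_linear[OF bounded_linear_minus[OF bounded_linear_ident] assms] by simp

lemma pd_diff:
  assumes "f differentiable (at x)" "g differentiable (at x)"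
  shows "pd l (\<lambda>x. f x - g x) x = pd l f x - pd l g x"
  using pd_eqI[OF has_derivative_diff[OF assms[unfolded frechet_derivative_works]], of l]
  by (simp add: pd_def)

lemma bounded_linear_coord: "bounded_linear (\<lambda>x::'a::real_normed_vector^'k::finite. x $ i)"
  by (rule bounded_linear_vec_nth)

lemma pd_component:
  fixes f :: "real^'n::finite \<Rightarrow> 'a::real_normed_vector^'k::finite"
  assumes "f differentiable (at x)"
  shows "pd l (\<lambda>x. f x $ i) x = pd l f x $ i"
  by (rule pd_linear[OF bounded_linear_coord assms])

lemma differentiable_component_iff:
  fixes f :: "real^'n::finite \<Rightarrow> 'a::real_normed_vector^'k::finite"
  shows "f differentiable (at x) \<longleftrightarrow> (\<forall>i. (\<lambda>x. f x $ i) differentiable (at x))"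
proof
  show "f differentiable (at x) \<Longrightarrow> \<forall>i. (\<lambda>x. f x $ i) differentiable (at x)"
    using differentiable_linear[OF bounded_linear_coord, of f x] by blast
next
  assume "\<forall>i. (\<lambda>x. f x $ i) differentiable (at x)"
  \<comment> \<open>The coordinate embeddings are bounded linear, and f is the sum of its embedded
    components.\<close>
  moreover have "bounded_linear (axis i :: 'a \<Rightarrow> 'a^'k)" for i
  proof
    show "axis i (a + b) = axis i a + (axis i b :: 'a^'k)" for a b
      by (simp add: vec_eq_iff axis_def)
    show "axis i (r *\<^sub>R a) = r *\<^sub>R (axis i a :: 'a^'k)" for r a
      by (simp add: vec_eq_iff axis_def)
    show "\<exists>K. \<forall>a. norm (axis i a :: 'a^'k) \<le> norm a * K"
    proof (intro exI[of _ 1] allI)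
      fix a :: 'a
      have "norm (axis i a :: 'a^'k) \<le> (\<Sum>j\<in>UNIV. norm ((axis i a :: 'a^'k) $ j))"
        unfolding norm_vec_def by (rule L2_set_le_sum) simp
      also have "\<dots> = norm a" by (simp add: axis_def if_distrib cong: if_cong)
      finally show "norm (axis i a :: 'a^'k) \<le> norm a * 1" by simp
    qed
  qed
  ultimately have "(\<lambda>x. axis i (f x $ i)) differentiable (at x)" for i
    using differentiable_linear[of "axis i" "\<lambda>x. f x $ i" x] by blast
  then have "(\<lambda>x. \<Sum>i\<in>UNIV. axis i (f x $ i)) differentiable (at x)"
    by (intro differentiable_sum ballI) auto
  moreover have "(\<lambda>x. \<Sum>i\<in>UNIV. axis i (f x $ i)) = f"
    by (simp add: fun_eq_iff vec_eq_iff axis_def)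
  ultimately show "f differentiable (at x)" by simp
qed

lemma Cdiff_linear:
  assumes "open S" "bounded_linear L" "Cdiff k S f"
  shows "Cdiff k S (\<lambda>x. L (f x))"
  using assms(3)
proof (induction k arbitrary: f)
  case 0
  then show ?case using bounded_linear.continuous_on[OF assms(2)] by simp
next
  case (Suc k)
  have "Cdiff k S (pd l (\<lambda>x. L (f x)))" for l
    by (rule Cdiff_cong[OF assms(1) _ Suc.IH[of "pd l f"]])
       (use Suc.prems in \<open>simp_all add: pd_linear[OF assms(2)]\<close>)
  moreover have "(\<lambda>x. L (f x)) differentiable (at x)" if "x \<in> S" for x
    by (rule differentiable_linear[OF assms(2)]) (use Suc.prems that in simp)
  ultimately show ?case by simp
qed

lemma smooth_on_linear:
  "open S \<Longrightarrow> bounded_linear L \<Longrightarrow> smooth_on S f \<Longrightarrow> smooth_on S (\<lambda>x. L (f x))"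
  using Cdiff_linear[of S L _ f] by (simp add: smooth_on_def)

lemma Cdiff_add:
  assumes "open S" "Cdiff k S f" "Cdiff k S g"
  shows "Cdiff k S (\<lambda>x. f x + g x)"
  using assms(2,3)
proof (induction k arbitrary: f g)
  case 0
  then show ?case by (simp add: continuous_on_add)
next
  case (Suc k)
  have "Cdiff k S (pd l (\<lambda>x. f x + g x))" for l
    by (rule Cdiff_cong[OF assms(1) _ Suc.IH[of "pd l f" "pd l g"]])
       (use Suc.prems in \<open>simp_all add: pd_add\<close>)
  then show ?case using Suc.prems by simp
qed

lemma smooth_on_add:
  "open S \<Longrightarrow> smooth_on S f \<Longrightarrow> smooth_on S g \<Longrightarrow> smooth_on S (\<lambda>x. f x + g x)"
  by (simp add: smooth_on_def Cdiff_add)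

lemma smooth_on_minus:
  "open S \<Longrightarrow> smooth_on S f \<Longrightarrow> smooth_on S (\<lambda>x. - f x)"
  by (rule smooth_on_linear[OF _ bounded_linear_minus[OF bounded_linear_ident]])

lemma smooth_on_diff:
  "open S \<Longrightarrow> smooth_on S f \<Longrightarrow> smooth_on S g \<Longrightarrow> smooth_on S (\<lambda>x. f x - g x)"
  using smooth_on_add[of S f "\<lambda>x. - g x"] smooth_on_minus[of S g] by simp

lemma Cdiff_sum:
  assumes "open S" "\<And>i. i \<in> I \<Longrightarrow> Cdiff k S (f i)"
  shows "Cdiff k S (\<lambda>x. \<Sum>i\<in>I. f i x)"
  using assms(2)
  by (induction I rule: infinite_finite_induct) (simp_all add: Cdiff_const Cdiff_add[OF assms(1)])

lemma smooth_on_sum: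
  "open S \<Longrightarrow> (\<And>i. i \<in> I \<Longrightarrow> smooth_on S (f i)) \<Longrightarrow> smooth_on S (\<lambda>x. \<Sum>i\<in>I. f i x)"
  by (simp add: smooth_on_def Cdiff_sum)

lemma Cdiff_mult:
  fixes f g :: "real^'n::finite \<Rightarrow> 'a::real_normed_algebra"
  assumes "open S" "Cdiff k S f" "Cdiff k S g"
  shows "Cdiff k S (\<lambda>x. f x * g x)"
  using assms(2,3)
proof (induction k arbitrary: f g)
  case 0
  then show ?case by (simp add: continuous_on_mult)
next
  case (Suc k)
  have "Cdiff k S (pd l (\<lambda>x. f x * g x))" for l
  proof (rule Cdiff_cong[OF assms(1)])
    \<comment> \<open>The Leibniz terms contain f and g themselves, now at the lower order
      k.\<close>
    show "Cdiff k S (\<lambda>x. f x * pd l g x + pd l f x * g x)"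
      using Suc.prems Cdiff_SucD[of k S f] Cdiff_SucD[of k S g]
      by (intro Cdiff_add[OF assms(1)] Suc.IH) auto
  qed (use Suc.prems in \<open>simp_all add: pd_mult\<close>)
  then show ?case using Suc.prems by auto
qed

lemma smooth_on_mult:
  fixes f g :: "real^'n::finite \<Rightarrow> 'a::real_normed_algebra"
  shows "open S \<Longrightarrow> smooth_on S f \<Longrightarrow> smooth_on S g \<Longrightarrow> smooth_on S (\<lambda>x. f x * g x)"
  by (simp add: smooth_on_def Cdiff_mult)

lemma smooth_on_prod:
  fixes f :: "'i \<Rightarrow> real^'n::finite \<Rightarrow> real"
  shows "open S \<Longrightarrow> (\<And>i. i \<in> I \<Longrightarrow> smooth_on S (f i)) \<Longrightarrow> smooth_on S (\<lambda>x. \<Prod>i\<in>I. f i x)"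
  by (induction I rule: infinite_finite_induct) (simp_all add: smooth_on_const smooth_on_mult)

lemma Cdiff_component_iff:
  fixes f :: "real^'n::finite \<Rightarrow> 'a::real_normed_vector^'k::finite"
  assumes "open S"
  shows "Cdiff k S f \<longleftrightarrow> (\<forall>i. Cdiff k S (\<lambda>x. f x $ i))"
proof
  show "Cdiff k S f \<Longrightarrow> \<forall>i. Cdiff k S (\<lambda>x. f x $ i)"
    using Cdiff_linear[OF assms bounded_linear_coord, of k f] by blast
next
  show "\<forall>i. Cdiff k S (\<lambda>x. f x $ i) \<Longrightarrow> Cdiff k S f"
  proof (induction k arbitrary: f)
    case 0
    then show ?case using continuous_on_vec_lambda[of S "\<lambda>i x. f x $ i"] by simp
  next
    case (Suc k)
    have d: "\<forall>x\<in>S. f differentiable (at x)"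
      using Suc.prems by (auto simp: differentiable_component_iff)
    have "Cdiff k S (pd l f)" for l
    proof (rule Suc.IH, rule)
      fix i
      show "Cdiff k S (\<lambda>x. pd l f x $ i)"
        by (rule Cdiff_cong[OF assms, of "pd l (\<lambda>x. f x $ i)"])
           (use d Suc.prems in \<open>simp_all add: pd_component\<close>)
    qed
    with d show ?case by simp
  qed
qed

lemma smooth_on_component_iff:
  fixes f :: "real^'n::finite \<Rightarrow> 'a::real_normed_vector^'k::finite"
  shows "open S \<Longrightarrow> smooth_on S f = (\<forall>i. smooth_on S (\<lambda>x. f x $ i))"
  using Cdiff_component_iff[of S _ f] by (auto simp: smooth_on_def)

lemma pd_id: "pd l (\<lambda>x. x) x = axis l 1"
  using pd_eqI[OF has_derivative_ident] .

lemma smooth_on_id: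
  fixes S :: "(real^'n::finite) set"
  shows "smooth_on S (\<lambda>x. x)"
  unfolding smooth_on_def
proof
  fix k show "Cdiff k S (\<lambda>x::real^'n. x)"
  proof (cases k)
    case (Suc j)
    have "pd l (\<lambda>x::real^'n. x) = (\<lambda>x. axis l 1)" for l by (auto simp: pd_id)
    then show ?thesis using Suc by (simp add: Cdiff_const)
  qed (simp add: continuous_on_id)
qed

lemma smooth_on_coord: "open S \<Longrightarrow> smooth_on S (\<lambda>x. x $ i)"
  by (rule smooth_on_linear[OF _ bounded_linear_coord smooth_on_id])

section \<open>Chain rule, compositions and reciprocals\<close>

lemma has_derivative_chain:
  fixes \<phi> :: "real^'m::finite \<Rightarrow> 'b::real_normed_vector" and g :: "real^'n::finite \<Rightarrow> real^'m"
  assumes "g differentiable (at x)" "\<phi> differentiable (at (g x))"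
  shows "((\<lambda>x. \<phi> (g x)) has_derivative
     (\<lambda>u. \<Sum>j\<in>UNIV. (\<Sum>l\<in>UNIV. u $ l *\<^sub>R pd l g x) $ j *\<^sub>R pd j \<phi> (g x))) (at x)"
  using has_derivative_compose[OF has_derivative_pd[OF assms(1)] has_derivative_pd[OF assms(2)]] .

lemma differentiable_chain:
  fixes \<phi> :: "real^'m::finite \<Rightarrow> 'b::real_normed_vector" and g :: "real^'n::finite \<Rightarrow> real^'m"
  assumes "g differentiable (at x)" "\<phi> differentiable (at (g x))"
  shows "(\<lambda>x. \<phi> (g x)) differentiable (at x)"
  by (rule differentiableI[OF has_derivative_chain[OF assms]])

lemma pd_chain:
  fixes \<phi> :: "real^'m::finite \<Rightarrow> 'b::real_normed_vector" and g :: "real^'n::finite \<Rightarrow> real^'m"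
  assumes "g differentiable (at x)" "\<phi> differentiable (at (g x))"
  shows "pd l (\<lambda>x. \<phi> (g x)) x = (\<Sum>j\<in>UNIV. pd l g x $ j *\<^sub>R pd j \<phi> (g x))"
proof -
  have "(\<Sum>k\<in>UNIV. axis l 1 $ k *\<^sub>R pd k g x) = (\<Sum>k\<in>UNIV. if k = l then pd k g x else 0)"
    by (intro sum.cong) (auto simp: axis_def)
  then show ?thesis
    using pd_eqI[OF has_derivative_chain[OF assms], of l] by simp
qed

text \<open>The outer function is smooth while the inner one has a fixed finite order. This
  asymmetry serves the bootstrap for inverse maps, where the order of the inner map is all that the
  induction hypothesis provides.\<close>

lemma Cdiff_compose:
  fixes \<phi> :: "real^'n::finite \<Rightarrow> real" and g :: "real^'n \<Rightarrow> real^'n"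
  assumes "open S" "open T" "g ` S \<subseteq> T" "smooth_on T \<phi>" "Cdiff k S g"
  shows "Cdiff k S (\<lambda>x. \<phi> (g x))"
  using assms(4,5)
proof (induction k arbitrary: \<phi>)
  case 0
  then show ?case
    using continuous_on_compose2[OF smooth_on_continuous[OF 0(1)] _ assms(3)] by simp
next
  case (Suc k)
  have d: "g differentiable (at x)" "\<phi> differentiable (at (g x))" if "x \<in> S" for x
    using that Suc.prems assms(3) smooth_on_differentiable by auto
  have "Cdiff k S (pd l (\<lambda>x. \<phi> (g x)))" for l
  proof (rule Cdiff_cong[OF assms(1)])
    show "Cdiff k S (\<lambda>x. \<Sum>j\<in>UNIV. pd l g x $ j * pd j \<phi> (g x))"
      using Suc.prems Cdiff_SucD[of k S g] Cdiff_component_iff[OF assms(1)]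
      by (intro Cdiff_sum Cdiff_mult Suc.IH smooth_on_pd assms(1)) auto
  qed (simp add: pd_chain d)
  moreover have "(\<lambda>x. \<phi> (g x)) differentiable (at x)" if "x \<in> S" for x
    by (rule differentiable_chain) (use d that in auto)
  ultimately show ?case by simp
qed

lemma smooth_on_compose:
  fixes \<phi> :: "real^'n::finite \<Rightarrow> real" and g :: "real^'n \<Rightarrow> real^'n"
  assumes "open S" "open T" "g ` S \<subseteq> T" "smooth_on T \<phi>" "smooth_on S g"
  shows "smooth_on S (\<lambda>x. \<phi> (g x))"
  using Cdiff_compose[OF assms(1-4)] assms(5) unfolding smooth_on_def[of S] by blast

text \<open>A bootstrap: the derivative of 1/f is a product of 1/f, a derivative of f and 1/f again,
  so order k for 1/f yields order k + 1.\<close>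

lemma smooth_on_inverse:
  fixes f :: "real^'n::finite \<Rightarrow> real"
  assumes "open S" "smooth_on S f" "\<And>x. x \<in> S \<Longrightarrow> f x \<noteq> 0"
  shows "smooth_on S (\<lambda>x. inverse (f x))"
  unfolding smooth_on_def
proof
  fix k show "Cdiff k S (\<lambda>x. inverse (f x))"
  proof (induction k)
    case 0
    then show ?case using assms smooth_on_continuous by (auto intro!: continuous_on_inverse)
  next
    case (Suc k)
    have D: "((\<lambda>x. inverse (f x)) has_derivative
      (\<lambda>u. - (inverse (f x) * frechet_derivative f (at x) u * inverse (f x)))) (at x)" if "x \<in> S" for x
      using smooth_on_differentiable[OF assms(2) that] assms(3)[OF that]
      by (intro Deriv.has_derivative_inverse) (auto simp: frechet_derivative_works)
    have "Cdiff k S (pd l (\<lambda>x. inverse (f x)))" for l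
    proof (rule Cdiff_cong[OF assms(1)])
      have "Cdiff k S (pd l f)" using smooth_on_pd[OF assms(2)] by (simp add: smooth_on_def)
      then show "Cdiff k S (\<lambda>x. - (inverse (f x) * pd l f x * inverse (f x)))"
        by (intro Cdiff_linear[OF assms(1) bounded_linear_minus[OF bounded_linear_ident]]
            Cdiff_mult assms(1) Suc.IH)
      show "- (inverse (f y) * pd l f y * inverse (f y)) = pd l (\<lambda>x. inverse (f x)) y" if "y \<in> S" for y
        using pd_eqI[OF D[OF that], of l] by (simp add: pd_def)
    qed
    moreover have "(\<lambda>x. inverse (f x)) differentiable (at x)" if "x \<in> S" for x
      by (rule differentiableI[OF D[OF that]])
    ultimately show ?case by simp
  qed
qed

lemma smooth_on_divide:
  fixes f g :: "real^'n::finite \<Rightarrow> real"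
  assumes "open S" "smooth_on S f" "smooth_on S g" "\<And>x. x \<in> S \<Longrightarrow> g x \<noteq> 0"
  shows "smooth_on S (\<lambda>x. f x / g x)"
  using smooth_on_mult[OF assms(1,2) smooth_on_inverse[OF assms(1,3,4)]]
  by (simp add: divide_inverse)

section \<open>The Euler operator and radial means\<close>

text \<open>The mean value theorem is applied twice: in direction k to the difference \<psi> of f
  along two parallel segments, then in direction l to the k-th partial derivative. The left-hand
  side is symmetric in k and l, which yields the symmetry of second derivatives.\<close>

lemma second_difference:
  fixes f :: "real^'n::finite \<Rightarrow> real"
  assumes "smooth_on S f" "0 < h"
    and S: "\<And>a b. 0 \<le> a \<Longrightarrow> a \<le> h \<Longrightarrow> 0 \<le> b \<Longrightarrow> b \<le> h \<Longrightarrow> x + a *\<^sub>R axis k 1 + b *\<^sub>R axis l 1 \<in> S"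
  shows "\<exists>a b. 0 \<le> a \<and> a \<le> h \<and> 0 \<le> b \<and> b \<le> h \<and>
    f (x + h *\<^sub>R axis k 1 + h *\<^sub>R axis l 1) - f (x + h *\<^sub>R axis k 1) - f (x + h *\<^sub>R axis l 1) + f x
    = h\<^sup>2 * pd l (pd k f) (x + a *\<^sub>R axis k 1 + b *\<^sub>R axis l 1)"
proof -
  have line: "((\<lambda>a. g (y + a *\<^sub>R axis m 1)) has_real_derivative pd m g (y + a *\<^sub>R axis m 1)) (at a)"
    if "smooth_on S g" "y + a *\<^sub>R axis m 1 \<in> S" for g :: "real^'n \<Rightarrow> real" and y a m
  proof -
    let ?D = "frechet_derivative g (at (y + a *\<^sub>R axis m 1))"
    have D: "(g has_derivative ?D) (at (y + a *\<^sub>R axis m 1))"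
      using smooth_on_differentiable[OF that] by (simp add: frechet_derivative_works)
    have "((\<lambda>a. y + a *\<^sub>R axis m 1) has_derivative (\<lambda>t. t *\<^sub>R axis m 1)) (at a)"
      by (auto intro!: derivative_eq_intros)
    from has_derivative_compose[OF this D]
    have "((\<lambda>a. g (y + a *\<^sub>R axis m 1)) has_derivative (\<lambda>t. ?D (t *\<^sub>R axis m 1))) (at a)" .
    moreover have "?D (t *\<^sub>R axis m 1) = pd m g (y + a *\<^sub>R axis m 1) * t" for t
      using linear_scale[OF bounded_linear.linear[OF has_derivative_bounded_linear[OF D]]]
      by (simp add: pd_def)
    ultimately show ?thesis by (simp add: has_field_derivative_def)
  qed
  define \<psi> where "\<psi> a = f ((x + h *\<^sub>R axis l 1) + a *\<^sub>R axis k 1) - f (x + a *\<^sub>R axis k 1)" for a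
  have 1: "(\<psi> has_real_derivative
      pd k f ((x + h *\<^sub>R axis l 1) + a *\<^sub>R axis k 1) - pd k f (x + a *\<^sub>R axis k 1)) (at a)"
    if "0 \<le> a" "a \<le> h" for a
    unfolding \<psi>_def using S[OF that, of 0] S[OF that, of h] assms(2)
    by (intro DERIV_diff line assms(1)) (simp_all add: add_ac)
  obtain a where a: "0 < a" "a < h" "\<psi> h - \<psi> 0 = h * (pd k f ((x + h *\<^sub>R axis l 1) + a *\<^sub>R axis k 1)
      - pd k f (x + a *\<^sub>R axis k 1))"
    using MVT2[OF assms(2) 1] by auto
  have 2: "((\<lambda>b. pd k f ((x + a *\<^sub>R axis k 1) + b *\<^sub>R axis l 1)) has_real_derivative
      pd l (pd k f) ((x + a *\<^sub>R axis k 1) + b *\<^sub>R axis l 1)) (at b)" if "0 \<le> b" "b \<le> h" for b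
    using S[of a b] a that by (intro line smooth_on_pd assms(1)) simp
  obtain b where b: "0 < b" "b < h" "pd k f ((x + a *\<^sub>R axis k 1) + h *\<^sub>R axis l 1)
      - pd k f ((x + a *\<^sub>R axis k 1) + 0 *\<^sub>R axis l 1)
      = h * pd l (pd k f) ((x + a *\<^sub>R axis k 1) + b *\<^sub>R axis l 1)"
    using MVT2[OF assms(2) 2] by auto
  have "f (x + h *\<^sub>R axis k 1 + h *\<^sub>R axis l 1) - f (x + h *\<^sub>R axis k 1) - f (x + h *\<^sub>R axis l 1) + f x
    = \<psi> h - \<psi> 0"
    by (simp add: \<psi>_def add_ac)
  also have "\<dots> = h * (h * pd l (pd k f) ((x + a *\<^sub>R axis k 1) + b *\<^sub>R axis l 1))"
    using a(3) b(3) by (simp add: add_ac)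
  finally show ?thesis
    using a b by (intro exI[of _ a] exI[of _ b]) (simp add: power2_eq_square)
qed

lemma pd_commute:
  fixes f :: "real^'n::finite \<Rightarrow> real"
  assumes "open S" "smooth_on S f" "x \<in> S"
  shows "pd k (pd l f) x = pd l (pd k f) x"
proof (rule ccontr)
  assume ne: "pd k (pd l f) x \<noteq> pd l (pd k f) x"
  define e where "e = \<bar>pd k (pd l f) x - pd l (pd k f) x\<bar> / 2"
  have e: "e > 0" using ne by (simp add: e_def)
  have cont: "isCont (pd i (pd j f)) x" for i j
    by (intro smooth_on_isCont[OF _ assms(3)] smooth_on_pd assms(2))
  have "\<exists>d>0. \<forall>y. dist y x < d \<longrightarrow> dist (pd i (pd j f) y) (pd i (pd j f) x) < e" for i j
    using cont[of i j] e by (auto simp: continuous_at_eps_delta)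
  then obtain d where d: "\<And>i j. d i j > 0"
    "\<And>i j y. dist y x < d i j \<Longrightarrow> dist (pd i (pd j f) y) (pd i (pd j f) x) < e" by metis
  obtain r where r: "r > 0" "ball x r \<subseteq> S" using assms(1,3) openE by blast
  \<comment> \<open>All points met in the two second differences lie within 2 h of x; dividing by 3
    makes 2 h strictly smaller than each radius.\<close>
  define h where "h = min r (min (d k l) (d l k)) / 3"
  have h: "h > 0" "2 * h < r" "2 * h < d k l" "2 * h < d l k" using d(1)[of k l] d(1)[of l k] r by (auto simp: h_def)
  have near: "dist (x + a *\<^sub>R axis i 1 + b *\<^sub>R axis j 1) x \<le> 2 * h"
    if "0 \<le> a" "a \<le> h" "0 \<le> b" "b \<le> h" for a b i j
    using norm_triangle_ineq[of "a *\<^sub>R axis i (1::real)" "b *\<^sub>R axis j 1"] that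
    by (simp add: dist_norm add.assoc)
  have inS: "x + a *\<^sub>R axis i 1 + b *\<^sub>R axis j 1 \<in> S"
    if "0 \<le> a" "a \<le> h" "0 \<le> b" "b \<le> h" for a b i j
    using near[OF that, of i j] h r by (auto simp: dist_commute subset_iff)
  obtain a b where ab: "0 \<le> a" "a \<le> h" "0 \<le> b" "b \<le> h"
    "f (x + h *\<^sub>R axis k 1 + h *\<^sub>R axis l 1) - f (x + h *\<^sub>R axis k 1) - f (x + h *\<^sub>R axis l 1) + f x
    = h\<^sup>2 * pd l (pd k f) (x + a *\<^sub>R axis k 1 + b *\<^sub>R axis l 1)"
    using second_difference[OF assms(2) h(1), of x k l] inS by blast
  obtain a' b' where ab': "0 \<le> a'" "a' \<le> h" "0 \<le> b'" "b' \<le> h"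
    "f (x + h *\<^sub>R axis l 1 + h *\<^sub>R axis k 1) - f (x + h *\<^sub>R axis l 1) - f (x + h *\<^sub>R axis k 1) + f x
    = h\<^sup>2 * pd k (pd l f) (x + a' *\<^sub>R axis l 1 + b' *\<^sub>R axis k 1)"
    using second_difference[OF assms(2) h(1), of x l k] inS by blast
  have "x + h *\<^sub>R axis l 1 + h *\<^sub>R axis k 1 = x + h *\<^sub>R axis k 1 + h *\<^sub>R axis l 1" by simp
  then have "h\<^sup>2 * pd l (pd k f) (x + a *\<^sub>R axis k 1 + b *\<^sub>R axis l 1)
      = h\<^sup>2 * pd k (pd l f) (x + a' *\<^sub>R axis l 1 + b' *\<^sub>R axis k 1)"
    using ab(5) ab'(5) by (simp only:)
  then have eq: "pd l (pd k f) (x + a *\<^sub>R axis k 1 + b *\<^sub>R axis l 1)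
      = pd k (pd l f) (x + a' *\<^sub>R axis l 1 + b' *\<^sub>R axis k 1)" using h(1) by simp
  have "dist (pd l (pd k f) (x + a *\<^sub>R axis k 1 + b *\<^sub>R axis l 1)) (pd l (pd k f) x) < e"
    by (rule d(2)) (use near[OF ab(1-4), of k l] h in linarith)
  moreover have "dist (pd k (pd l f) (x + a' *\<^sub>R axis l 1 + b' *\<^sub>R axis k 1)) (pd k (pd l f) x) < e"
    by (rule d(2)) (use near[OF ab'(1-4), of l k] h in linarith)
  ultimately show False using eq unfolding e_def dist_real_def by (smt (verit) field_sum_of_halves)
qed

section \<open>The Euler operator and its behaviour along rays\<close>

definition euler :: "(real^'n::finite \<Rightarrow> 'b::real_normed_vector) \<Rightarrow> real^'n \<Rightarrow> 'b" where
  "euler f x = (\<Sum>l\<in>UNIV. x $ l *\<^sub>R pd l f x)"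

lemma ray_derivative:
  assumes "f differentiable (at (s *\<^sub>R x))"
  shows "((\<lambda>s. f (s *\<^sub>R x)) has_vector_derivative (\<Sum>l\<in>UNIV. x $ l *\<^sub>R pd l f (s *\<^sub>R x))) (at s within T)"
proof -
  have "((\<lambda>s. s *\<^sub>R x) has_vector_derivative x) (at s within T)"
    by (auto intro!: derivative_eq_intros)
  from vector_derivative_diff_chain_within[OF this has_derivative_at_withinI[OF has_derivative_pd[OF assms]]]
  show ?thesis by (simp add: o_def)
qed

lemma euler_ray: "euler f (s *\<^sub>R x) = s *\<^sub>R (\<Sum>l\<in>UNIV. x $ l *\<^sub>R pd l f (s *\<^sub>R x))"
  by (simp add: euler_def scaleR_sum_right)

lemma ball_scaleR: "x \<in> ball 0 r \<Longrightarrow> 0 \<le> s \<Longrightarrow> s \<le> 1 \<Longrightarrow> s *\<^sub>R x \<in> ball (0::'a::real_normed_vector) r"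
  using mult_left_le_one_le[of "norm x" s] by simp

text \<open>Integrating by parts along the ray shows that this is a right inverse of E + (p + 1).
  The exponent is a parameter because differentiating in x brings down one more factor s.\<close>

definition radial_mean :: "nat \<Rightarrow> (real^'n::finite \<Rightarrow> real) \<Rightarrow> real^'n \<Rightarrow> real" where
  "radial_mean p g x = integral (cbox 0 1) (\<lambda>s. s ^ p * g (s *\<^sub>R x))"

lemma radial_continuous:
  fixes g :: "real^'n::finite \<Rightarrow> real"
  assumes "continuous_on (ball 0 r) g"
  shows "continuous_on (ball 0 r \<times> cbox 0 1) (\<lambda>(x, s). s ^ p * g (s *\<^sub>R x))"
proof -
  have "continuous_on (ball 0 r \<times> cbox 0 1) (\<lambda>z. g (snd z *\<^sub>R fst z))"
  proof (rule continuous_on_compose2[OF assms])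
    show "(\<lambda>z. snd z *\<^sub>R fst z) ` (ball (0::real^'n) r \<times> cbox 0 1) \<subseteq> ball 0 r"
      using ball_scaleR[where 'a="real^'n"] by (auto simp del: mem_ball_0)
  qed (intro continuous_intros)
  then show ?thesis by (auto simp: split_beta intro!: continuous_intros)
qed

lemma radial_integrable:
  fixes g :: "real^'n::finite \<Rightarrow> real"
  assumes "continuous_on (ball 0 r) g" "x \<in> ball 0 r"
  shows "(\<lambda>s. s ^ p * g (s *\<^sub>R x)) integrable_on cbox 0 1"
proof (rule integrable_continuous)
  show "continuous_on (cbox 0 1) (\<lambda>s. s ^ p * g (s *\<^sub>R x))"
  proof (intro continuous_on_mult continuous_on_power continuous_on_id)
    show "continuous_on (cbox 0 1) (\<lambda>s. g (s *\<^sub>R x))"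
    proof (rule continuous_on_compose2[OF assms(1)])
      show "(\<lambda>s. s *\<^sub>R x) ` cbox 0 1 \<subseteq> ball 0 r"
        using ball_scaleR[OF assms(2)] by (auto simp del: mem_ball_0)
    qed (intro continuous_intros)
  qed
qed

lemma radial_mean_has_derivative:
  fixes g :: "real^'n::finite \<Rightarrow> real"
  assumes "smooth_on (ball 0 r) g" "x \<in> ball 0 r"
  shows "(radial_mean p g has_derivative (\<lambda>u. \<Sum>l\<in>UNIV. u $ l * radial_mean (Suc p) (pd l g) x)) (at x)"
proof -
  define N :: "'n \<Rightarrow> (real^'n) \<Rightarrow>\<^sub>L real" where "N l = Blinfun (\<lambda>u. u $ l)" for l
  have N: "blinfun_apply (N l) u = u $ l" for l u
    by (simp add: N_def bounded_linear_Blinfun_apply[OF bounded_linear_vec_nth])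
  \<comment> \<open>\<open>leibniz_rule\<close> wants the derivative of the integrand as a bounded
    linear function that is jointly continuous in x and s.\<close>
  define D where "D x s = (\<Sum>l\<in>UNIV. (s ^ Suc p * pd l g (s *\<^sub>R x)) *\<^sub>R N l)" for x and s :: real
  have Dapp: "blinfun_apply (D y s) u = (\<Sum>l\<in>UNIV. u $ l * (s ^ Suc p * pd l g (s *\<^sub>R y)))" for y s u
    unfolding D_def blinfun.sum_left blinfun.scaleR_left N by (simp only: real_scaleR_def mult_ac)
  have cont: "continuous_on (ball 0 r \<times> cbox 0 1) (\<lambda>(x, s). s ^ q * pd l g (s *\<^sub>R x))" for q l
    by (intro radial_continuous smooth_on_continuous smooth_on_pd assms)
  have Dcont: "continuous_on (ball 0 r \<times> cbox 0 1) (\<lambda>(x, s). D x s)"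
  proof -
    have "continuous_on (ball 0 r \<times> cbox 0 1) (\<lambda>z. (snd z ^ Suc p * pd l g (snd z *\<^sub>R fst z)) *\<^sub>R N l)" for l
      using cont[where q="Suc p" and l=l]
      by (intro continuous_on_scaleR continuous_on_const) (simp add: case_prod_unfold del: power_Suc)
    then show ?thesis unfolding D_def split_beta by (intro continuous_on_sum)
  qed
  have "((\<lambda>x. integral (cbox 0 1) (\<lambda>s. s ^ p * g (s *\<^sub>R x))) has_derivative
      blinfun_apply (integral (cbox 0 1) (D x))) (at x within ball 0 r)"
  proof (rule leibniz_rule)
    fix y :: "real^'n" and s assume y: "y \<in> ball 0 r" and s: "s \<in> cbox 0 (1::real)"
    have d: "g differentiable (at (s *\<^sub>R y))"
      using smooth_on_differentiable[OF assms(1) ball_scaleR[OF y]] s by simp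
    have "((\<lambda>x. s *\<^sub>R x) has_derivative (\<lambda>u. s *\<^sub>R u)) (at y)"
      by (auto intro!: derivative_eq_intros)
    from has_derivative_compose[OF this has_derivative_pd[OF d]]
    have "((\<lambda>x. s ^ p * g (s *\<^sub>R x)) has_derivative
      (\<lambda>u. s ^ p * (\<Sum>l\<in>UNIV. (s *\<^sub>R u) $ l *\<^sub>R pd l g (s *\<^sub>R y)))) (at y)"
      by (rule has_derivative_mult_right)
    moreover have "(\<lambda>u. s ^ p * (\<Sum>l\<in>UNIV. (s *\<^sub>R u) $ l *\<^sub>R pd l g (s *\<^sub>R y))) = blinfun_apply (D y s)"
      by (rule ext) (simp add: Dapp sum_distrib_left mult.assoc mult.left_commute)
    ultimately show "((\<lambda>x. s ^ p * g (s *\<^sub>R x)) has_derivative blinfun_apply (D y s)) (at y within ball 0 r)"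
      by (simp add: has_derivative_at_withinI)
  next
    show "(\<lambda>s. s ^ p * g (s *\<^sub>R y)) integrable_on cbox 0 1" if "y \<in> ball 0 r" for y :: "real^'n"
      by (rule radial_integrable[OF smooth_on_continuous[OF assms(1)] that])
  qed (use Dcont assms in auto)
  moreover have "blinfun_apply (integral (cbox 0 1) (D x)) u = (\<Sum>l\<in>UNIV. u $ l * radial_mean (Suc p) (pd l g) x)" for u
  proof -
    have Dx: "D x integrable_on cbox 0 1"
    proof (rule integrable_continuous)
      show "continuous_on (cbox 0 1) (D x)"
        using continuous_on_compose2[OF Dcont, of "cbox 0 1" "Pair x"] assms(2)
        by (simp add: image_subset_iff continuous_on_Pair)
    qed
    have int: "(\<lambda>s. s ^ Suc p * pd l g (s *\<^sub>R x)) integrable_on cbox 0 1" for l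
      by (rule radial_integrable[OF smooth_on_continuous[OF smooth_on_pd[OF assms(1)]] assms(2)])
    have "blinfun_apply (integral (cbox 0 1) (D x)) u = integral (cbox 0 1) (\<lambda>s. blinfun_apply (D x s) u)"
      using integral_linear[OF Dx blinfun.bounded_linear_left, of u] by (simp add: o_def)
    also have "\<dots> = integral (cbox 0 1) (\<lambda>s. \<Sum>l\<in>UNIV. u $ l * (s ^ Suc p * pd l g (s *\<^sub>R x)))"
      by (simp only: Dapp)
    also have "\<dots> = (\<Sum>l\<in>UNIV. integral (cbox 0 1) (\<lambda>s. u $ l * (s ^ Suc p * pd l g (s *\<^sub>R x))))"
      by (rule integral_sum) (simp, rule integrable_on_mult_right[OF int])
    also have "\<dots> = (\<Sum>l\<in>UNIV. u $ l * radial_mean (Suc p) (pd l g) x)"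
      unfolding radial_mean_def by (simp only: integral_mult_right)
    finally show ?thesis .
  qed
  then have "blinfun_apply (integral (cbox 0 1) (D x)) = (\<lambda>u. \<Sum>l\<in>UNIV. u $ l * radial_mean (Suc p) (pd l g) x)"
    by (rule ext)
  ultimately show ?thesis
    unfolding at_within_open[OF assms(2) open_ball] radial_mean_def[of p, abs_def] by (simp only:)
qed

lemma pd_radial_mean:
  assumes "smooth_on (ball 0 r) g" "x \<in> ball 0 r"
  shows "pd l (radial_mean p g) x = radial_mean (Suc p) (pd l g) x"
proof -
  have "(\<Sum>k\<in>UNIV. axis l 1 $ k * radial_mean (Suc p) (pd k g) x)
    = (\<Sum>k\<in>UNIV. if k = l then radial_mean (Suc p) (pd k g) x else 0)"
    by (intro sum.cong) (auto simp: axis_def)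
  then show ?thesis using pd_eqI[OF radial_mean_has_derivative[OF assms], of l] by simp
qed

text \<open>Each derivative replaces g by a partial derivative and p by p + 1, so the induction has
  to run over all g and p at once.\<close>

lemma smooth_on_radial_mean:
  assumes "smooth_on (ball 0 r) g"
  shows "smooth_on (ball 0 r) (radial_mean p g)"
  unfolding smooth_on_def
proof
  fix k show "Cdiff k (ball 0 r) (radial_mean p g)"
    using assms
  proof (induction k arbitrary: g p)
    case 0
    then show ?case
      using integral_continuous_on_param[OF radial_continuous[OF smooth_on_continuous[OF 0]]]
      by (simp add: radial_mean_def[abs_def])
  next
    case (Suc k)
    have "Cdiff k (ball 0 r) (pd l (radial_mean p g))" for l
      by (rule Cdiff_cong[OF open_ball pd_radial_mean[symmetric, OF Suc.prems] Suc.IH[OF smooth_on_pd[OF Suc.prems]]])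
    then show ?case
      using differentiableI[OF radial_mean_has_derivative[OF Suc.prems]] by simp
  qed
qed

text \<open>The fundamental theorem of calculus on [0, 1], for g(sx) in the first identity and for s
  g(sx) in the second.\<close>

lemma radial_mean_ftc:
  fixes g :: "real^'n::finite \<Rightarrow> real"
  assumes "smooth_on (ball 0 r) g" "x \<in> ball 0 r"
  shows "(\<Sum>l\<in>UNIV. x $ l * radial_mean 0 (pd l g) x) = g x - g 0"
    and "euler (radial_mean 0 g) x + radial_mean 0 g x = g x"
proof -
  have int: "(\<lambda>s. s ^ q * k (s *\<^sub>R x)) integrable_on cbox 0 1"
    if "smooth_on (ball 0 r) k" for q and k :: "real^'n \<Rightarrow> real"
    by (rule radial_integrable[OF smooth_on_continuous[OF that] assms(2)])
  have ray: "((\<lambda>s. g (s *\<^sub>R x)) has_vector_derivative (\<Sum>l\<in>UNIV. x $ l *\<^sub>R pd l g (s *\<^sub>R x))) (at s within {0..1})"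
    if "0 \<le> s" "s \<le> 1" for s
    by (rule ray_derivative[OF smooth_on_differentiable[OF assms(1) ball_scaleR[OF assms(2) that]]])
  have int': "(\<lambda>s. x $ l * (s ^ q * pd l g (s *\<^sub>R x))) integrable_on cbox 0 1" for q l
    by (rule integrable_on_mult_right[OF int[OF smooth_on_pd[OF assms(1)]]])
  have mult: "(\<Sum>l\<in>UNIV. x $ l * radial_mean q (pd l g) x)
      = integral (cbox 0 1) (\<lambda>s. \<Sum>l\<in>UNIV. x $ l * (s ^ q * pd l g (s *\<^sub>R x)))" for q
    unfolding radial_mean_def by (subst integral_sum[OF finite int']) (simp only: integral_mult_right)
  have "((\<lambda>s. \<Sum>l\<in>UNIV. x $ l *\<^sub>R pd l g (s *\<^sub>R x)) has_integral g (1 *\<^sub>R x) - g (0 *\<^sub>R x)) {0..1}"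
    by (rule fundamental_theorem_of_calculus) (use ray in auto)
  from integral_unique[OF this] mult[of 0]
  show "(\<Sum>l\<in>UNIV. x $ l * radial_mean 0 (pd l g) x) = g x - g 0" by simp
  have "((\<lambda>s. s * (\<Sum>l\<in>UNIV. x $ l *\<^sub>R pd l g (s *\<^sub>R x)) + g (s *\<^sub>R x)) has_integral
     1 * g (1 *\<^sub>R x) - 0 * g (0 *\<^sub>R x)) {0..1}"
  proof (rule fundamental_theorem_of_calculus)
    show "((\<lambda>s. s * g (s *\<^sub>R x)) has_vector_derivative
       s * (\<Sum>l\<in>UNIV. x $ l *\<^sub>R pd l g (s *\<^sub>R x)) + g (s *\<^sub>R x)) (at s within {0..1})"
      if "s \<in> {0..1}" for s
      using has_vector_derivative_mult[OF has_vector_derivative_id ray[of s]] that by simp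
  qed simp
  from integral_unique[OF this]
  have "integral (cbox 0 1) (\<lambda>s. s * (\<Sum>l\<in>UNIV. x $ l *\<^sub>R pd l g (s *\<^sub>R x)) + g (s *\<^sub>R x)) = g x"
    by simp
  moreover have "integral (cbox 0 1) (\<lambda>s. s * (\<Sum>l\<in>UNIV. x $ l *\<^sub>R pd l g (s *\<^sub>R x)) + g (s *\<^sub>R x))
    = (\<Sum>l\<in>UNIV. x $ l * radial_mean 1 (pd l g) x) + radial_mean 0 g x"
  proof -
    have "(\<lambda>s. s * (\<Sum>l\<in>UNIV. x $ l *\<^sub>R pd l g (s *\<^sub>R x)) + g (s *\<^sub>R x))
      = (\<lambda>s. (\<Sum>l\<in>UNIV. x $ l * (s ^ 1 * pd l g (s *\<^sub>R x))) + s ^ 0 * g (s *\<^sub>R x))"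
      by (rule ext) (simp add: sum_distrib_left mult.left_commute)
    moreover have "integral (cbox 0 1) \<dots>
      = integral (cbox 0 1) (\<lambda>s. \<Sum>l\<in>UNIV. x $ l * (s ^ 1 * pd l g (s *\<^sub>R x))) + radial_mean 0 g x"
      unfolding radial_mean_def
      by (rule integral_add[OF integrable_sum[OF finite int'] int[OF assms(1)]])
    ultimately show ?thesis by (simp only: mult)
  qed
  moreover have "euler (radial_mean 0 g) x = (\<Sum>l\<in>UNIV. x $ l * radial_mean 1 (pd l g) x)"
    by (simp add: euler_def pd_radial_mean[OF assms])
  ultimately show "euler (radial_mean 0 g) x + radial_mean 0 g x = g x" by simp
qed

text \<open>Hadamard's lemma, with radial means of the partial derivatives as coefficients. Their
  values at 0 are recorded so that it can be applied a second time when the whole 1-jet of w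
  vanishes.\<close>

lemma hadamard:
  fixes w :: "real^'n::finite \<Rightarrow> real"
  assumes "smooth_on (ball 0 r) w" "w 0 = 0" "0 < r"
  obtains c where "\<And>i. smooth_on (ball 0 r) (c i)" "\<And>x. x \<in> ball 0 r \<Longrightarrow> w x = (\<Sum>i\<in>UNIV. x $ i * c i x)"
    "\<And>i. c i 0 = pd i w 0"
proof
  show "smooth_on (ball 0 r) (radial_mean 0 (pd i w))" for i
    by (intro smooth_on_radial_mean smooth_on_pd assms)
  show "w x = (\<Sum>i\<in>UNIV. x $ i * radial_mean 0 (pd i w) x)" if "x \<in> ball 0 r" for x
    using radial_mean_ftc(1)[OF assms(1) that] assms(2) by simp
  show "radial_mean 0 (pd i w) 0 = pd i w 0" for i
    by (simp add: radial_mean_def)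
qed

lemma euler_mult:
  fixes f g :: "real^'n::finite \<Rightarrow> real"
  assumes "f differentiable (at x)" "g differentiable (at x)"
  shows "euler (\<lambda>x. f x * g x) x = f x * euler g x + euler f x * g x"
  by (simp add: euler_def pd_mult[OF assms] sum_distrib_left sum_distrib_right sum.distrib[symmetric] algebra_simps)

lemma euler_sum:
  assumes "\<And>i. i \<in> I \<Longrightarrow> f i differentiable (at x)"
  shows "euler (\<lambda>x. \<Sum>i\<in>I. f i x) x = (\<Sum>i\<in>I. euler (f i) x)"
proof -
  have "pd l (\<lambda>x. \<Sum>i\<in>I. f i x) x = (\<Sum>i\<in>I. pd l (f i) x)" for l
    by (rule pd_sum) (rule assms)
  then show ?thesis
    unfolding euler_def by (simp only: scaleR_sum_right) (rule sum.swap)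
qed

lemma euler_coord:
  fixes x :: "real^'n::finite"
  shows "euler (\<lambda>x. x $ i) x = x $ i"
proof -
  have "(\<lambda>x::real^'n. x) differentiable (at x)" for x by simp
  from pd_component[OF this] have "pd l (\<lambda>x::real^'n. x $ i) x = axis l 1 $ i" for l x
    by (simp add: pd_id)
  then have "euler (\<lambda>x. x $ i) x = (\<Sum>l\<in>UNIV. if l = i then x $ l else 0)"
    unfolding euler_def by (intro sum.cong) (auto simp: axis_def)
  then show ?thesis by simp
qed

text \<open>The solution is the integral of s^-2 w(sx) over [0, 1], made visibly smooth. Writing w
  as the sum of x_i x_j d_ij by two uses of Hadamard's lemma, the ansatz u = sum of x_i x_j v_ij
  turns E u = u + w into E v_ij + v_ij = d_ij, which a radial mean solves on the whole ball.\<close>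

lemma euler_quadratic_solution:
  fixes w :: "real^'n::finite \<Rightarrow> real"
  assumes "smooth_on (ball 0 r) w" "w 0 = 0" "\<And>l. pd l w 0 = 0" "0 < r"
  obtains u where "smooth_on (ball 0 r) u" "u 0 = 0" "\<And>l. pd l u 0 = 0"
    "\<And>x::real^'n. x \<in> ball 0 r \<Longrightarrow> euler u x = u x + w x"
proof -
  obtain c where c: "\<And>i. smooth_on (ball 0 r) (c i)" "\<And>x. x \<in> ball 0 r \<Longrightarrow> w x = (\<Sum>i\<in>UNIV. x $ i * c i x)"
    "\<And>i. c i 0 = pd i w 0"
    by (rule hadamard[OF assms(1,2,4)]) (rule that)
  have c0: "c i 0 = 0" for i by (simp add: c(3) assms(3))
  have "\<exists>d. (\<forall>j. smooth_on (ball 0 r) (d j)) \<and> (\<forall>x\<in>ball 0 r. c i x = (\<Sum>j\<in>UNIV. x $ j * d j x))" for i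
    by (rule hadamard[OF c(1)[of i] c0[of i] assms(4)]) auto
  then obtain d where d: "\<And>i j. smooth_on (ball 0 r) (d i j)"
     "\<And>i x. x \<in> ball 0 r \<Longrightarrow> c i x = (\<Sum>j\<in>UNIV. x $ j * d i j x)" by metis
  define v where "v i j = radial_mean 0 (d i j)" for i j
  have v: "smooth_on (ball 0 r) (v i j)" for i j unfolding v_def by (rule smooth_on_radial_mean[OF d(1)])
  have vd: "euler (v i j) x + v i j x = d i j x" if "x \<in> ball 0 r" for i j x
    unfolding v_def by (rule radial_mean_ftc(2)[OF d(1) that])
  define u where "u x = (\<Sum>i\<in>UNIV. \<Sum>j\<in>UNIV. x $ i * (x $ j * v i j x))" for x
  note smooth = smooth_on_sum[OF open_ball] smooth_on_mult[OF open_ball] smooth_on_coord[OF open_ball] v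
  show thesis
  proof
    show "smooth_on (ball 0 r) u" unfolding u_def by (intro smooth)
    show "u 0 = 0" by (simp add: u_def)
    have diff: "(\<lambda>x. x $ i) differentiable (at x)" "(\<lambda>x. x $ j * v i j x) differentiable (at x)"
      "(\<lambda>x. x $ i * (x $ j * v i j x)) differentiable (at x)" "v i j differentiable (at x)"
      if "x \<in> ball 0 r" for i j x
      by (intro smooth_on_differentiable[OF _ that] smooth)+
    have diffs: "(\<lambda>x. \<Sum>j\<in>UNIV. x $ i * (x $ j * v i j x)) differentiable (at x)" if "x \<in> ball 0 r" for i x
      by (intro smooth_on_differentiable[OF _ that] smooth)
    have 0: "0 \<in> ball (0::real^'n) r" using assms(4) by simp
    show "pd l u 0 = 0" for l
      unfolding u_def using diff[OF 0] diffs[OF 0] by (simp add: pd_sum pd_mult)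
    fix x :: "real^'n" assume x: "x \<in> ball 0 r"
    have "euler u x = (\<Sum>i\<in>UNIV. \<Sum>j\<in>UNIV. euler (\<lambda>x. x $ i * (x $ j * v i j x)) x)"
      unfolding u_def using diff[OF x] diffs[OF x] by (simp add: euler_sum)
    also have "\<dots> = (\<Sum>i\<in>UNIV. \<Sum>j\<in>UNIV. x $ i * (x $ j * v i j x) + x $ i * (x $ j * d i j x))"
    proof (intro sum.cong refl)
      fix i j
      \<comment> \<open>The two coordinate factors contribute 2 v_ij; one copy belongs to u on the
        right, the other completes E v_ij + v_ij = d_ij.\<close>
      have "euler (\<lambda>x. x $ i * (x $ j * v i j x)) x
        = x $ i * (x $ j * v i j x) + x $ i * (x $ j * (euler (v i j) x + v i j x))"
        using diff[OF x] by (simp add: euler_mult euler_coord algebra_simps)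
      then show "euler (\<lambda>x. x $ i * (x $ j * v i j x)) x
        = x $ i * (x $ j * v i j x) + x $ i * (x $ j * d i j x)"
        by (simp only: vd[OF x])
    qed
    also have "\<dots> = u x + w x"
      by (simp add: u_def c(2)[OF x] d(2)[OF x] sum.distrib sum_distrib_left)
    finally show "euler u x = u x + w x" .
  qed
qed

section \<open>Geometrically convergent sequences of smooth functions\<close>

text \<open>The mean value theorem on [0, 1] for s^p v(sx). The lower endpoint contributes only for
  p = 0, where \<open>0 ^ 0 = 1\<close>; there the truncated exponent p - 1 is harmless because of
  the factor p.\<close>

lemma ray_mvt:
  fixes v :: "real^'n::finite \<Rightarrow> real"
  assumes "smooth_on (ball 0 r) v" "x \<in> ball 0 r"
    and "\<And>s. 0 < s \<Longrightarrow> s < 1 \<Longrightarrow>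
      \<bar>of_nat p * s ^ (p - 1) * v (s *\<^sub>R x) + s ^ p * (\<Sum>l\<in>UNIV. x $ l *\<^sub>R pd l v (s *\<^sub>R x))\<bar> \<le> M"
  shows "\<bar>v x - 0 ^ p * v 0\<bar> \<le> M"
proof -
  have d: "((\<lambda>s. s ^ p * v (s *\<^sub>R x)) has_real_derivative
      of_nat p * s ^ (p - 1) * v (s *\<^sub>R x) + s ^ p * (\<Sum>l\<in>UNIV. x $ l *\<^sub>R pd l v (s *\<^sub>R x))) (at s)"
    if "0 \<le> s" "s \<le> 1" for s
  proof -
    have "((\<lambda>s. v (s *\<^sub>R x)) has_real_derivative (\<Sum>l\<in>UNIV. x $ l *\<^sub>R pd l v (s *\<^sub>R x))) (at s)"
      unfolding has_real_derivative_iff_has_vector_derivative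
      by (rule ray_derivative[OF smooth_on_differentiable[OF assms(1) ball_scaleR[OF assms(2) that]]])
    from DERIV_mult[OF DERIV_pow[of p s] this] show ?thesis
      by (simp add: algebra_simps)
  qed
  obtain s where s: "0 < s" "s < 1" and eq: "1 ^ p * v (1 *\<^sub>R x) - 0 ^ p * v (0 *\<^sub>R x) = (1 - 0) *
     (of_nat p * s ^ (p - 1) * v (s *\<^sub>R x) + s ^ p * (\<Sum>l\<in>UNIV. x $ l *\<^sub>R pd l v (s *\<^sub>R x)))"
    using MVT2[OF zero_less_one d] by auto
  then show ?thesis using assms(3)[OF s] by simp
qed

text \<open>The derivative of s^(q+1) v(sx) is s^q times (E v + (q+1) v)(sx), and s^q \<le> 1. The
  bound is independent of q and of the ball, which is what allows one radius for derivatives of all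
  orders.\<close>

lemma euler_bound_Suc:
  fixes v :: "real^'n::finite \<Rightarrow> real"
  assumes "smooth_on (ball 0 r) v"
    and "\<And>y. y \<in> ball 0 r \<Longrightarrow> \<bar>euler v y + real (Suc q) * v y\<bar> \<le> M"
    and "x \<in> ball 0 r"
  shows "\<bar>v x\<bar> \<le> M"
proof -
  have "\<bar>v x - 0 ^ Suc q * v 0\<bar> \<le> M"
  proof (rule ray_mvt[OF assms(1,3)])
    fix s :: real assume s: "0 < s" "s < 1"
    have y: "s *\<^sub>R x \<in> ball 0 r" using s by (intro ball_scaleR[OF assms(3)]) simp_all
    have "of_nat (Suc q) * s ^ (Suc q - 1) * v (s *\<^sub>R x) + s ^ Suc q * (\<Sum>l\<in>UNIV. x $ l *\<^sub>R pd l v (s *\<^sub>R x))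
      = s ^ q * (euler v (s *\<^sub>R x) + real (Suc q) * v (s *\<^sub>R x))"
      unfolding euler_ray by (simp add: algebra_simps)
    moreover have "\<bar>s ^ q * (euler v (s *\<^sub>R x) + real (Suc q) * v (s *\<^sub>R x))\<bar> \<le> 1 * M"
      unfolding abs_mult using s assms(2)[OF y] by (intro mult_mono) (auto simp: power_le_one)
    ultimately show "\<bar>of_nat (Suc q) * s ^ (Suc q - 1) * v (s *\<^sub>R x)
        + s ^ Suc q * (\<Sum>l\<in>UNIV. x $ l *\<^sub>R pd l v (s *\<^sub>R x))\<bar> \<le> M" by simp
  qed
  then show ?thesis by simp
qed

text \<open>E annihilates constants, so v is controlled only relative to its value at 0. Along a ray
  one divides E v by s, and the factor \<open>norm y\<close> in the hypothesis pays for
  this.\<close>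

lemma euler_bound_0:
  fixes v :: "real^'n::finite \<Rightarrow> real"
  assumes "smooth_on (ball 0 r) v"
    and "\<And>y. y \<in> ball 0 r \<Longrightarrow> \<bar>euler v y\<bar> \<le> M * norm y"
    and "x \<in> ball 0 r"
  shows "\<bar>v x - v 0\<bar> \<le> M * norm x"
proof -
  have "\<bar>v x - 0 ^ 0 * v 0\<bar> \<le> M * norm x"
  proof (rule ray_mvt[OF assms(1,3)])
    fix s :: real assume s: "0 < s" "s < 1"
    have y: "s *\<^sub>R x \<in> ball 0 r" using s by (intro ball_scaleR[OF assms(3)]) simp_all
    have "s * \<bar>\<Sum>l\<in>UNIV. x $ l *\<^sub>R pd l v (s *\<^sub>R x)\<bar> \<le> s * (M * norm x)"
      using assms(2)[OF y] s unfolding euler_ray by (simp add: abs_mult)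
    then show "\<bar>of_nat 0 * s ^ (0 - 1) * v (s *\<^sub>R x)
        + s ^ 0 * (\<Sum>l\<in>UNIV. x $ l *\<^sub>R pd l v (s *\<^sub>R x))\<bar> \<le> M * norm x"
      using s by simp
  qed
  then show ?thesis by simp
qed

lemma smooth_on_euler:
  fixes v :: "real^'n::finite \<Rightarrow> real"
  assumes "open S" "smooth_on S v"
  shows "smooth_on S (euler v)"
  unfolding euler_def real_scaleR_def
  by (intro smooth_on_sum smooth_on_mult smooth_on_coord smooth_on_pd assms)

lemma pd_coord: "pd l (\<lambda>x::real^'n::finite. x $ i) x = (if i = l then 1 else 0)"
proof -
  have "(\<lambda>x::real^'n. x) differentiable (at x)" by simp
  from pd_component[OF this, of l i] show ?thesis by (simp add: pd_id axis_def)
qed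

text \<open>The commutator of d_l and E is d_l, so each differentiation raises the constant c by
  one. Starting from c = -1, two derivatives reach the range of
  \<open>euler_bound_Suc\<close>.\<close>

lemma euler_pd:
  fixes v :: "real^'n::finite \<Rightarrow> real"
  assumes "open S" "smooth_on S v" "x \<in> S"
    and "\<And>y. y \<in> S \<Longrightarrow> euler v y + c * v y = w y"
  shows "euler (pd l v) x + (c + 1) * pd l v x = pd l w x"
proof -
  have "pd l w x = pd l (\<lambda>y. euler v y + c * v y) x"
    by (rule pd_cong[OF assms(1,3)]) (simp add: assms(4))
  also have "\<dots> = pd l (euler v) x + pd l (\<lambda>y. c * v y) x"
    by (intro pd_add smooth_on_differentiable[OF _ assms(3)] smooth_on_euler smooth_on_mult smooth_on_const assms)
  also have "pd l (\<lambda>y. c * v y) x = c * pd l v x"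
    using pd_mult[of "\<lambda>y. c" x v l] smooth_on_differentiable[OF assms(2,3)] by simp
  also have "pd l (euler v) x = (\<Sum>k\<in>UNIV. pd l (\<lambda>y. y $ k * pd k v y) x)"
    unfolding euler_def real_scaleR_def
    by (intro pd_sum smooth_on_differentiable[OF _ assms(3)] smooth_on_mult smooth_on_coord smooth_on_pd assms)
  also have "\<dots> = (\<Sum>k\<in>UNIV. x $ k * pd k (pd l v) x + (if k = l then pd k v x else 0))"
  proof (rule sum.cong[OF refl])
    fix k
    have "pd l (\<lambda>y. y $ k * pd k v y) x = x $ k * pd l (pd k v) x + pd l (\<lambda>y. y $ k) x * pd k v x"
      by (intro pd_mult smooth_on_differentiable[OF _ assms(3)] smooth_on_coord smooth_on_pd assms)
    then show "pd l (\<lambda>y. y $ k * pd k v y) x = x $ k * pd k (pd l v) x + (if k = l then pd k v x else 0)"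
      by (simp add: pd_coord pd_commute[OF assms(1-3)])
  qed
  also have "\<dots> = euler (pd l v) x + pd l v x"
    by (simp add: sum.distrib euler_def)
  finally show ?thesis by (simp add: algebra_simps)
qed

text \<open>The rate \<open>3/4\<close> exceeds the contraction factor \<open>1/2\<close> of the linear equations in \<open>geo_linear\<close>, so
  solutions inherit the rate of the coefficients.\<close>

definition geo0 :: "(real^'n::finite) set \<Rightarrow> (nat \<Rightarrow> real^'n \<Rightarrow> real) \<Rightarrow> bool" where
  "geo0 S f \<longleftrightarrow> (\<exists>B. \<forall>m. \<forall>x\<in>S. \<bar>f m x\<bar> \<le> B \<and> \<bar>f (Suc m) x - f m x\<bar> \<le> B * (3/4) ^ m)"

primrec geo :: "nat \<Rightarrow> (real^'n::finite) set \<Rightarrow> (nat \<Rightarrow> real^'n \<Rightarrow> real) \<Rightarrow> bool" where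
  "geo 0 S f \<longleftrightarrow> geo0 S f"
| "geo (Suc k) S f \<longleftrightarrow> geo0 S f \<and> (\<forall>l. geo k S (\<lambda>m. pd l (f m)))"

lemma geo_imp_geo0: "geo k S f \<Longrightarrow> geo0 S f"
  by (cases k) simp_all

lemma geo_SucD: "geo (Suc k) S f \<Longrightarrow> geo k S f"
  by (induction k arbitrary: f) simp_all

lemma geo_cong:
  assumes "open S" "\<And>m x. x \<in> S \<Longrightarrow> f m x = g m x" "geo k S f"
  shows "geo k S g"
  using assms(2,3)
proof (induction k arbitrary: f g)
  case 0
  then show ?case by (simp add: geo0_def)
next
  case (Suc k)
  have "geo k S (\<lambda>m. pd l (g m))" for l
  proof (rule Suc.IH)
    show "pd l (f m) x = pd l (g m) x" if "x \<in> S" for m x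
      by (rule pd_cong[OF assms(1) that]) (rule Suc.prems(1))
  qed (use Suc.prems in simp)
  moreover have "geo0 S g" using Suc.prems by (simp add: geo0_def)
  ultimately show ?case by simp
qed

lemma geo0_add: assumes "geo0 S f" "geo0 S g" shows "geo0 S (\<lambda>m x. f m x + g m x)"
proof -
  obtain B where B: "\<And>m x. x \<in> S \<Longrightarrow> \<bar>f m x\<bar> \<le> B \<and> \<bar>f (Suc m) x - f m x\<bar> \<le> B * (3/4) ^ m"
    using assms(1) unfolding geo0_def by auto
  obtain C where C: "\<And>m x. x \<in> S \<Longrightarrow> \<bar>g m x\<bar> \<le> C \<and> \<bar>g (Suc m) x - g m x\<bar> \<le> C * (3/4) ^ m"
    using assms(2) unfolding geo0_def by auto
  show ?thesis unfolding geo0_def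
  proof (intro exI[of _ "B + C"] allI ballI)
    fix m x assume "x \<in> S"
    from B[OF this, of m] C[OF this, of m]
    show "\<bar>f m x + g m x\<bar> \<le> B + C \<and> \<bar>f (Suc m) x + g (Suc m) x - (f m x + g m x)\<bar> \<le> (B + C) * (3/4) ^ m"
      unfolding distrib_right by linarith
  qed
qed

lemma geo0_mult: assumes "geo0 S f" "geo0 S g" shows "geo0 S (\<lambda>m x. f m x * g m x)"
proof -
  obtain B where B: "\<And>m x. x \<in> S \<Longrightarrow> \<bar>f m x\<bar> \<le> B \<and> \<bar>f (Suc m) x - f m x\<bar> \<le> B * (3/4) ^ m"
    using assms(1) unfolding geo0_def by auto
  obtain C where C: "\<And>m x. x \<in> S \<Longrightarrow> \<bar>g m x\<bar> \<le> C \<and> \<bar>g (Suc m) x - g m x\<bar> \<le> C * (3/4) ^ m"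
    using assms(2) unfolding geo0_def by auto
  show ?thesis unfolding geo0_def
  \<comment> \<open>The difference of the products splits into two terms, each at most B C (3/4)^m;
    hence the factor 2.\<close>
  proof (intro exI[of _ "2 * (B * C)"] allI ballI conjI)
    fix m x assume x: "x \<in> S"
    have nn: "0 \<le> B" "0 \<le> C" using B[OF x] C[OF x] abs_ge_zero order_trans by blast+
    have 1: "\<bar>f m x\<bar> * \<bar>g m x\<bar> \<le> B * C"
      using B[OF x, of m] C[OF x, of m] nn by (intro mult_mono) auto
    moreover have "0 \<le> B * C" using nn by simp
    ultimately show "\<bar>f m x * g m x\<bar> \<le> 2 * (B * C)" by (simp add: abs_mult)
    have "f (Suc m) x * g (Suc m) x - f m x * g m x
      = f (Suc m) x * (g (Suc m) x - g m x) + (f (Suc m) x - f m x) * g m x"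
      by (simp add: algebra_simps)
    also have "\<bar>\<dots>\<bar> \<le> \<bar>f (Suc m) x\<bar> * \<bar>g (Suc m) x - g m x\<bar> + \<bar>f (Suc m) x - f m x\<bar> * \<bar>g m x\<bar>"
      unfolding abs_mult[symmetric] by (rule abs_triangle_ineq)
    also have "\<dots> \<le> B * (C * (3/4) ^ m) + B * (3/4) ^ m * C"
      using B[OF x, of m] B[OF x, of "Suc m"] C[OF x, of m] nn by (intro add_mono mult_mono) auto
    finally show "\<bar>f (Suc m) x * g (Suc m) x - f m x * g m x\<bar> \<le> 2 * (B * C) * (3/4) ^ m"
      by (simp add: algebra_simps)
  qed
qed

lemma geo_add:
  assumes "open S" "\<And>m. smooth_on S (f m)" "\<And>m. smooth_on S (g m)" "geo k S f" "geo k S g"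
  shows "geo k S (\<lambda>m x. f m x + g m x)"
  using assms(2-)
proof (induction k arbitrary: f g)
  case 0
  then show ?case by (simp add: geo0_add)
next
  case (Suc k)
  have "geo k S (\<lambda>m. pd l (\<lambda>x. f m x + g m x))" for l
  proof (rule geo_cong[OF assms(1)])
    show "geo k S (\<lambda>m x. pd l (f m) x + pd l (g m) x)"
      by (rule Suc.IH) (use Suc.prems in \<open>simp_all add: smooth_on_pd\<close>)
    show "pd l (f m) x + pd l (g m) x = pd l (\<lambda>x. f m x + g m x) x" if "x \<in> S" for m x
      using pd_add[OF smooth_on_differentiable[OF Suc.prems(1) that] smooth_on_differentiable[OF Suc.prems(2) that]]
      by simp
  qed
  then show ?case using Suc.prems by (simp add: geo0_add)
qed

lemma geo_mult:
  assumes "open S" "\<And>m. smooth_on S (f m)" "\<And>m. smooth_on S (g m)" "geo k S f" "geo k S g"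
  shows "geo k S (\<lambda>m x. f m x * g m x)"
  using assms(2-)
proof (induction k arbitrary: f g)
  case 0
  then show ?case by (simp add: geo0_mult)
next
  case (Suc k)
  have "geo k S (\<lambda>m. pd l (\<lambda>x. f m x * g m x))" for l
  proof (rule geo_cong[OF assms(1)])
    have 1: "geo k S (\<lambda>m x. f m x * pd l (g m) x)"
      by (rule Suc.IH) (use Suc.prems geo_SucD[OF Suc.prems(3)] in \<open>simp_all add: smooth_on_pd\<close>)
    have 2: "geo k S (\<lambda>m x. pd l (f m) x * g m x)"
      by (rule Suc.IH) (use Suc.prems geo_SucD[OF Suc.prems(4)] in \<open>simp_all add: smooth_on_pd\<close>)
    show "geo k S (\<lambda>m x. f m x * pd l (g m) x + pd l (f m) x * g m x)"
      by (rule geo_add[OF assms(1) _ _ 1 2])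
        (intro smooth_on_mult[OF assms(1)] smooth_on_pd Suc.prems)+
    show "f m x * pd l (g m) x + pd l (f m) x * g m x = pd l (\<lambda>x. f m x * g m x) x" if "x \<in> S" for m x
      using pd_mult[OF smooth_on_differentiable[OF Suc.prems(1) that] smooth_on_differentiable[OF Suc.prems(2) that]]
      by simp
  qed
  then show ?case using Suc.prems by (simp add: geo0_mult)
qed

lemma geo_zero: "geo k S (\<lambda>m x. 0)"
  by (induction k) (auto simp: geo0_def intro!: exI[of _ 0])

lemma geo_sum:
  assumes "open S" "finite I" "\<And>i m. i \<in> I \<Longrightarrow> smooth_on S (f i m)" "\<And>i. i \<in> I \<Longrightarrow> geo k S (f i)"
  shows "geo k S (\<lambda>m x. \<Sum>i\<in>I. f i m x)"
  using assms(2-)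
proof (induction I rule: finite_induct)
  case empty
  then show ?case by (simp add: geo_zero)
next
  case (insert a I)
  have "geo k S (\<lambda>m x. f a m x + (\<Sum>i\<in>I. f i m x))"
  proof (rule geo_add[OF assms(1)])
    show "smooth_on S (\<lambda>x. \<Sum>i\<in>I. f i m x)" for m
      by (rule smooth_on_sum[OF assms(1)]) (simp add: insert.prems)
  qed (use insert in simp_all)
  then show ?case using insert.hyps by simp
qed

lemma component_lipschitz:
  fixes f :: "real^'n::finite \<Rightarrow> real"
  assumes "convex S" "\<And>x. x \<in> S \<Longrightarrow> f differentiable (at x)" "\<And>x l. x \<in> S \<Longrightarrow> \<bar>pd l f x\<bar> \<le> B"
    and "x \<in> S" "y \<in> S"
  shows "\<bar>f x - f y\<bar> \<le> real CARD('n) * B * norm (x - y)"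
proof -
  have "norm (f x - f y) \<le> real CARD('n) * B * norm (x - y)"
  proof (rule differentiable_bound[OF assms(1) _ _ assms(4,5)])
    fix z assume z: "z \<in> S"
    show "(f has_derivative (\<lambda>u. \<Sum>l\<in>UNIV. u $ l *\<^sub>R pd l f z)) (at z within S)"
      by (rule has_derivative_at_withinI[OF has_derivative_pd[OF assms(2)[OF z]]])
    show "onorm (\<lambda>u. \<Sum>l\<in>UNIV. u $ l *\<^sub>R pd l f z) \<le> real CARD('n) * B"
    proof (rule onorm_le)
      fix u :: "real^'n"
      have "norm (\<Sum>l\<in>UNIV. u $ l *\<^sub>R pd l f z) \<le> (\<Sum>l\<in>UNIV. \<bar>u $ l\<bar> * \<bar>pd l f z\<bar>)"
        using norm_sum[of "\<lambda>l. u $ l *\<^sub>R pd l f z" UNIV] by (simp add: abs_mult)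
      also have "\<dots> \<le> (\<Sum>l\<in>(UNIV::'n set). norm u * B)"
        by (intro sum_mono mult_mono component_le_norm_cart assms(3) z) auto
      finally show "norm (\<Sum>l\<in>UNIV. u $ l *\<^sub>R pd l f z) \<le> real CARD('n) * B * norm u"
        by (simp add: mult_ac)
    qed
  qed
  then show ?thesis by simp
qed

lemma norm_le_card:
  fixes v :: "real^'n::finite"
  assumes "\<And>i. \<bar>v $ i\<bar> \<le> B"
  shows "norm v \<le> real CARD('n) * B"
  using norm_le_l1_cart[of v] sum_mono[of UNIV "\<lambda>i. \<bar>v $ i\<bar>" "\<lambda>i. B"] assms by simp

lemma compact_lipschitz:
  fixes \<phi> :: "real^'n::finite \<Rightarrow> real"
  assumes "smooth_on T \<phi>" "compact K" "convex K" "K \<subseteq> T"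
  obtains B where "0 \<le> B" "\<And>y. y \<in> K \<Longrightarrow> \<bar>\<phi> y\<bar> \<le> B"
    "\<And>y z. y \<in> K \<Longrightarrow> z \<in> K \<Longrightarrow> \<bar>\<phi> y - \<phi> z\<bar> \<le> B * norm (y - z)"
proof -
  have bdd: "\<exists>B\<ge>0. \<forall>y\<in>K. \<bar>g y\<bar> \<le> B" if "smooth_on T g" for g :: "real^'n \<Rightarrow> real"
  proof -
    have "bounded (g ` K)"
      by (intro compact_imp_bounded compact_continuous_image[OF _ assms(2)]
          continuous_on_subset[OF smooth_on_continuous[OF that] assms(4)])
    then obtain B where "\<forall>y\<in>K. \<bar>g y\<bar> \<le> B" unfolding bounded_iff by auto
    then show ?thesis by (intro exI[of _ "max B 0"]) auto
  qed
  obtain B0 where B0: "0 \<le> B0" "\<forall>y\<in>K. \<bar>\<phi> y\<bar> \<le> B0" using bdd[OF assms(1)] by auto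
  have "\<forall>l. \<exists>B\<ge>0. \<forall>y\<in>K. \<bar>pd l \<phi> y\<bar> \<le> B" using bdd[OF smooth_on_pd[OF assms(1)]] by simp
  then obtain D where D: "\<And>l. 0 \<le> D l" "\<And>l y. y \<in> K \<Longrightarrow> \<bar>pd l \<phi> y\<bar> \<le> D l"
    unfolding choice_iff by auto
  have le: "\<bar>pd l \<phi> y\<bar> \<le> sum D UNIV" if "y \<in> K" for l y
    using D(2)[OF that, of l] member_le_sum[of l UNIV D] D(1) by simp
  have Dnn: "0 \<le> sum D UNIV" using D(1) by (simp add: sum_nonneg)
  show thesis
  proof (rule that[of "B0 + real CARD('n) * sum D UNIV"])
    show "0 \<le> B0 + real CARD('n) * sum D UNIV" using B0 Dnn by simp
    show "\<bar>\<phi> y\<bar> \<le> B0 + real CARD('n) * sum D UNIV" if "y \<in> K" for y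
      using B0 Dnn that by (simp add: add_increasing2)
    show "\<bar>\<phi> y - \<phi> z\<bar> \<le> (B0 + real CARD('n) * sum D UNIV) * norm (y - z)" if "y \<in> K" "z \<in> K" for y z
    proof -
      have "\<bar>\<phi> y - \<phi> z\<bar> \<le> real CARD('n) * sum D UNIV * norm (y - z)"
        using component_lipschitz[OF assms(3) _ le that] smooth_on_differentiable[OF assms(1)] assms(4) by auto
      then show ?thesis using B0 by (simp add: distrib_right add_increasing)
    qed
  qed
qed

text \<open>The derivatives of \<phi> are bounded and Lipschitz only on compact sets, so all maps h
  m must take values in one compact convex K. In the chain rule every factor has order at most k,
  which closes the induction over all smooth \<phi>.\<close>

lemma geo_compose:
  fixes \<phi> :: "real^'n::finite \<Rightarrow> real" and h :: "nat \<Rightarrow> real^'n \<Rightarrow> real^'n"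
  assumes "open S" "open T" "compact K" "convex K" "K \<subseteq> T" "\<And>m x. x \<in> S \<Longrightarrow> h m x \<in> K"
    and "\<And>m. smooth_on S (h m)" "smooth_on T \<phi>" "\<And>i. geo k S (\<lambda>m x. h m x $ i)"
  shows "geo k S (\<lambda>m x. \<phi> (h m x))"
  using assms(8,9)
proof (induction k arbitrary: \<phi>)
  case 0
  obtain B where B: "0 \<le> B" "\<And>y. y \<in> K \<Longrightarrow> \<bar>\<phi> y\<bar> \<le> B"
    "\<And>y z. y \<in> K \<Longrightarrow> z \<in> K \<Longrightarrow> \<bar>\<phi> y - \<phi> z\<bar> \<le> B * norm (y - z)"
    by (rule compact_lipschitz[OF 0(1) assms(3-5)]) (rule that)
  have "\<forall>i. \<exists>C. \<forall>m. \<forall>x\<in>S. \<bar>h m x $ i\<bar> \<le> C \<and> \<bar>h (Suc m) x $ i - h m x $ i\<bar> \<le> C * (3/4) ^ m"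
    using 0(2) by (simp add: geo0_def)
  then obtain C where C: "\<And>i m x. x \<in> S \<Longrightarrow> \<bar>h m x $ i\<bar> \<le> C i"
    "\<And>i m x. x \<in> S \<Longrightarrow> \<bar>h (Suc m) x $ i - h m x $ i\<bar> \<le> C i * (3/4) ^ m"
    unfolding choice_iff by auto
  have "\<exists>B'. \<forall>m. \<forall>x\<in>S. \<bar>\<phi> (h m x)\<bar> \<le> B' \<and> \<bar>\<phi> (h (Suc m) x) - \<phi> (h m x)\<bar> \<le> B' * (3/4) ^ m"
  proof (intro exI allI ballI conjI)
    fix m x assume x: "x \<in> S"
    have nn: "0 \<le> C i" for i using C(1)[OF x, of 0 i] by linarith
    have nnB: "0 \<le> B * sum C UNIV" using B(1) nn by (simp add: sum_nonneg)
    show "\<bar>\<phi> (h m x)\<bar> \<le> B + B * sum C UNIV" using B(2)[OF assms(6)[OF x, of m]] nnB by linarith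
    have "\<bar>\<phi> (h (Suc m) x) - \<phi> (h m x)\<bar> \<le> B * norm (h (Suc m) x - h m x)"
      by (intro B(3) assms(6) x)
    also have "\<dots> \<le> B * (\<Sum>i\<in>UNIV. C i * (3/4) ^ m)"
    proof (rule mult_left_mono[OF _ B(1)])
      have "norm (h (Suc m) x - h m x) \<le> (\<Sum>i\<in>UNIV. \<bar>(h (Suc m) x - h m x) $ i\<bar>)"
        by (rule norm_le_l1_cart)
      also have "\<dots> \<le> (\<Sum>i\<in>UNIV. C i * (3/4) ^ m)"
        by (rule sum_mono) (use C(2)[OF x] in simp)
      finally show "norm (h (Suc m) x - h m x) \<le> (\<Sum>i\<in>UNIV. C i * (3/4) ^ m)" .
    qed
    also have "\<dots> \<le> (B + B * sum C UNIV) * (3/4) ^ m"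
      using B(1) by (simp add: sum_distrib_right[symmetric] distrib_right)
    finally show "\<bar>\<phi> (h (Suc m) x) - \<phi> (h m x)\<bar> \<le> (B + B * sum C UNIV) * (3/4) ^ m" .
  qed
  then show ?case by (simp add: geo0_def)
next
  case (Suc k)
  have geo0: "geo0 S (\<lambda>m x. \<phi> (h m x))"
    by (rule geo_imp_geo0, rule Suc.IH[OF Suc.prems(1) geo_SucD[OF Suc.prems(2)]])
  have img: "h m ` S \<subseteq> T" for m using assms(5,6) by blast
  have comp: "smooth_on S (\<lambda>x. \<psi> (h m x))" if "smooth_on T \<psi>" for \<psi> :: "real^'n \<Rightarrow> real" and m
    by (rule smooth_on_compose[OF assms(1,2) img that assms(7)])
  have comp2: "smooth_on S (\<lambda>x. h m x $ j)" for m j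
    by (rule smooth_on_linear[OF assms(1) bounded_linear_coord assms(7)])
  have "geo k S (\<lambda>m. pd l (\<lambda>x. \<phi> (h m x)))" for l
  proof (rule geo_cong[OF assms(1)])
    show "geo k S (\<lambda>m x. \<Sum>j\<in>UNIV. pd l (\<lambda>x. h m x $ j) x * pd j \<phi> (h m x))"
    proof (rule geo_sum[OF assms(1) finite])
      fix j
      have "geo k S (\<lambda>m. pd l (\<lambda>x. h m x $ j))" using Suc.prems(2)[of j] by simp
      moreover have "geo k S (\<lambda>m x. pd j \<phi> (h m x))"
        by (rule Suc.IH[OF smooth_on_pd[OF Suc.prems(1)] geo_SucD[OF Suc.prems(2)]])
      ultimately show "geo k S (\<lambda>m x. pd l (\<lambda>x. h m x $ j) x * pd j \<phi> (h m x))"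
        using geo_mult[OF assms(1) smooth_on_pd[OF comp2] comp[OF smooth_on_pd[OF Suc.prems(1)]]] by simp
      show "smooth_on S (\<lambda>x. pd l (\<lambda>x. h m x $ j) x * pd j \<phi> (h m x))" for m
        by (rule smooth_on_mult[OF assms(1) smooth_on_pd[OF comp2] comp[OF smooth_on_pd[OF Suc.prems(1)]]])
    qed
    fix m x assume x: "x \<in> S"
    have d: "h m differentiable (at x)" "\<phi> differentiable (at (h m x))"
      using smooth_on_differentiable[OF assms(7) x] smooth_on_differentiable[OF Suc.prems(1), of "h m x"] img x
      by auto
    show "(\<Sum>j\<in>UNIV. pd l (\<lambda>x. h m x $ j) x * pd j \<phi> (h m x)) = pd l (\<lambda>x. \<phi> (h m x)) x"
      by (simp add: pd_chain[OF d] pd_component[OF d(1)])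
  qed
  with geo0 show ?case by simp
qed

lemma euler_diff:
  assumes "f differentiable (at x)" "g differentiable (at x)"
  shows "euler (\<lambda>x. f x - g x) x = euler f x - euler g x"
  by (simp add: euler_def pd_diff[OF assms] scaleR_diff_right sum_subtractf)

lemma euler_component:
  fixes f :: "real^'n::finite \<Rightarrow> real^'k::finite"
  assumes "f differentiable (at x)"
  shows "euler (\<lambda>x. f x $ i) x = euler f x $ i"
  by (simp add: euler_def pd_component[OF assms])

text \<open>Each row of A has absolute sum at most 1/2, while E + (q+1) has an inverse bounded by 1,
  so the iteration contracts by 1/2. Differentiating the equation keeps A and replaces q by q + 1;
  the new term, a derivative of A times W, joins the source G. Hence the induction is over k with q,
  W and G arbitrary, and the smallness of A is never asked of its derivatives.\<close>

lemma geo_linear: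
  fixes W G :: "nat \<Rightarrow> 'n::finite \<Rightarrow> real^'n \<Rightarrow> real" and A :: "nat \<Rightarrow> 'n \<Rightarrow> 'n \<Rightarrow> real^'n \<Rightarrow> real"
  assumes "\<And>m i. smooth_on (ball 0 r) (W m i)"
    and "\<And>m i j. smooth_on (ball 0 r) (A m i j)" "\<And>m i. smooth_on (ball 0 r) (G m i)"
    and "\<And>m i j x. x \<in> ball 0 r \<Longrightarrow> \<bar>A m i j x\<bar> \<le> 1 / (2 * real CARD('n))"
    and "\<And>i x. x \<in> ball 0 r \<Longrightarrow> W 0 i x = 0"
    and "\<And>m i x. x \<in> ball 0 r \<Longrightarrow> euler (W (Suc m) i) x + real (Suc q) * W (Suc m) i x
           = (\<Sum>j\<in>UNIV. A m i j x * W m j x) + G m i x"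
    and "\<And>i j. geo k (ball 0 r) (\<lambda>m. A m i j)" "\<And>i. geo k (ball 0 r) (\<lambda>m. G m i)"
  shows "geo k (ball 0 r) (\<lambda>m. W m i)"
  using assms(1,3,5-)
proof (induction k arbitrary: q W G i)
  case 0
  let ?N = "real CARD('n)" and ?S = "ball (0::real^'n) r"
  have N: "?N > 0" by simp
  have "\<forall>i j. \<exists>B. \<forall>m. \<forall>x\<in>?S. \<bar>A m i j x\<bar> \<le> B \<and> \<bar>A (Suc m) i j x - A m i j x\<bar> \<le> B * (3/4) ^ m"
    using 0(5) by (simp add: geo0_def)
  then obtain a where a': "\<forall>i j m. \<forall>x\<in>?S. \<bar>A m i j x\<bar> \<le> a i j
      \<and> \<bar>A (Suc m) i j x - A m i j x\<bar> \<le> a i j * (3/4) ^ m"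
    unfolding choice_iff by blast
  then have a: "\<And>i j m x. x \<in> ?S \<Longrightarrow> \<bar>A m i j x\<bar> \<le> a i j"
    "\<And>i j m x. x \<in> ?S \<Longrightarrow> \<bar>A (Suc m) i j x - A m i j x\<bar> \<le> a i j * (3/4) ^ m"
    by blast+
  have "\<forall>i. \<exists>B. \<forall>m. \<forall>x\<in>?S. \<bar>G m i x\<bar> \<le> B \<and> \<bar>G (Suc m) i x - G m i x\<bar> \<le> B * (3/4) ^ m"
    using 0(6) by (simp add: geo0_def)
  then obtain g where g: "\<And>i m x. x \<in> ?S \<Longrightarrow> \<bar>G m i x\<bar> \<le> g i"
    "\<And>i m x. x \<in> ?S \<Longrightarrow> \<bar>G (Suc m) i x - G m i x\<bar> \<le> g i * (3/4) ^ m"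
    unfolding choice_iff by (auto simp del: mem_ball mem_ball_0)
  have "geo0 ?S (\<lambda>m. W m i)"
  \<comment> \<open>On an empty ball the chosen bounds could be negative; otherwise their signs are
    read off at a point.\<close>
  proof (cases "?S = {}")
    case True
    then show ?thesis unfolding geo0_def by blast
  next
    case False
    then obtain x0 where x0: "x0 \<in> ?S" by blast
    define B where "B = (\<Sum>i\<in>UNIV. \<Sum>j\<in>UNIV. a i j) + (\<Sum>i\<in>UNIV. g i)"
    have ann: "0 \<le> a i j" for i j using a(1)[OF x0, of 0 i j] by linarith
    have gnn: "0 \<le> g i" for i using g(1)[OF x0, of 0 i] by linarith
    have aB: "a i j \<le> B" for i j
    proof -
      have "a i j \<le> (\<Sum>j\<in>UNIV. a i j)" by (rule member_le_sum) (auto simp: ann)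
      also have "\<dots> \<le> (\<Sum>i\<in>UNIV. \<Sum>j\<in>UNIV. a i j)"
        by (rule member_le_sum[of i UNIV "\<lambda>i. \<Sum>j\<in>UNIV. a i j"]) (auto simp: ann sum_nonneg)
      also have "\<dots> \<le> B" unfolding B_def using sum_nonneg[of UNIV g] gnn by simp
      finally show ?thesis .
    qed
    have gB: "g i \<le> B" for i
    proof -
      have "g i \<le> sum g UNIV" by (rule member_le_sum) (auto simp: gnn)
      also have "\<dots> \<le> B" unfolding B_def by (simp add: sum_nonneg ann)
      finally show ?thesis .
    qed
    have B: "0 \<le> B" using gnn gB order_trans by blast
    \<comment> \<open>2 B is the fixed point of c = c/2 + B: half of the previous bound from A W,
      plus B from the source.\<close>
    have bound: "\<bar>W m i x\<bar> \<le> 2 * B" if "x \<in> ?S" for m i x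
      using that
    proof (induction m arbitrary: i x)
      case 0
      then show ?case using "0.prems"(1) \<open>\<And>i x. x \<in> ?S \<Longrightarrow> W 0 i x = 0\<close> B by simp
    next
      case (Suc m)
      show ?case
      proof (rule euler_bound_Suc[OF 0(1) _ Suc.prems, of _ _ q])
        fix y assume y: "y \<in> ?S"
        have "\<bar>\<Sum>j\<in>UNIV. A m i j y * W m j y\<bar> \<le> (\<Sum>j\<in>(UNIV::'n set). 1 / (2 * ?N) * (2 * B))"
        proof (rule order_trans[OF sum_abs], rule sum_mono)
          fix j show "\<bar>A m i j y * W m j y\<bar> \<le> 1 / (2 * ?N) * (2 * B)"
            unfolding abs_mult by (intro mult_mono assms(4) Suc.IH y) auto
        qed
        also have "\<dots> = B" by simp
        finally show "\<bar>euler (W (Suc m) i) y + real (Suc q) * W (Suc m) i y\<bar> \<le> 2 * B"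
          unfolding 0(4)[OF y] using g(1)[OF y, of m i] gB[of i] by linarith
      qed
    qed
    \<comment> \<open>The recursion for the differences requires K/2 + (2 N B^2 + B) \<le> 3K/4,
      which explains the factor 4; the extra 2 B covers the first difference, since W 0
      vanishes.\<close>
    define K where "K = 4 * (?N * (B * (2 * B)) + B) + 2 * B"
    have K: "0 \<le> K" "2 * B \<le> K" using B by (simp_all add: K_def)
    have diff: "\<bar>W (Suc m) i x - W m i x\<bar> \<le> K * (3/4) ^ m" if "x \<in> ?S" for m i x
      using that
    proof (induction m arbitrary: i x)
      case 0
      then show ?case using bound[OF 0, of 1 i] K \<open>\<And>i x. x \<in> ?S \<Longrightarrow> W 0 i x = 0\<close> by simp
    next
      case (Suc m)
      show ?case
      proof (rule euler_bound_Suc[OF _ _ Suc.prems, of _ q])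
        show "smooth_on ?S (\<lambda>x. W (Suc (Suc m)) i x - W (Suc m) i x)"
          by (intro smooth_on_diff[OF open_ball] 0)
        fix y assume y: "y \<in> ?S"
        have d: "W m i differentiable (at y)" for m i by (rule smooth_on_differentiable[OF 0(1) y])
        have t: "\<bar>A (Suc m) i j y * W (Suc m) j y - A m i j y * W m j y\<bar>
           \<le> 1 / (2 * ?N) * (K * (3/4) ^ m) + B * (3/4) ^ m * (2 * B)" for j
        proof -
          have "A (Suc m) i j y * W (Suc m) j y - A m i j y * W m j y
            = A (Suc m) i j y * (W (Suc m) j y - W m j y) + (A (Suc m) i j y - A m i j y) * W m j y"
            by (simp add: algebra_simps)
          also have "\<bar>\<dots>\<bar> \<le> \<bar>A (Suc m) i j y\<bar> * \<bar>W (Suc m) j y - W m j y\<bar> + \<bar>A (Suc m) i j y - A m i j y\<bar> * \<bar>W m j y\<bar>"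
            unfolding abs_mult[symmetric] by (rule abs_triangle_ineq)
          also have "\<dots> \<le> 1 / (2 * ?N) * (K * (3/4) ^ m) + B * (3/4) ^ m * (2 * B)"
          proof (intro add_mono mult_mono assms(4) Suc.IH bound y)
            show "\<bar>A (Suc m) i j y - A m i j y\<bar> \<le> B * (3/4) ^ m"
              by (rule order_trans[OF a(2)[OF y]]) (simp add: aB mult_right_mono)
          qed (use B in simp_all)
          finally show ?thesis .
        qed
        have "euler (\<lambda>x. W (Suc (Suc m)) i x - W (Suc m) i x) y
             + real (Suc q) * (W (Suc (Suc m)) i y - W (Suc m) i y)
          = ((\<Sum>j\<in>UNIV. A (Suc m) i j y * W (Suc m) j y) + G (Suc m) i y)
             - ((\<Sum>j\<in>UNIV. A m i j y * W m j y) + G m i y)"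
          unfolding euler_diff[OF d d] 0(4)[OF y, symmetric] by (simp add: algebra_simps)
        also have "\<dots> = (\<Sum>j\<in>UNIV. A (Suc m) i j y * W (Suc m) j y - A m i j y * W m j y) + (G (Suc m) i y - G m i y)"
          by (simp add: sum_subtractf)
        also have "\<bar>\<dots>\<bar> \<le> (\<Sum>j\<in>(UNIV::'n set). 1 / (2 * ?N) * (K * (3/4) ^ m) + B * (3/4) ^ m * (2 * B)) + B * (3/4) ^ m"
        proof (rule order_trans[OF abs_triangle_ineq add_mono])
          show "\<bar>\<Sum>j\<in>UNIV. A (Suc m) i j y * W (Suc m) j y - A m i j y * W m j y\<bar>
            \<le> (\<Sum>j\<in>(UNIV::'n set). 1 / (2 * ?N) * (K * (3/4) ^ m) + B * (3/4) ^ m * (2 * B))"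
            by (rule order_trans[OF sum_abs sum_mono]) (rule t)
          show "\<bar>G (Suc m) i y - G m i y\<bar> \<le> B * (3/4) ^ m"
            by (rule order_trans[OF g(2)[OF y]]) (simp add: gB mult_right_mono)
        qed
        also have "\<dots> = (K / 2 + (?N * (B * (2 * B)) + B)) * (3/4) ^ m"
          by (simp add: distrib_left distrib_right)
        also have "\<dots> \<le> (K * (3/4)) * (3/4) ^ m"
        proof (rule mult_right_mono)
          have "0 \<le> 2 * B" using B by simp
          then show "K / 2 + (?N * (B * (2 * B)) + B) \<le> K * (3/4)" unfolding K_def by argo
        qed simp
        finally show "\<bar>euler (\<lambda>x. W (Suc (Suc m)) i x - W (Suc m) i x) y
             + real (Suc q) * (W (Suc (Suc m)) i y - W (Suc m) i y)\<bar> \<le> K * (3/4) ^ Suc m"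
          by (simp only: power_Suc mult.assoc)
      qed
    qed
    show ?thesis unfolding geo0_def
    proof (intro exI[of _ K] allI ballI conjI)
      show "\<bar>W m i x\<bar> \<le> K" if "x \<in> ?S" for m x using bound[OF that, of m i] K by linarith
    qed (rule diff)
  qed
  then show ?case by simp
next
  case (Suc k)
  let ?S = "ball (0::real^'n) r"
  \<comment> \<open>The undifferentiated equation already gives order k for W. This makes the
    product of W with a derivative of A an admissible source at order k in the differentiated
    equation.\<close>
  have geoW: "geo k ?S (\<lambda>m. W m i)" for i
    by (rule Suc.IH[OF Suc.prems(1-4) geo_SucD[OF Suc.prems(5)] geo_SucD[OF Suc.prems(6)]])
  have "geo k ?S (\<lambda>m. pd l (W m i))" for l
  proof (rule Suc.IH[where q = "Suc q" and W = "\<lambda>m i. pd l (W m i)"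
        and G = "\<lambda>m i x. (\<Sum>j\<in>UNIV. pd l (A m i j) x * W m j x) + pd l (G m i) x"])
    show "smooth_on ?S (pd l (W m i))" for m i by (rule smooth_on_pd[OF Suc.prems(1)])
    have sm: "smooth_on ?S (\<lambda>x. \<Sum>j\<in>UNIV. pd l (A m i j) x * W m j x)" for m i
      by (intro smooth_on_sum smooth_on_mult open_ball smooth_on_pd assms(2) Suc.prems(1))
    then show "smooth_on ?S (\<lambda>x. (\<Sum>j\<in>UNIV. pd l (A m i j) x * W m j x) + pd l (G m i) x)" for m i
      by (rule smooth_on_add[OF open_ball _ smooth_on_pd[OF Suc.prems(2)]])
    show "pd l (W 0 i) x = 0" if "x \<in> ?S" for i x
    proof -
      have "pd l (W 0 i) x = pd l (\<lambda>x. 0) x"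
        by (rule pd_cong[OF open_ball that]) (rule Suc.prems(3))
      then show ?thesis by simp
    qed
    show "geo k ?S (\<lambda>m. A m i j)" for i j by (rule geo_SucD[OF Suc.prems(5)])
    show "geo k ?S (\<lambda>m x. (\<Sum>j\<in>UNIV. pd l (A m i j) x * W m j x) + pd l (G m i) x)" for i
    proof (rule geo_add[OF open_ball sm smooth_on_pd[OF Suc.prems(2)]])
      show "geo k ?S (\<lambda>m. pd l (G m i))" using Suc.prems(6)[of i] by simp
      show "geo k ?S (\<lambda>m x. \<Sum>j\<in>UNIV. pd l (A m i j) x * W m j x)"
      proof (rule geo_sum[OF open_ball finite])
        show "smooth_on ?S (\<lambda>x. pd l (A m i j) x * W m j x)" for j m
          by (intro smooth_on_mult open_ball smooth_on_pd assms(2) Suc.prems(1))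
        show "geo k ?S (\<lambda>m x. pd l (A m i j) x * W m j x)" for j
        proof (rule geo_mult[OF open_ball])
          show "geo k ?S (\<lambda>m. pd l (A m i j))" using Suc.prems(5)[of i j] by simp
        qed (rule smooth_on_pd[OF assms(2)] Suc.prems(1) geoW)+
      qed
    qed
    fix m i x assume x: "x \<in> ?S"
    have d: "A m i j differentiable (at x)" "W m j differentiable (at x)" "G m i differentiable (at x)"
       "(\<lambda>x. A m i j x * W m j x) differentiable (at x)"
       "(\<lambda>x. \<Sum>j\<in>UNIV. A m i j x * W m j x) differentiable (at x)" for j
      by (intro smooth_on_differentiable[OF _ x] smooth_on_sum smooth_on_mult open_ball assms(2) Suc.prems)+
    have "euler (pd l (W (Suc m) i)) x + (real (Suc q) + 1) * pd l (W (Suc m) i) x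
      = pd l (\<lambda>x. (\<Sum>j\<in>UNIV. A m i j x * W m j x) + G m i x) x"
      by (rule euler_pd[OF open_ball Suc.prems(1) x]) (rule Suc.prems(4))
    also have "\<dots> = (\<Sum>j\<in>UNIV. A m i j x * pd l (W m j) x)
        + ((\<Sum>j\<in>UNIV. pd l (A m i j) x * W m j x) + pd l (G m i) x)"
      by (simp add: pd_add[OF d(5,3)] pd_sum d pd_mult sum.distrib)
    finally show "euler (pd l (W (Suc m) i)) x + real (Suc (Suc q)) * pd l (W (Suc m) i) x
      = (\<Sum>j\<in>UNIV. A m i j x * pd l (W m j) x)
        + ((\<Sum>j\<in>UNIV. pd l (A m i j) x * W m j x) + pd l (G m i) x)"
      by (simp add: add_ac)
  qed
  then show ?case using geo_imp_geo0[OF geoW] by simp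
qed

section \<open>Limits of geometrically convergent sequences and their derivatives\<close>

lemma geo0_uniform_limit:
  assumes "geo0 S f"
  shows "uniform_limit S f (\<lambda>x. lim (\<lambda>m. f m x)) sequentially"
proof -
  obtain B where B: "\<And>m x. x \<in> S \<Longrightarrow> \<bar>f (Suc m) x - f m x\<bar> \<le> B * (3/4) ^ m"
    using assms unfolding geo0_def by auto
  have "uniform_limit S (\<lambda>n x. \<Sum>i<n. f (Suc i) x - f i x) (\<lambda>x. suminf (\<lambda>i. f (Suc i) x - f i x)) sequentially"
  proof (rule Weierstrass_m_test)
    show "norm (f (Suc n) x - f n x) \<le> B * (3/4) ^ n" if "x \<in> S" for n x using B[OF that, of n] by simp
    show "summable (\<lambda>n. B * (3/4::real) ^ n)" by (intro summable_mult summable_geometric) simp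
  qed
  then have "uniform_limit S (\<lambda>n x. f 0 x + (\<Sum>i<n. f (Suc i) x - f i x))
      (\<lambda>x. f 0 x + suminf (\<lambda>i. f (Suc i) x - f i x)) sequentially"
    by (rule uniform_limit_add[OF uniform_limit_const])
  moreover have "(\<lambda>n x. f 0 x + (\<Sum>i<n. f (Suc i) x - f i x)) = f"
    using sum_lessThan_telescope[of "\<lambda>i. f i x" for x] by (simp add: fun_eq_iff)
  ultimately have "uniform_limit S f (\<lambda>x. f 0 x + suminf (\<lambda>i. f (Suc i) x - f i x)) sequentially"
    by simp
  then show ?thesis
    using uniformly_convergentI uniformly_convergent_uniform_limit_iff by blast
qed

lemma geo0_tendsto: "geo0 S f \<Longrightarrow> x \<in> S \<Longrightarrow> (\<lambda>m. f m x) \<longlonglongrightarrow> lim (\<lambda>m. f m x)"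
  by (rule tendsto_uniform_limitI[OF geo0_uniform_limit])

lemma geo_limit_has_derivative:
  fixes f :: "nat \<Rightarrow> real^'n::finite \<Rightarrow> real"
  assumes "\<And>m. smooth_on (ball 0 r) (f m)" "geo (Suc 0) (ball 0 r) f" "x \<in> ball 0 r"
  shows "((\<lambda>x. lim (\<lambda>m. f m x)) has_derivative (\<lambda>u. \<Sum>l\<in>UNIV. u $ l * lim (\<lambda>m. pd l (f m) x))) (at x)"
proof -
  let ?S = "ball (0::real^'n) r"
  have "\<exists>g. \<forall>x\<in>?S. (\<lambda>n. f n x) \<longlonglongrightarrow> g x \<and>
      (g has_derivative (\<lambda>u. \<Sum>l\<in>UNIV. u $ l * lim (\<lambda>m. pd l (f m) x))) (at x within ?S)"
  proof (rule has_derivative_sequence[OF convex_ball])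
    show "(f n has_derivative (\<lambda>u. \<Sum>l\<in>UNIV. u $ l *\<^sub>R pd l (f n) x)) (at x within ?S)" if "x \<in> ?S" for n x
      by (rule has_derivative_at_withinI[OF has_derivative_pd[OF smooth_on_differentiable[OF assms(1) that]]])
    show "x \<in> ?S" by (rule assms(3))
    show "(\<lambda>n. f n x) \<longlonglongrightarrow> lim (\<lambda>m. f m x)"
      by (rule geo0_tendsto[OF _ assms(3)]) (use assms(2) in simp)
    fix e :: real assume e: "e > 0"
    have "\<forall>l\<in>UNIV. \<forall>\<^sub>F n in sequentially. \<forall>x\<in>?S. dist (pd l (f n) x) (lim (\<lambda>m. pd l (f m) x)) < e / real CARD('n)"
    proof
      fix l
      have "geo0 ?S (\<lambda>m. pd l (f m))" using assms(2) by simp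
      from uniform_limitD[OF geo0_uniform_limit[OF this]] e
      show "\<forall>\<^sub>F n in sequentially. \<forall>x\<in>?S. dist (pd l (f n) x) (lim (\<lambda>m. pd l (f m) x)) < e / real CARD('n)"
        by simp
    qed
    then have "\<forall>\<^sub>F n in sequentially. \<forall>l\<in>UNIV. \<forall>x\<in>?S. dist (pd l (f n) x) (lim (\<lambda>m. pd l (f m) x)) < e / real CARD('n)"
      by (rule eventually_ball_finite[OF finite])
    then show "\<forall>\<^sub>F n in sequentially. \<forall>x\<in>?S. \<forall>u. norm ((\<Sum>l\<in>UNIV. u $ l *\<^sub>R pd l (f n) x)
        - (\<Sum>l\<in>UNIV. u $ l * lim (\<lambda>m. pd l (f m) x))) \<le> e * norm u"
    proof (rule eventually_mono, intro ballI allI)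
      fix n x and u :: "real^'n"
      assume n: "\<forall>l\<in>UNIV. \<forall>x\<in>?S. dist (pd l (f n) x) (lim (\<lambda>m. pd l (f m) x)) < e / real CARD('n)" and x: "x \<in> ?S"
      have "norm ((\<Sum>l\<in>UNIV. u $ l *\<^sub>R pd l (f n) x) - (\<Sum>l\<in>UNIV. u $ l * lim (\<lambda>m. pd l (f m) x)))
        = \<bar>\<Sum>l\<in>UNIV. u $ l * (pd l (f n) x - lim (\<lambda>m. pd l (f m) x))\<bar>"
        by (simp add: sum_subtractf right_diff_distrib)
      also have "\<dots> \<le> (\<Sum>l\<in>(UNIV::'n set). norm u * (e / real CARD('n)))"
      proof (rule order_trans[OF sum_abs sum_mono])
        fix l
        have "\<bar>pd l (f n) x - lim (\<lambda>m. pd l (f m) x)\<bar> \<le> e / real CARD('n)"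
          using n x by (auto simp: dist_real_def less_imp_le)
        then show "\<bar>u $ l * (pd l (f n) x - lim (\<lambda>m. pd l (f m) x))\<bar> \<le> norm u * (e / real CARD('n))"
          unfolding abs_mult by (intro mult_mono component_le_norm_cart) auto
      qed
      also have "\<dots> = e * norm u" by simp
      finally show "norm ((\<Sum>l\<in>UNIV. u $ l *\<^sub>R pd l (f n) x)
        - (\<Sum>l\<in>UNIV. u $ l * lim (\<lambda>m. pd l (f m) x))) \<le> e * norm u" .
    qed
  qed
  then obtain g where g: "\<And>x. x \<in> ?S \<Longrightarrow> (\<lambda>n. f n x) \<longlonglongrightarrow> g x"
    "\<And>x. x \<in> ?S \<Longrightarrow> (g has_derivative (\<lambda>u. \<Sum>l\<in>UNIV. u $ l * lim (\<lambda>m. pd l (f m) x))) (at x within ?S)"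
    by (auto simp del: mem_ball mem_ball_0)
  have eq: "g y = lim (\<lambda>m. f m y)" if "y \<in> ?S" for y using limI[OF g(1)[OF that]] by simp
  have "(g has_derivative (\<lambda>u. \<Sum>l\<in>UNIV. u $ l * lim (\<lambda>m. pd l (f m) x))) (at x)"
    using g(2)[OF assms(3)] unfolding at_within_open[OF assms(3) open_ball] .
  then show ?thesis by (rule has_derivative_transform_within_open[OF _ open_ball assms(3) eq])
qed

lemma pd_geo_limit:
  fixes f :: "nat \<Rightarrow> real^'n::finite \<Rightarrow> real"
  assumes "\<And>m. smooth_on (ball 0 r) (f m)" "geo (Suc 0) (ball 0 r) f" "x \<in> ball 0 r"
  shows "pd l (\<lambda>x. lim (\<lambda>m. f m x)) x = lim (\<lambda>m. pd l (f m) x)"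
proof -
  have "(\<Sum>k\<in>UNIV. axis l 1 $ k * lim (\<lambda>m. pd k (f m) x)) = (\<Sum>k\<in>UNIV. if k = l then lim (\<lambda>m. pd k (f m) x) else 0)"
    by (intro sum.cong) (auto simp: axis_def)
  then show ?thesis using pd_eqI[OF geo_limit_has_derivative[OF assms], of l] by simp
qed

text \<open>Derivative and limit may be exchanged at each order because the derivatives of every
  order converge uniformly on the same ball; the derivative sequence then satisfies the same
  hypotheses.\<close>

lemma smooth_on_geo_limit:
  fixes f :: "nat \<Rightarrow> real^'n::finite \<Rightarrow> real"
  assumes "\<And>m. smooth_on (ball 0 r) (f m)" "\<And>k. geo k (ball 0 r) f"
  shows "smooth_on (ball 0 r) (\<lambda>x. lim (\<lambda>m. f m x))"
  unfolding smooth_on_def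
proof
  fix k show "Cdiff k (ball 0 r) (\<lambda>x. lim (\<lambda>m. f m x))"
    using assms
  proof (induction k arbitrary: f)
    case 0
    have "uniform_limit (ball 0 r) f (\<lambda>x. lim (\<lambda>m. f m x)) sequentially"
      by (rule geo0_uniform_limit) (use 0(2)[of 0] in simp)
    moreover have "\<forall>\<^sub>F n in sequentially. continuous_on (ball 0 r) (f n)"
      using smooth_on_continuous[OF 0(1)] by simp
    ultimately show ?case
      using uniform_limit_theorem[of "ball 0 r" f sequentially] by simp
  next
    case (Suc k)
    have "Cdiff k (ball 0 r) (pd l (\<lambda>x. lim (\<lambda>m. f m x)))" for l
    proof (rule Cdiff_cong[OF open_ball pd_geo_limit[OF Suc.prems(1) Suc.prems(2), symmetric]])
      show "Cdiff k (ball 0 r) (\<lambda>x. lim (\<lambda>m. pd l (f m) x))"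
      proof (rule Suc.IH)
        show "geo j (ball 0 r) (\<lambda>m. pd l (f m))" for j using Suc.prems(2)[of "Suc j"] by simp
      qed (rule smooth_on_pd[OF Suc.prems(1)])
    qed
    then show ?case
      using differentiableI[OF geo_limit_has_derivative[OF Suc.prems(1) Suc.prems(2)]] by simp
  qed
qed

section \<open>The flow as a solution of a singular equation\<close>

text \<open>In 1 / (2 N^2) one factor N pays for summing over the directions and the other for
  passing from components to the norm, so h - id is Lipschitz with constant 1/2. This gives both
  injectivity of h and the bound 2 |x| for its values.\<close>

lemma near_identity_lipschitz:
  fixes h :: "real^'n::finite \<Rightarrow> real^'n"
  assumes "convex S" "\<And>x. x \<in> S \<Longrightarrow> h differentiable (at x)"
    and "\<And>x l i. x \<in> S \<Longrightarrow> \<bar>pd l h x $ i - axis l 1 $ i\<bar> \<le> 1 / (2 * (real CARD('n))\<^sup>2)"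
    and "x \<in> S" "y \<in> S"
  shows "norm (h x - h y - (x - y)) \<le> 1/2 * norm (x - y)"
proof -
  let ?N = "real CARD('n)"
  have "\<bar>(h x - h y - (x - y)) $ i\<bar> \<le> ?N * (1 / (2 * ?N\<^sup>2)) * norm (x - y)" for i
  proof -
    have d: "(\<lambda>x. h x $ i) differentiable (at z)" "(\<lambda>x::real^'n. x $ i) differentiable (at z)" if "z \<in> S" for z
      using differentiable_linear[OF bounded_linear_coord assms(2)[OF that]]
        differentiable_linear[OF bounded_linear_coord, of "\<lambda>x. x" z i] by simp_all
    have "\<bar>(h x $ i - x $ i) - (h y $ i - y $ i)\<bar> \<le> ?N * (1 / (2 * ?N\<^sup>2)) * norm (x - y)"
    proof (rule component_lipschitz[OF assms(1) _ _ assms(4,5)])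
      show "(\<lambda>x. h x $ i - x $ i) differentiable (at z)" if "z \<in> S" for z
        by (rule differentiable_diff[OF d[OF that]])
      show "\<bar>pd l (\<lambda>x. h x $ i - x $ i) z\<bar> \<le> 1 / (2 * ?N\<^sup>2)" if "z \<in> S" for z l
        using assms(3)[OF that, of l i]
        unfolding pd_diff[OF d[OF that]] pd_component[OF assms(2)[OF that]] pd_coord by (simp add: axis_def)
    qed
    then show ?thesis by (simp add: algebra_simps)
  qed
  from norm_le_card[OF this] show ?thesis by (simp add: power2_eq_square)
qed

text \<open>The iterates solve E h' = h' + X o h, starting from the identity. Their first
  derivatives satisfy E d_l h' = (DX o h) d_l h with a right-hand side of size O(|x|), so they form
  a contracting sequence on a small ball. The second derivatives satisfy an equation with E + 1 that
  is linear in the previous second derivatives, so \<open>geo_linear\<close> supplies all higher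
  orders without a further change of the ball.\<close>

theorem euler_flow:
  fixes X :: "real^'n::finite \<Rightarrow> real^'n"
  assumes "smooth_on (ball 0 1) X" "X 0 = 0" "\<And>l. pd l X 0 = 0"
  obtains r h where "0 < r" "r \<le> 1/4" "smooth_on (ball 0 r) h" "h 0 = 0" "\<And>l. pd l h 0 = axis l 1"
    "\<And>x. x \<in> ball 0 r \<Longrightarrow> norm (h x) \<le> 2 * norm x"
    "\<And>x l i. x \<in> ball 0 r \<Longrightarrow> \<bar>pd l h x $ i - axis l 1 $ i\<bar> \<le> 1 / (2 * (real CARD('n))\<^sup>2)"
    "\<And>x. x \<in> ball 0 r \<Longrightarrow> euler h x = h x + X (h x)"
proof -
  let ?N = "real CARD('n)" and ?K = "cball (0::real^'n) (1/2)"
  have N: "1 \<le> ?N" by (simp add: Suc_leI)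
  define \<epsilon> where "\<epsilon> = 1 / (2 * ?N\<^sup>2)"
  have \<epsilon>: "0 < \<epsilon>" "\<epsilon> \<le> 1" using N by (simp_all add: \<epsilon>_def power2_eq_square field_simps mult_ge1_I add_increasing)
  define Z where "Z i = (\<lambda>y. X y $ i)" for i
  have Z: "smooth_on (ball 0 1) (Z i)" for i
    unfolding Z_def by (rule smooth_on_linear[OF open_ball bounded_linear_coord assms(1)])
  have Z0: "Z i 0 = 0" for i by (simp add: Z_def assms(2))
  have ZD0: "pd j (Z i) 0 = 0" for i j
    unfolding Z_def using pd_component[OF smooth_on_differentiable[OF assms(1)], of 0] assms(3) by simp
  have KT: "?K \<subseteq> ball 0 1" by auto
  have "\<exists>B\<ge>0. \<forall>y\<in>?K. \<forall>z\<in>?K. \<bar>pd j (Z i) y - pd j (Z i) z\<bar> \<le> B * norm (y - z)" for i j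
    by (rule compact_lipschitz[OF smooth_on_pd[OF Z, of j i] compact_cball convex_cball KT]) blast
  then have "\<forall>i j. \<exists>B\<ge>0. \<forall>y\<in>?K. \<forall>z\<in>?K. \<bar>pd j (Z i) y - pd j (Z i) z\<bar> \<le> B * norm (y - z)" by simp
  then obtain c where c': "\<forall>i j. 0 \<le> c i j \<and>
      (\<forall>y\<in>?K. \<forall>z\<in>?K. \<bar>pd j (Z i) y - pd j (Z i) z\<bar> \<le> c i j * norm (y - z))"
    unfolding choice_iff by blast
  then have c: "\<And>i j. 0 \<le> c i j"
    "\<And>i j y z. y \<in> ?K \<Longrightarrow> z \<in> ?K \<Longrightarrow> \<bar>pd j (Z i) y - pd j (Z i) z\<bar> \<le> c i j * norm (y - z)"
    by blast+
  \<comment> \<open>A common Lipschitz constant for the entries of DX on the ball of radius 1/2; as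
    DX vanishes at 0, it also gives |DX y| \<le> C |y| entrywise. The summand 1 makes it safe to
    divide by C.\<close>
  define C where "C = 1 + (\<Sum>i\<in>UNIV. \<Sum>j\<in>UNIV. c i j)"
  have cC: "c i j \<le> C" for i j
  proof -
    have "c i j \<le> (\<Sum>j\<in>UNIV. c i j)" by (rule member_le_sum) (auto simp: c)
    also have "\<dots> \<le> (\<Sum>i\<in>UNIV. \<Sum>j\<in>UNIV. c i j)"
      by (rule member_le_sum[of i UNIV "\<lambda>i. \<Sum>j\<in>UNIV. c i j"]) (auto simp: c sum_nonneg)
    finally show ?thesis unfolding C_def by simp
  qed
  have C: "1 \<le> C" unfolding C_def by (simp add: sum_nonneg c)
  have lip: "\<bar>pd j (Z i) y - pd j (Z i) z\<bar> \<le> C * norm (y - z)" if "y \<in> ?K" "z \<in> ?K" for i j y z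
    by (rule order_trans[OF c(2)[OF that] mult_right_mono[OF cC]]) simp
  have small: "\<bar>pd j (Z i) y\<bar> \<le> C * norm y" if "y \<in> ?K" for i j y
    using lip[OF that, of 0 j i] ZD0 by simp
  \<comment> \<open>Three estimates lead to 1 / (8 N^3 C): \<open>r1\<close> keeps the first
    derivatives close to the identity, \<open>r2\<close> gives them the contraction factor 1/2, and
    \<open>r3\<close> makes the coefficients of the second-derivative equation at most 1 / (2 N).
    The cap 1/4 keeps the values, of norm at most 2 r, in the ball of radius 1/2.\<close>
  define r where "r = min (1/4) (1 / (8 * ?N^3 * C))"
  have r: "0 < r" "r \<le> 1/4" using N C by (auto simp: r_def)
  have r8: "8 * ?N^3 * C * r \<le> 1"
  proof -
    have "8 * ?N^3 * C * r \<le> 8 * ?N^3 * C * (1 / (8 * ?N^3 * C))"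
      by (rule mult_left_mono) (use C in \<open>auto simp: r_def\<close>)
    then show ?thesis using C by simp
  qed
  have N3: "?N \<le> ?N^3" "?N + ?N^3 \<le> 2 * ?N^3" "1 \<le> ?N^3"
    using self_le_power[OF N, of 3] N by simp_all
  have r1: "4 * ?N * C * r \<le> \<epsilon>"
  proof -
    have "4 * ?N * C * r = \<epsilon> * (8 * ?N^3 * C * r)" using N by (simp add: \<epsilon>_def power3_eq_cube power2_eq_square)
    also have "\<dots> \<le> \<epsilon> * 1" by (rule mult_left_mono[OF r8]) (use \<epsilon> in simp)
    finally show ?thesis by simp
  qed
  have r2: "2 * (?N + ?N^3) * C * r \<le> 1/2"
  proof -
    have "4 * (?N + ?N^3) * (C * r) \<le> 4 * (2 * ?N^3) * (C * r)"
      by (intro mult_right_mono mult_left_mono N3) (use C r in auto)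
    also have "\<dots> = 8 * ?N^3 * C * r" by simp
    finally have "4 * (?N + ?N^3) * (C * r) \<le> 1" using r8 by (rule order_trans)
    moreover have "2 * (?N + ?N^3) * C * r = 1/2 * (4 * (?N + ?N^3) * (C * r))" by simp
    ultimately show ?thesis by linarith
  qed
  have r3: "C * (2 * r) \<le> 1 / (2 * ?N)"
  proof -
    have "4 * ?N * (C * r) \<le> 8 * ?N^3 * (C * r)"
      by (rule mult_right_mono) (use N3 C r in \<open>linarith, simp\<close>)
    then have "4 * ?N * (C * r) \<le> 1" using r8 by (simp add: mult_ac)
    then show ?thesis using N by (simp add: field_simps)
  qed
  let ?S = "ball (0::real^'n) r"
  have zero: "0 \<in> ?S" using r by simp
  \<comment> \<open>The class of maps preserved by the iteration; \<epsilon> is the tolerance of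
    \<open>near_identity_lipschitz\<close>.\<close>
  define P where "P h \<longleftrightarrow> smooth_on ?S h \<and> h 0 = 0 \<and> (\<forall>l. pd l h 0 = axis l 1) \<and>
     (\<forall>x\<in>?S. \<forall>l i. \<bar>pd l h x $ i - axis l 1 $ i\<bar> \<le> \<epsilon>)" for h :: "real^'n \<Rightarrow> real^'n"
  have Pnorm: "norm (h x) \<le> 2 * norm x" if "P h" "x \<in> ?S" for h x
  proof -
    have "norm (h x - h 0 - (x - 0)) \<le> 1/2 * norm (x - 0)"
    proof (rule near_identity_lipschitz[OF convex_ball _ _ that(2) zero])
      show "h differentiable (at z)" if "z \<in> ?S" for z
        using smooth_on_differentiable[of ?S h z] that \<open>P h\<close> by (simp add: P_def)
      show "\<bar>pd l h z $ i - axis l 1 $ i\<bar> \<le> 1 / (2 * ?N\<^sup>2)" if "z \<in> ?S" for z l i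
        using \<open>P h\<close> that unfolding P_def \<epsilon>_def by blast
    qed
    moreover have "h 0 = 0" using that(1) by (simp add: P_def)
    ultimately have "norm (h x - x) \<le> 1/2 * norm x" by simp
    then show ?thesis using norm_triangle_sub[of "h x" x] norm_ge_zero[of x] by linarith
  qed
  have PK: "h x \<in> ?K" if "P h" "x \<in> ?S" for h x
    using Pnorm[OF that] that(2) r by simp
  have Psm: "smooth_on ?S h" "\<And>i. smooth_on ?S (\<lambda>x. h x $ i)" if "P h" for h
    using that smooth_on_component_iff[OF open_ball, of 0 r h] by (simp_all add: P_def)
  have Pd: "\<bar>pd l h x $ j\<bar> \<le> 2" if "P h" "x \<in> ?S" for h x l j
  proof -
    have "\<bar>pd l h x $ j - axis l 1 $ j\<bar> \<le> \<epsilon>" using that unfolding P_def by blast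
    moreover have "\<bar>axis l (1::real) $ j\<bar> \<le> 1" by (simp add: axis_def)
    ultimately show ?thesis using \<epsilon> by linarith
  qed
  have comp: "smooth_on ?S (\<lambda>x. \<psi> (h x))" if "P h" "smooth_on (ball 0 1) \<psi>" for h and \<psi> :: "real^'n \<Rightarrow> real"
  proof (rule smooth_on_compose[OF open_ball open_ball _ that(2) Psm(1)[OF that(1)]])
    show "h ` ?S \<subseteq> ball 0 1" using PK[OF that(1)] KT by blast
  qed
  have pdZ: "pd l (\<lambda>x. \<psi> (h x)) x = (\<Sum>j\<in>UNIV. pd l h x $ j * pd j \<psi> (h x))"
    if "P h" "x \<in> ?S" "smooth_on (ball 0 1) \<psi>" for h x l and \<psi> :: "real^'n \<Rightarrow> real"
  proof -
    have "h x \<in> ball 0 1" using PK[OF that(1,2)] KT by blast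
    from pd_chain[OF smooth_on_differentiable[OF Psm(1)[OF that(1)] that(2)] smooth_on_differentiable[OF that(3) this], of l]
    show ?thesis by simp
  qed
  have Deq: "euler (pd l (\<lambda>x. h' x $ i)) x = (\<Sum>j\<in>UNIV. pd l h x $ j * pd j (Z i) (h x))"
    if "P h" "smooth_on ?S h'" "\<forall>x\<in>?S. euler h' x = h' x + X (h x)" "x \<in> ?S" for h h' l i x
  proof -
    have sm: "smooth_on ?S (\<lambda>x. h' x $ i)"
      by (rule smooth_on_linear[OF open_ball bounded_linear_coord that(2)])
    \<comment> \<open>\<open>euler_pd\<close> with c = -1: one derivative removes the resonant
      zeroth-order term.\<close>
    have "euler (pd l (\<lambda>x. h' x $ i)) x + (- 1 + 1) * pd l (\<lambda>x. h' x $ i) x = pd l (\<lambda>x. Z i (h x)) x"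
    proof (rule euler_pd[OF open_ball sm that(4)])
      show "euler (\<lambda>x. h' x $ i) y + - 1 * h' y $ i = Z i (h y)" if "y \<in> ?S" for y
        using bspec[OF \<open>\<forall>x\<in>?S. euler h' x = h' x + X (h x)\<close> that]
        unfolding euler_component[OF smooth_on_differentiable[OF \<open>smooth_on ?S h'\<close> that]] Z_def by simp
    qed
    then show ?thesis using pdZ[OF that(1,4) Z] by simp
  qed
  have step: "\<exists>h'. P h' \<and> (\<forall>x\<in>?S. euler h' x = h' x + X (h x))" if Ph: "P h" for h
  proof -
    have "\<exists>u. smooth_on ?S u \<and> u 0 = 0 \<and> (\<forall>l. pd l u 0 = 0) \<and> (\<forall>x\<in>?S. euler u x = u x + Z i (h x))" for i
    proof -
      have "pd l (\<lambda>x. Z i (h x)) 0 = 0" for l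
        using pdZ[OF Ph zero Z] Ph by (simp add: P_def ZD0)
      moreover have "Z i (h 0) = 0" using Ph by (simp add: P_def Z0)
      ultimately show ?thesis
        by (rule_tac euler_quadratic_solution[OF comp[OF Ph Z] _ _ r(1), of i]) blast+
    qed
    then obtain u where u: "\<And>i. smooth_on ?S (u i)" "\<And>i. u i 0 = 0" "\<And>i l. pd l (u i) 0 = 0"
      "\<And>i x. x \<in> ?S \<Longrightarrow> euler (u i) x = u i x + Z i (h x)" by metis
    \<comment> \<open>The identity satisfies E x = x, so it may be added to the correction u without
      changing the equation; this choice fixes the linear part.\<close>
    define h' where "h' x = (\<chi> i. x $ i + u i x)" for x
    have h'i: "h' x $ i = x $ i + u i x" for x i by (simp add: h'_def)
    have sm: "smooth_on ?S h'"
      unfolding smooth_on_component_iff[OF open_ball] h'_def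
      by (simp add: smooth_on_add smooth_on_coord u(1))
    have dh: "h' differentiable (at x)" if "x \<in> ?S" for x by (rule smooth_on_differentiable[OF sm that])
    have d: "(\<lambda>x. x $ i) differentiable (at x)" "u i differentiable (at x)" if "x \<in> ?S" for i x
      by (rule smooth_on_differentiable[OF smooth_on_coord[OF open_ball] that])
         (rule smooth_on_differentiable[OF u(1) that])
    have pdh: "pd l h' x $ i = axis l 1 $ i + pd l (u i) x" if "x \<in> ?S" for l i x
      using pd_component[OF dh[OF that], of l i] pd_add[OF d[OF that], of l i]
      by (simp add: h'_def pd_coord axis_def)
    have eul: "\<forall>x\<in>?S. euler h' x = h' x + X (h x)"
    proof
      fix x assume that: "x \<in> ?S"
      have "euler h' x $ i = (h' x + X (h x)) $ i" for i
      proof -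
        have "euler h' x $ i = (\<Sum>l\<in>UNIV. x $ l * axis l 1 $ i) + (\<Sum>l\<in>UNIV. x $ l * pd l (u i) x)"
          by (simp add: euler_def pdh[OF that] distrib_left sum.distrib)
        also have "(\<Sum>l\<in>UNIV. x $ l * axis l 1 $ i) = x $ i"
          using arg_cong[OF basis_expansion[of x], of "\<lambda>v. v $ i"] by simp
        also have "(\<Sum>l\<in>UNIV. x $ l * pd l (u i) x) = u i x + Z i (h x)"
          using u(4)[OF that, of i] by (simp add: euler_def)
        finally show ?thesis by (simp add: h'i Z_def)
      qed
      then show "euler h' x = h' x + X (h x)" by (simp add: vec_eq_iff)
    qed
    have pd0: "pd l h' 0 = axis l 1" for l
      using pdh[OF zero, of l] u(3) by (simp add: vec_eq_iff)
    have "\<bar>pd l h' x $ i - axis l 1 $ i\<bar> \<le> \<epsilon>" if x: "x \<in> ?S" for x l i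
    proof -
      \<comment> \<open>Each of the N terms of the Euler derivative is at most 2 for the first
        derivative of h times C (2 |y|) for DX at h y, in total 4 N C |y|.\<close>
      have "\<bar>pd l (\<lambda>x. h' x $ i) x - pd l (\<lambda>x. h' x $ i) 0\<bar> \<le> (4 * ?N * C) * norm x"
      proof (rule euler_bound_0[OF smooth_on_pd[OF smooth_on_linear[OF open_ball bounded_linear_coord sm]] _ x])
        fix y assume y: "y \<in> ?S"
        have "\<bar>euler (pd l (\<lambda>x. h' x $ i)) y\<bar> \<le> (\<Sum>j\<in>(UNIV::'n set). 2 * (C * (2 * norm y)))"
          unfolding Deq[OF Ph sm eul y]
        proof (rule order_trans[OF sum_abs sum_mono])
          fix j
          have "\<bar>pd j (Z i) (h y)\<bar> \<le> C * (2 * norm y)"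
            by (rule order_trans[OF small[OF PK[OF Ph y]] mult_left_mono[OF Pnorm[OF Ph y]]]) (use C in simp)
          then show "\<bar>pd l h y $ j * pd j (Z i) (h y)\<bar> \<le> 2 * (C * (2 * norm y))"
            unfolding abs_mult by (intro mult_mono Pd[OF Ph y]) auto
        qed
        then show "\<bar>euler (pd l (\<lambda>x. h' x $ i)) y\<bar> \<le> (4 * ?N * C) * norm y" by (simp add: mult_ac)
      qed
      also have "\<dots> \<le> (4 * ?N * C) * r" by (rule mult_left_mono) (use x C in auto)
      also note r1
      finally show ?thesis
        unfolding pd_component[OF dh[OF x]] pd_component[OF dh[OF zero]] pd0 .
    qed
    then have "P h'" unfolding P_def using sm pd0 by (auto simp: h'_def u(2) vec_eq_iff)
    with eul show ?thesis by blast
  qed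
  have pdid: "pd l (\<lambda>x::real^'n. x) = (\<lambda>x. axis l 1)" for l by (rule ext) (rule pd_id)
  have Pid: "P (\<lambda>x. x)"
    unfolding P_def pdid using \<epsilon> smooth_on_id by simp
  have "\<exists>h. \<forall>n. (P (h n) \<and> (n = 0 \<longrightarrow> h n = (\<lambda>x. x))) \<and> (\<forall>x\<in>?S. euler (h (Suc n)) x = h (Suc n) x + X (h n x))"
    by (rule dependent_nat_choice) (use Pid step in auto)
  then obtain h where Ph: "\<And>m. P (h m)" and h0: "h 0 = (\<lambda>x. x)"
    and heq: "\<And>m. \<forall>x\<in>?S. euler (h (Suc m)) x = h (Suc m) x + X (h m x)"
    by blast
  have dh: "h m differentiable (at x)" if "x \<in> ?S" for m x
    by (rule smooth_on_differentiable[OF Psm(1)[OF Ph] that])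
  define H where "H i m = (\<lambda>x. h m x $ i)" for i m
  have smH: "smooth_on ?S (H i m)" for i m unfolding H_def by (rule Psm(2)[OF Ph])
  have pdH: "pd l (H i m) x = pd l (h m) x $ i" if "x \<in> ?S" for l i m x
    unfolding H_def by (rule pd_component[OF dh[OF that]])
  have DeqH: "euler (pd l (H i (Suc m))) x = (\<Sum>j\<in>UNIV. pd l (H j m) x * pd j (Z i) (h m x))"
    if "x \<in> ?S" for l i m x
    using Deq[OF Ph[of m] Psm(1)[OF Ph[of "Suc m"]] heq that, of l i] unfolding H_def[symmetric] pdH[OF that] .
  \<comment> \<open>All iterates vanish at 0, so a difference of first derivatives integrates to a
    difference of values with a factor |x|. That factor is what \<open>euler_bound_0\<close>
    requires in the next estimate.\<close>
  have dlip: "\<bar>h (Suc m) x $ i - h m x $ i\<bar> \<le> ?N * (1/2)^m * norm x"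
    if "\<And>x l i. x \<in> ?S \<Longrightarrow> \<bar>pd l (h (Suc m)) x $ i - pd l (h m) x $ i\<bar> \<le> (1/2)^m" "x \<in> ?S" for m x i
  proof -
    have d: "H i m differentiable (at z)" if "z \<in> ?S" for z i m by (rule smooth_on_differentiable[OF smH that])
    have "\<bar>(H i (Suc m) x - H i m x) - (H i (Suc m) 0 - H i m 0)\<bar> \<le> ?N * (1/2)^m * norm (x - 0)"
      by (rule component_lipschitz[OF convex_ball _ _ that(2) zero])
         (simp_all add: d pd_diff[OF d d] pdH that(1) del: mem_ball mem_ball_0)
    moreover have "h k 0 = 0" for k using Ph[of k] by (simp add: P_def)
    ultimately show ?thesis by (simp add: H_def)
  qed
  \<comment> \<open>The difference of the products (DX o h) d_l h splits in two: the change of d_l h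
    costs q C (2 |y|), the change of DX costs 2 C N^2 q |y|, where q is the previous power of 1/2.
    Summing over N indices gives the constant in \<open>r2\<close>.\<close>
  have conv: "\<bar>pd l (h (Suc m)) x $ i - pd l (h m) x $ i\<bar> \<le> (1/2)^m" if "x \<in> ?S" for m x l i
    using that
  proof (induction m arbitrary: x l i)
    case 0
    have "\<bar>pd l (h (Suc 0)) x $ i - axis l 1 $ i\<bar> \<le> \<epsilon>" using Ph[of "Suc 0"] 0 unfolding P_def by blast
    then show ?case using \<epsilon> by (simp add: h0 pdid)
  next
    case (Suc m)
    let ?q = "(1/2::real)^m"
    have "\<bar>(pd l (H i (Suc (Suc m))) x - pd l (H i (Suc m)) x)
       - (pd l (H i (Suc (Suc m))) 0 - pd l (H i (Suc m)) 0)\<bar> \<le> (2 * (?N + ?N^3) * C * ?q) * norm x"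
    proof (rule euler_bound_0[OF smooth_on_diff[OF open_ball smooth_on_pd[OF smH] smooth_on_pd[OF smH]] _ Suc.prems])
      fix y assume y: "y \<in> ?S"
      have t: "\<bar>pd l (H j (Suc m)) y * pd j (Z i) (h (Suc m) y) - pd l (H j m) y * pd j (Z i) (h m y)\<bar>
         \<le> ?q * (C * (2 * norm y)) + 2 * (C * (?N * (?N * ?q * norm y)))" for j
      proof -
        have 1: "\<bar>pd j (Z i) (h (Suc m) y)\<bar> \<le> C * (2 * norm y)"
          by (rule order_trans[OF small[OF PK[OF Ph y]] mult_left_mono[OF Pnorm[OF Ph y]]]) (use C in simp)
        have "norm (h (Suc m) y - h m y) \<le> ?N * (?N * ?q * norm y)"
          by (rule norm_le_card) (use dlip[OF Suc.IH y] in simp)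
        then have 2: "\<bar>pd j (Z i) (h (Suc m) y) - pd j (Z i) (h m y)\<bar> \<le> C * (?N * (?N * ?q * norm y))"
          by (intro order_trans[OF lip[OF PK[OF Ph y] PK[OF Ph y]] mult_left_mono]) (use C in simp_all)
        have "pd l (H j (Suc m)) y * pd j (Z i) (h (Suc m) y) - pd l (H j m) y * pd j (Z i) (h m y)
          = (pd l (H j (Suc m)) y - pd l (H j m) y) * pd j (Z i) (h (Suc m) y)
            + pd l (H j m) y * (pd j (Z i) (h (Suc m) y) - pd j (Z i) (h m y))"
          by (simp add: algebra_simps)
        also have "\<bar>\<dots>\<bar> \<le> \<bar>pd l (H j (Suc m)) y - pd l (H j m) y\<bar> * \<bar>pd j (Z i) (h (Suc m) y)\<bar>
            + \<bar>pd l (H j m) y\<bar> * \<bar>pd j (Z i) (h (Suc m) y) - pd j (Z i) (h m y)\<bar>"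
          unfolding abs_mult[symmetric] by (rule abs_triangle_ineq)
        also have "\<dots> \<le> ?q * (C * (2 * norm y)) + 2 * (C * (?N * (?N * ?q * norm y)))"
          unfolding pdH[OF y] by (intro add_mono mult_mono Suc.IH[OF y] Pd[OF Ph y] 1 2) auto
        finally show ?thesis .
      qed
      have d: "pd l (H i m) differentiable (at y)" for m
        by (rule smooth_on_differentiable[OF smooth_on_pd[OF smH] y])
      have "\<bar>euler (\<lambda>x. pd l (H i (Suc (Suc m))) x - pd l (H i (Suc m)) x) y\<bar>
        = \<bar>\<Sum>j\<in>UNIV. pd l (H j (Suc m)) y * pd j (Z i) (h (Suc m) y) - pd l (H j m) y * pd j (Z i) (h m y)\<bar>"
        by (simp add: euler_diff[OF d d] DeqH[OF y] sum_subtractf)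
      also have "\<dots> \<le> (\<Sum>j\<in>(UNIV::'n set). ?q * (C * (2 * norm y)) + 2 * (C * (?N * (?N * ?q * norm y))))"
        by (rule order_trans[OF sum_abs sum_mono]) (rule t)
      also have "\<dots> = (2 * (?N + ?N^3) * C * ?q) * norm y"
        by (simp add: algebra_simps power3_eq_cube)
      finally show "\<bar>euler (\<lambda>x. pd l (H i (Suc (Suc m))) x - pd l (H i (Suc m)) x) y\<bar>
         \<le> (2 * (?N + ?N^3) * C * ?q) * norm y" .
    qed
    also have "\<dots> \<le> (2 * (?N + ?N^3) * C * ?q) * r"
      by (rule mult_left_mono) (use Suc.prems C in auto)
    also have "\<dots> = (2 * (?N + ?N^3) * C * r) * ?q" by (simp only: mult_ac)
    also have "\<dots> \<le> 1/2 * ?q" by (rule mult_right_mono[OF r2]) simp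
    finally have "\<bar>(pd l (H i (Suc (Suc m))) x - pd l (H i (Suc m)) x)
       - (pd l (H i (Suc (Suc m))) 0 - pd l (H i (Suc m)) 0)\<bar> \<le> 1/2 * ?q" .
    moreover have "pd l (h k) 0 = axis l 1" for k using Ph[of k] by (simp add: P_def)
    ultimately show ?case unfolding pdH[OF Suc.prems] pdH[OF zero] by simp
  qed
  have half: "(1/2::real)^m \<le> (3/4)^m" for m by (rule power_mono) simp_all
  have geo0H: "geo0 ?S (H i)" for i
    unfolding geo0_def
  proof (intro exI[of _ "2 * ?N"] allI ballI conjI)
    fix m x assume x: "x \<in> ?S"
    have nx: "norm x \<le> 1" using x r by simp
    have "\<bar>h m x $ i\<bar> \<le> norm (h m x)" by (rule component_le_norm_cart)
    then show "\<bar>H i m x\<bar> \<le> 2 * ?N" using Pnorm[OF Ph x, of m] nx N unfolding H_def by linarith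
    have "\<bar>h (Suc m) x $ i - h m x $ i\<bar> \<le> ?N * (1/2)^m * norm x" by (rule dlip[OF conv x])
    also have "\<dots> \<le> ?N * (1/2)^m * 1" by (rule mult_left_mono[OF nx]) simp
    also have "\<dots> \<le> 2 * ?N * (3/4)^m" using mult_mono[OF _ half[of m], of ?N "2 * ?N"] N by simp
    finally show "\<bar>H i (Suc m) x - H i m x\<bar> \<le> 2 * ?N * (3/4)^m" by (simp add: H_def)
  qed
  have geo0D: "geo0 ?S (\<lambda>m. pd l (H i m))" for l i
    unfolding geo0_def
  proof (intro exI[of _ 2] allI ballI conjI)
    fix m x assume x: "x \<in> ?S"
    show "\<bar>pd l (H i m) x\<bar> \<le> 2" unfolding pdH[OF x] by (rule Pd[OF Ph x])
    show "\<bar>pd l (H i (Suc m)) x - pd l (H i m) x\<bar> \<le> 2 * (3/4)^m"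
      unfolding pdH[OF x] using conv[OF x, of l m i] half[of m] by (smt (verit) zero_le_power)
  qed
  have geoC: "geo k ?S (\<lambda>m x. \<psi> (h m x))" if "smooth_on (ball 0 1) \<psi>" "\<And>i. geo k ?S (H i)"
    for k and \<psi> :: "real^'n \<Rightarrow> real"
    by (rule geo_compose[OF open_ball open_ball compact_cball convex_cball KT PK[OF Ph] Psm(1)[OF Ph] that(1)])
       (assumption, rule that(2)[unfolded H_def])
  \<comment> \<open>Orders 0 and 1 come from the direct estimates. In the induction step the
    coefficients and the source of the second-derivative equation involve h and its first
    derivatives only, and these are known at order k.\<close>
  have geoS: "geo (Suc k) ?S (H i)" for k i
  proof (induction k arbitrary: i)
    case 0
    then show ?case using geo0H geo0D by simp
  next
    case (Suc k)
    have gD: "geo k ?S (\<lambda>m. pd l (H i m))" for l i using Suc.IH[of i] by simp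
    have gC: "geo k ?S (\<lambda>m x. \<psi> (h m x))" if "smooth_on (ball 0 1) \<psi>" for \<psi> :: "real^'n \<Rightarrow> real"
      by (rule geoC[OF that geo_SucD[OF Suc.IH]])
    note sm = smooth_on_sum[OF open_ball] smooth_on_mult[OF open_ball] smooth_on_pd[OF smH] comp[OF Ph smooth_on_pd[OF smooth_on_pd[OF Z]]]
    have "geo k ?S (\<lambda>m. pd k' (pd l (H i m)))" for k' l i
    proof (rule geo_linear[where q = 0 and W = "\<lambda>m i. pd k' (pd l (H i m))" and A = "\<lambda>m i j x. pd j (Z i) (h m x)"
        and G = "\<lambda>m i x. \<Sum>j\<in>UNIV. pd l (H j m) x * (\<Sum>j'\<in>UNIV. pd k' (H j' m) x * pd j' (pd j (Z i)) (h m x))"])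
      show "smooth_on ?S (pd k' (pd l (H i m)))" for m i by (intro smooth_on_pd smH)
      show "smooth_on ?S (\<lambda>x. pd j (Z i) (h m x))" for m i j by (rule comp[OF Ph smooth_on_pd[OF Z]])
      show "smooth_on ?S (\<lambda>x. \<Sum>j\<in>UNIV. pd l (H j m) x * (\<Sum>j'\<in>UNIV. pd k' (H j' m) x * pd j' (pd j (Z i)) (h m x)))" for m i
        by (intro sm)
      show "\<bar>pd j (Z i) (h m x)\<bar> \<le> 1 / (2 * real CARD('n))" if "x \<in> ?S" for m i j x
      proof -
        have "norm (h m x) \<le> 2 * r" using Pnorm[OF Ph that, of m] that by simp
        then have "C * norm (h m x) \<le> C * (2 * r)" by (rule mult_left_mono) (use C in simp)
        with small[OF PK[OF Ph that], of j i m] r3 show ?thesis by linarith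
      qed
      \<comment> \<open>The iteration starts at the identity, so the second derivatives start at
        0.\<close>
      show "pd k' (pd l (H i 0)) x = 0" if "x \<in> ?S" for i x
      proof -
        have "pd l (H i 0) = (\<lambda>x. if i = l then 1 else 0)"
          unfolding H_def h0 by (rule ext) (rule pd_coord)
        then show ?thesis by simp
      qed
      show "geo k ?S (\<lambda>m x. pd j (Z i) (h m x))" for i j by (rule gC[OF smooth_on_pd[OF Z]])
      show "geo k ?S (\<lambda>m x. \<Sum>j\<in>UNIV. pd l (H j m) x * (\<Sum>j'\<in>UNIV. pd k' (H j' m) x * pd j' (pd j (Z i)) (h m x)))" for i
      proof (rule geo_sum[OF open_ball finite])
        fix j
        have s1: "smooth_on ?S (\<lambda>x. \<Sum>j'\<in>UNIV. pd k' (H j' m) x * pd j' (pd j (Z i)) (h m x))" for m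
          by (intro sm)
        show "smooth_on ?S (\<lambda>x. pd l (H j m) x * (\<Sum>j'\<in>UNIV. pd k' (H j' m) x * pd j' (pd j (Z i)) (h m x)))" for m
          by (intro sm)
        have "geo k ?S (\<lambda>m x. \<Sum>j'\<in>UNIV. pd k' (H j' m) x * pd j' (pd j (Z i)) (h m x))"
        proof (rule geo_sum[OF open_ball finite])
          show "smooth_on ?S (\<lambda>x. pd k' (H j' m) x * pd j' (pd j (Z i)) (h m x))" for m j'
            by (intro sm)
          show "geo k ?S (\<lambda>m x. pd k' (H j' m) x * pd j' (pd j (Z i)) (h m x))" for j'
            by (rule geo_mult[OF open_ball smooth_on_pd[OF smH] comp[OF Ph smooth_on_pd[OF smooth_on_pd[OF Z]]] gD
                  gC[OF smooth_on_pd[OF smooth_on_pd[OF Z]]]])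
        qed
        then show "geo k ?S (\<lambda>m x. pd l (H j m) x * (\<Sum>j'\<in>UNIV. pd k' (H j' m) x * pd j' (pd j (Z i)) (h m x)))"
          by (rule geo_mult[OF open_ball smooth_on_pd[OF smH] s1 gD])
      qed
      fix m i x assume x: "x \<in> ?S"
      \<comment> \<open>The second differentiation raises the constant from 0 to 1, the case q = 0
        of \<open>geo_linear\<close>.\<close>
      have "euler (pd k' (pd l (H i (Suc m)))) x + (0 + 1) * pd k' (pd l (H i (Suc m))) x
        = pd k' (\<lambda>x. \<Sum>j\<in>UNIV. pd l (H j m) x * pd j (Z i) (h m x)) x"
        by (rule euler_pd[OF open_ball smooth_on_pd[OF smH] x]) (simp add: DeqH)
      also have "\<dots> = (\<Sum>j\<in>UNIV. pd k' (\<lambda>x. pd l (H j m) x * pd j (Z i) (h m x)) x)"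
        by (intro pd_sum smooth_on_differentiable[OF _ x] smooth_on_mult[OF open_ball smooth_on_pd[OF smH] comp[OF Ph smooth_on_pd[OF Z]]])
      also have "\<dots> = (\<Sum>j\<in>UNIV. pd l (H j m) x * pd k' (\<lambda>x. pd j (Z i) (h m x)) x
           + pd k' (pd l (H j m)) x * pd j (Z i) (h m x))"
        by (intro sum.cong refl pd_mult smooth_on_differentiable[OF _ x] smooth_on_pd[OF smH] comp[OF Ph smooth_on_pd[OF Z]])
      also have "\<dots> = (\<Sum>j\<in>UNIV. pd j (Z i) (h m x) * pd k' (pd l (H j m)) x) +
          (\<Sum>j\<in>UNIV. pd l (H j m) x * (\<Sum>j'\<in>UNIV. pd k' (H j' m) x * pd j' (pd j (Z i)) (h m x)))"
        by (simp add: sum.distrib pdZ[OF Ph x smooth_on_pd[OF Z]] pdH[OF x] mult.commute[of "pd _ (pd _ _) _"])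
      finally show "euler (pd k' (pd l (H i (Suc m)))) x + real (Suc 0) * pd k' (pd l (H i (Suc m))) x =
         (\<Sum>j\<in>UNIV. pd j (Z i) (h m x) * pd k' (pd l (H j m)) x) +
          (\<Sum>j\<in>UNIV. pd l (H j m) x * (\<Sum>j'\<in>UNIV. pd k' (H j' m) x * pd j' (pd j (Z i)) (h m x)))"
        by simp
    qed
    then show ?case using geo0H geo0D by simp
  qed
  have geoH: "geo k ?S (H i)" for k i by (rule geo_SucD[OF geoS])
  define g where "g x = (\<chi> i. lim (\<lambda>m. H i m x))" for x
  have smg: "smooth_on ?S g"
    unfolding smooth_on_component_iff[OF open_ball] g_def by (simp add: smooth_on_geo_limit[OF smH geoH])
  have gi: "(\<lambda>m. h m x $ i) \<longlonglongrightarrow> g x $ i" if "x \<in> ?S" for x i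
    using geo0_tendsto[OF geo0H that] by (simp add: g_def H_def)
  then have gv: "(\<lambda>m. h m x) \<longlonglongrightarrow> g x" if "x \<in> ?S" for x
    using that by (simp add: vec_tendstoI)
  have pdg: "(\<lambda>m. pd l (h m) x $ i) \<longlonglongrightarrow> pd l g x $ i" if x: "x \<in> ?S" for x l i
  proof -
    have "pd l g x $ i = pd l (\<lambda>x. lim (\<lambda>m. H i m x)) x"
      using pd_component[OF smooth_on_differentiable[OF smg x], of l i] by (simp add: g_def)
    also have "\<dots> = lim (\<lambda>m. pd l (H i m) x)" by (rule pd_geo_limit[OF smH geoS x])
    finally show ?thesis
      using geo0_tendsto[OF geo0D x, of l i] by (simp add: pdH[OF x])
  qed
  show thesis
  proof (rule that[OF r smg])
    have "h m 0 = 0" for m using Ph[of m] by (simp add: P_def)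
    then show "g 0 = 0" using gv[OF zero] by (simp add: LIMSEQ_const_iff)
    have "pd l (h m) 0 = axis l 1" for m l using Ph[of m] by (simp add: P_def)
    then show "pd l g 0 = axis l 1" for l
      using pdg[OF zero, of l] by (simp add: LIMSEQ_const_iff vec_eq_iff)
    fix x assume x: "x \<in> ?S"
    show "norm (g x) \<le> 2 * norm x"
      by (rule LIMSEQ_le_const2[OF tendsto_norm[OF gv[OF x]]]) (use Pnorm[OF Ph x] in blast)
    show "\<bar>pd l g x $ i - axis l 1 $ i\<bar> \<le> 1 / (2 * (real CARD('n))\<^sup>2)" for l i
    proof (rule LIMSEQ_le_const2[OF tendsto_rabs[OF tendsto_diff[OF pdg[OF x] tendsto_const]]])
      show "\<exists>N. \<forall>n\<ge>N. \<bar>pd l (h n) x $ i - axis l 1 $ i\<bar> \<le> 1 / (2 * (real CARD('n))\<^sup>2)"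
        using Ph x unfolding P_def \<epsilon>_def by blast
    qed
    \<comment> \<open>Closedness of the smaller ball keeps the limit at a point where X is
      continuous.\<close>
    have "g x \<in> ?K"
      using closed_sequentially[OF closed_cball _ gv[OF x]] PK[OF Ph x] by blast
    then have "isCont X (g x)" using smooth_on_isCont[OF assms(1)] KT by blast
    then have "(\<lambda>m. h (Suc m) x + X (h m x)) \<longlonglongrightarrow> g x + X (g x)"
      by (intro tendsto_add LIMSEQ_Suc gv[OF x] isCont_tendsto_compose[OF _ gv[OF x]])
    moreover have "(\<lambda>m. euler (h (Suc m)) x) \<longlonglongrightarrow> euler g x"
      unfolding euler_def by (intro tendsto_sum tendsto_scaleR tendsto_const LIMSEQ_Suc vec_tendstoI pdg[OF x])
    ultimately show "euler g x = g x + X (g x)"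
      using bspec[OF heq x] LIMSEQ_unique by auto
  qed
qed

section \<open>The Courant bracket on 1-jets\<close>

lemma anchor_nth [simp]: "anchor u $ i = u $ Inl i"
  by (simp add: anchor_def)

lemma formpart_nth [simp]: "formpart u $ i = u $ Inr i"
  by (simp add: formpart_def)

lemma mk_gen_nth [simp]: "mk_gen X \<xi> $ Inl i = X $ i" "mk_gen X \<xi> $ Inr i = \<xi> $ i"
  by (simp_all add: mk_gen_def)

lemma anchor_mk_gen [simp]: "anchor (mk_gen X \<xi>) = X" and formpart_mk_gen [simp]: "formpart (mk_gen X \<xi>) = \<xi>"
  by (simp_all add: vec_eq_iff)

lemma gen_eqI:
  assumes "anchor u = anchor v" "formpart u = formpart v"
  shows "u = v"
proof -
  have "u $ i = v $ i" for i
    using assms by (cases i) (auto simp: vec_eq_iff)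
  then show ?thesis by (simp add: vec_eq_iff)
qed

lemma linear_anchor: "linear (anchor :: real^('n::finite + 'n) \<Rightarrow> real^'n)"
  and linear_formpart: "linear (formpart :: real^('n::finite + 'n) \<Rightarrow> real^'n)"
  by (auto intro!: linearI simp: vec_eq_iff)

lemmas bounded_linear_anchor = linear_anchor[unfolded linear_conv_bounded_linear]
lemmas bounded_linear_formpart = linear_formpart[unfolded linear_conv_bounded_linear]

lemma pairing_sum: "pairing u v = (1/2) * (\<Sum>l\<in>UNIV. u $ Inr l * v $ Inl l + v $ Inr l * u $ Inl l)"
  by (simp add: pairing_def contract_def sum.distrib)

lemma pairing_real: "pairing u v = (1/2) * (formpart u \<bullet> anchor v + formpart v \<bullet> anchor u)"
  for u v :: "real^('n::finite + 'n)"
  by (simp add: pairing_def contract_def inner_vec_def)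

lemma pairing_commute: "pairing u v = pairing v u"
  by (simp add: pairing_def add.commute)

lemma pairing_add: "pairing (u + v) w = pairing u w + pairing v w" "pairing w (u + v) = pairing w u + pairing w v"
  by (simp_all add: pairing_sum sum.distrib[symmetric] distrib_left[symmetric] algebra_simps)

lemma pairing_scale: "pairing (c *s u) w = c * pairing u w" "pairing w (c *s u) = c * pairing w u"
  by (simp_all add: pairing_sum sum_distrib_left algebra_simps)

lemma pairing_minus: "pairing (- u) w = - pairing u w" "pairing w (- u) = - pairing w u"
  using pairing_scale(1)[of "- 1" u w] pairing_scale(2)[of w "- 1" u] by simp_all

lemma pairing_diff: "pairing (u - v) w = pairing u w - pairing v w" "pairing w (u - v) = pairing w u - pairing w v"
  using pairing_add(1)[of u "- v" w] pairing_add(2)[of w u "- v"] by (simp_all add: pairing_minus)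

lemma pairing_zero [simp]: "pairing 0 w = 0" "pairing w 0 = 0"
  by (simp_all add: pairing_sum)

lemma pairing_sum_left: "pairing (\<Sum>i\<in>I. f i) w = (\<Sum>i\<in>I. pairing (f i) w)"
  by (induction I rule: infinite_finite_induct) (simp_all add: pairing_add)

lemma pairing_sum_right: "pairing w (\<Sum>i\<in>I. f i) = (\<Sum>i\<in>I. pairing w (f i))"
  by (induction I rule: infinite_finite_induct) (simp_all add: pairing_add)

lemma pairing_axis: "pairing u (axis (Inl i) 1) = (1/2) * u $ Inr i" "pairing u (axis (Inr i) 1) = (1/2) * u $ Inl i"
proof -
  have 1: "(\<Sum>l\<in>UNIV. u $ Inr l * axis (Inl i) 1 $ Inl l + axis (Inl i) 1 $ Inr l * u $ Inl l)
    = (\<Sum>l\<in>UNIV. if l = i then u $ Inr l else 0)"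
    by (intro sum.cong) (auto simp: axis_def)
  have 2: "(\<Sum>l\<in>UNIV. u $ Inr l * axis (Inr i) 1 $ Inl l + axis (Inr i) 1 $ Inr l * u $ Inl l)
    = (\<Sum>l\<in>UNIV. if l = i then u $ Inl l else 0)"
    by (intro sum.cong) (auto simp: axis_def)
  show "pairing u (axis (Inl i) 1) = (1/2) * u $ Inr i" "pairing u (axis (Inr i) 1) = (1/2) * u $ Inl i"
    unfolding pairing_sum 1 2 by simp_all
qed

lemma pairing_nondegenerate:
  fixes u :: "'a::real_normed_field ^ ('n::finite + 'n)"
  assumes "\<And>v. pairing u v = 0"
  shows "u = 0"
proof -
  have "u $ a = 0" for a
    using assms[of "axis (Inl (projr a)) 1"] assms[of "axis (Inr (projl a)) 1"]
    by (cases a) (simp_all add: pairing_axis)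
  then show ?thesis by (simp add: vec_eq_iff)
qed

text \<open>The value of the bracket at a point depends on the 1-jets of the two sections only.\<close>

definition dir_sum :: "'a::real_normed_field ^ ('n::finite + 'n) \<Rightarrow> ('n \<Rightarrow> 'a ^ 'k) \<Rightarrow> 'a ^ 'k" where
  "dir_sum s dr = (\<Sum>l\<in>UNIV. s $ Inl l *s dr l)"

definition jet_bracket :: "'a::real_normed_field ^ ('n::finite + 'n) \<Rightarrow> ('n \<Rightarrow> 'a ^ ('n + 'n)) \<Rightarrow>
    'a ^ ('n + 'n) \<Rightarrow> ('n \<Rightarrow> 'a ^ ('n + 'n)) \<Rightarrow> 'a ^ ('n + 'n)" where
  "jet_bracket s ds r dr = dir_sum s dr - dir_sum r ds
     + mk_gen 0 (\<chi> i. pairing (ds i) r - pairing s (dr i))"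

text \<open>The terms of the two Lie derivatives that differentiate a vector field combine with half
  of the exact term into the 1-form with components <d_i s, r> - <s, d_i r>. The result is bilinear
  in the 1-jets, which reduces the later bracket computations to algebra.\<close>

lemma courant_bracket_jet:
  fixes s r :: "real^'n::finite \<Rightarrow> 'a::real_normed_field ^ ('n + 'n)"
  assumes "s differentiable (at x)" "r differentiable (at x)"
  shows "courant_bracket s r x = jet_bracket (s x) (\<lambda>l. pd l s x) (r x) (\<lambda>l. pd l r x)"
proof (rule gen_eqI)
  have ds: "(\<lambda>y. s y $ a) differentiable (at x)" and dr: "(\<lambda>y. r y $ a) differentiable (at x)" for a
    using assms differentiable_component_iff by blast+
  note pds = pd_component[OF assms(1)] and pdr = pd_component[OF assms(2)]
  show "anchor (courant_bracket s r x) = anchor (jet_bracket (s x) (\<lambda>l. pd l s x) (r x) (\<lambda>l. pd l r x))"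
    by (simp add: vec_eq_iff courant_bracket_def Let_def lie_bracket_def vf_apply_def pds pdr
        jet_bracket_def dir_sum_def)
  have dd: "(\<lambda>y. s y $ Inr l * r y $ Inl l) differentiable (at x)" "(\<lambda>y. r y $ Inr l * s y $ Inl l) differentiable (at x)" for l
    by (intro differentiable_mult ds dr)+
  have D: "pd i (\<lambda>y. contract (formpart (s y)) (anchor (r y)) - contract (formpart (r y)) (anchor (s y))) x
    = (\<Sum>l\<in>UNIV. s x $ Inr l * pd i r x $ Inl l + pd i s x $ Inr l * r x $ Inl l)
      - (\<Sum>l\<in>UNIV. r x $ Inr l * pd i s x $ Inl l + pd i r x $ Inr l * s x $ Inl l)" for i
  proof -
    have "pd i (\<lambda>y. contract (formpart (s y)) (anchor (r y)) - contract (formpart (r y)) (anchor (s y))) x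
      = pd i (\<lambda>y. \<Sum>l\<in>UNIV. s y $ Inr l * r y $ Inl l) x - pd i (\<lambda>y. \<Sum>l\<in>UNIV. r y $ Inr l * s y $ Inl l) x"
      unfolding contract_def anchor_nth formpart_nth by (rule pd_diff) (intro differentiable_sum finite ballI dd)+
    then show ?thesis
      by (simp add: pd_sum dd pd_mult[OF ds dr] pd_mult[OF dr ds] pds pdr)
  qed
  have "courant_bracket s r x $ Inr i = jet_bracket (s x) (\<lambda>l. pd l s x) (r x) (\<lambda>l. pd l r x) $ Inr i" for i
  proof -
    have "courant_bracket s r x $ Inr i =
       (\<Sum>l\<in>UNIV. s x $ Inl l * pd l r x $ Inr i) + (\<Sum>l\<in>UNIV. r x $ Inr l * pd i s x $ Inl l)
       - ((\<Sum>l\<in>UNIV. r x $ Inl l * pd l s x $ Inr i) + (\<Sum>l\<in>UNIV. s x $ Inr l * pd i r x $ Inl l))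
       + 1/2 * ((\<Sum>l\<in>UNIV. s x $ Inr l * pd i r x $ Inl l + pd i s x $ Inr l * r x $ Inl l)
      - (\<Sum>l\<in>UNIV. r x $ Inr l * pd i s x $ Inl l + pd i r x $ Inr l * s x $ Inl l))"
      using D[of i]
      by (simp add: courant_bracket_def Let_def lie_deriv_def vf_apply_def pds pdr differential_def)
    also have "\<dots> = (\<Sum>l\<in>UNIV. s x $ Inl l * pd l r x $ Inr i) - (\<Sum>l\<in>UNIV. r x $ Inl l * pd l s x $ Inr i)
      + (pairing (pd i s x) (r x) - pairing (s x) (pd i r x))"
      by (simp add: pairing_sum sum.distrib algebra_simps)
    finally show ?thesis by (simp add: jet_bracket_def dir_sum_def)
  qed
  then show "formpart (courant_bracket s r x) = formpart (jet_bracket (s x) (\<lambda>l. pd l s x) (r x) (\<lambda>l. pd l r x))"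
    by (simp add: vec_eq_iff)
qed

lemma bounded_linear_matrix_mult: "bounded_linear (\<lambda>v. (A::real^'n^'m) *v v)"
  by (rule matrix_vector_mul_bounded_linear)

lemma matrix_dir_sum: "A *v dir_sum s dr = dir_sum s (\<lambda>l. A *v dr l)"
  for A :: "'a::real_normed_field^'k::finite^'m::finite"
  unfolding dir_sum_def
  by (simp add: vec_eq_iff matrix_vector_mult_def sum_distrib_left sum.swap[of _ "UNIV::'k set"] mult.left_commute)

lemma matrix_vector_mult_uminus: "(- A) *v u = - (A *v u)"
  for A :: "'a::ring_1^'k::finite^'m::finite"
  by (simp add: vec_eq_iff matrix_vector_mult_def sum_negf)

text \<open>Since J^-1 = -J, being orthogonal and being skew for the pairing amount to the
  same.\<close>

lemma skew_of_orthogonal: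
  assumes "J ** J = - mat 1" "\<And>u v. pairing (J *v u) (J *v v) = pairing u v"
  shows "pairing (J *v u) v = - pairing u (J *v v)"
proof -
  have "pairing (J *v (J *v u)) (J *v v) = pairing (J *v u) v" by (rule assms(2))
  moreover have "J *v (J *v u) = - u" using assms(1) by (simp add: matrix_vector_mul_assoc matrix_vector_mult_uminus)
  ultimately show ?thesis by (simp add: pairing_minus)
qed

text \<open>A constant J commutes with partial derivatives. The directional terms then cancel by J^2
  = -1, and the 1-form terms cancel by orthogonality outside J and by skewness inside J.\<close>

lemma gc_structure_constant:
  fixes J :: "real^('n::finite + 'n)^('n + 'n)"
  assumes "J ** J = - mat 1" "\<And>u v. pairing (J *v u) (J *v v) = pairing u v" "open V"
  shows "gc_structure_on V (\<lambda>x. J)"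
  unfolding gc_structure_on_def
proof (intro conjI allI ballI impI)
  show "smooth_on V (\<lambda>x. J $ i $ j)" for i j by (rule smooth_on_const)
  show "J ** J = - mat 1" by fact
  show "pairing (J *v u) (J *v v) = pairing u v" for u v by fact
  fix s r :: "real^'n \<Rightarrow> real^('n + 'n)" and x
  assume s: "smooth_on V s" and r: "smooth_on V r" and x: "x \<in> V"
  note d = smooth_on_differentiable[OF s x] smooth_on_differentiable[OF r x]
  note dJ = differentiable_linear[OF bounded_linear_matrix_mult d(1)] differentiable_linear[OF bounded_linear_matrix_mult d(2)]
  note pJ = pd_linear[OF bounded_linear_matrix_mult d(1)] pd_linear[OF bounded_linear_matrix_mult d(2)]
  have JJ: "J *v (J *v u) = - u" for u using assms(1) by (simp add: matrix_vector_mul_assoc matrix_vector_mult_uminus)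
  have skew: "pairing (J *v u) v = - pairing u (J *v v)" for u v by (rule skew_of_orthogonal[OF assms(1,2)])
  let ?ds = "\<lambda>l. pd l s x" and ?dr = "\<lambda>l. pd l r x"
  have neg: "dir_sum u (\<lambda>l. - w l) = - dir_sum u w" for u :: "real^('n + 'n)" and w :: "'n \<Rightarrow> real^('n + 'n)"
    by (simp add: dir_sum_def sum_negf)
  have "(mk_gen 0 (\<chi> i. pairing (J *v ?ds i) (r x) - pairing (J *v s x) (?dr i)) :: real^('n+'n))
      = - mk_gen 0 (\<chi> i. pairing (?ds i) (J *v r x) - pairing (s x) (J *v ?dr i))"
    by (rule gen_eqI) (simp_all add: vec_eq_iff skew)
  then show "courant_bracket (\<lambda>y. J *v s y) (\<lambda>y. J *v r y) x - courant_bracket s r x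
          - J *v (courant_bracket (\<lambda>y. J *v s y) r x + courant_bracket s (\<lambda>y. J *v r y) x) = 0"
    unfolding courant_bracket_jet[OF dJ] courant_bracket_jet[OF d] courant_bracket_jet[OF dJ(1) d(2)]
      courant_bracket_jet[OF d(1) dJ(2)] jet_bracket_def pJ
    by (simp add: matrix_vector_right_distrib matrix_vector_mult_diff_distrib matrix_dir_sum JJ neg assms(2))
qed

text \<open>The B-field transformation exp(B), with the 2-form written as a matrix from vectors to
  covectors.\<close>

definition gen_shift :: "real^'n::finite^'n \<Rightarrow> real^('n + 'n) \<Rightarrow> real^('n + 'n)" where
  "gen_shift B u = mk_gen (anchor u) (formpart u + B *v anchor u)"

lemma gen_shift_simps [simp]: "anchor (gen_shift B u) = anchor u" "formpart (gen_shift B u) = formpart u + B *v anchor u"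
  by (simp_all add: gen_shift_def)

lemma anchor_linear_simps [simp]:
  fixes u v :: "real^('n::finite + 'n)"
  shows "anchor (u + v) = anchor u + anchor v" "anchor (u - v) = anchor u - anchor v"
    "anchor (sum f I) = (\<Sum>i\<in>I. anchor (f i :: real^('n + 'n)))" "anchor (c *\<^sub>R u) = c *\<^sub>R anchor u"
    "formpart (u + v) = formpart u + formpart v" "formpart (u - v) = formpart u - formpart v"
    "formpart (sum f I) = (\<Sum>i\<in>I. formpart (f i :: real^('n + 'n)))" "formpart (c *\<^sub>R u) = c *\<^sub>R formpart u"
    "anchor 0 = (0::real^'n)" "formpart 0 = (0::real^'n)"
  by (simp_all add: vec_eq_iff)

lemma anchor_jet_bracket:
  fixes s r :: "real^('n::finite + 'n)"
  shows "anchor (jet_bracket s ds r dr)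
    = (\<Sum>l\<in>UNIV. anchor s $ l *\<^sub>R anchor (dr l)) - (\<Sum>l\<in>UNIV. anchor r $ l *\<^sub>R anchor (ds l))"
  by (simp add: jet_bracket_def dir_sum_def scalar_mult_eq_scaleR)

lemma formpart_jet_bracket:
  fixes s r :: "real^('n::finite + 'n)"
  shows "formpart (jet_bracket s ds r dr)
    = (\<Sum>l\<in>UNIV. anchor s $ l *\<^sub>R formpart (dr l)) - (\<Sum>l\<in>UNIV. anchor r $ l *\<^sub>R formpart (ds l))
      + (\<chi> k. pairing (ds k) r - pairing s (dr k))"
  by (simp add: jet_bracket_def dir_sum_def scalar_mult_eq_scaleR)

lemma pd_matrix_vector:
  fixes B :: "real^'n::finite \<Rightarrow> real^'k::finite^'m::finite" and X :: "real^'n \<Rightarrow> real^'k"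
  assumes "\<And>i j. (\<lambda>y. B y $ i $ j) differentiable (at x)" "X differentiable (at x)"
  shows "pd l (\<lambda>y. B y *v X y) x = (\<chi> i j. pd l (\<lambda>y. B y $ i $ j) x) *v X x + B x *v pd l X x"
    and "(\<lambda>y. B y *v X y) differentiable (at x)"
proof -
  have X: "(\<lambda>y. X y $ j) differentiable (at x)" for j using assms(2) differentiable_component_iff by blast
  have c: "(\<lambda>y. \<Sum>j\<in>UNIV. B y $ i $ j * X y $ j) differentiable (at x)" for i
    by (intro differentiable_sum finite ballI differentiable_mult assms(1) X)
  show d: "(\<lambda>y. B y *v X y) differentiable (at x)"
    unfolding differentiable_component_iff by (simp add: matrix_vector_mult_def c)
  have "pd l (\<lambda>y. B y *v X y) x $ i = (\<Sum>j\<in>UNIV. pd l (\<lambda>y. B y $ i $ j) x * X x $ j + B x $ i $ j * pd l X x $ j)" for i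
  proof -
    have "pd l (\<lambda>y. B y *v X y) x $ i = pd l (\<lambda>y. \<Sum>j\<in>UNIV. B y $ i $ j * X y $ j) x"
      using pd_component[OF d, of l i] by (simp add: matrix_vector_mult_def)
    also have "\<dots> = (\<Sum>j\<in>UNIV. pd l (\<lambda>y. B y $ i $ j * X y $ j) x)"
      by (intro pd_sum differentiable_mult assms(1) X)
    finally show ?thesis
      by (simp add: pd_mult[OF assms(1) X] pd_component[OF assms(2)] add.commute)
  qed
  then show "pd l (\<lambda>y. B y *v X y) x = (\<chi> i j. pd l (\<lambda>y. B y $ i $ j) x) *v X x + B x *v pd l X x"
    by (simp add: vec_eq_iff matrix_vector_mult_def sum.distrib)
qed

lemma skew_inner:
  fixes B :: "real^'n::finite^'n"
  assumes "transpose B = - B"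
  shows "(B *v u) \<bullet> v = - ((B *v v) \<bullet> u)"
proof -
  have "(B *v u) \<bullet> v = u \<bullet> (transpose B *v v)"
    by (metis dot_lmul_matrix inner_commute transpose_matrix_vector transpose_transpose)
  then show ?thesis unfolding assms by (simp add: inner_commute matrix_vector_mult_uminus)
qed

text \<open>For constant skew B the shift commutes with the bracket algebraically; the derivatives
  of B contribute only the contraction of the 3-form dB with the two vector fields, which the cyclic
  identity annihilates.\<close>

lemma courant_bracket_shift:
  fixes s r :: "real^'n::finite \<Rightarrow> real^('n + 'n)" and B :: "real^'n \<Rightarrow> real^'n^'n"
  assumes "s differentiable (at x)" "r differentiable (at x)" "\<And>i j. (\<lambda>y. B y $ i $ j) differentiable (at x)"
    and skew: "\<And>y. transpose (B y) = - B y"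
    and closed: "\<And>i j k. pd i (\<lambda>y. B y $ j $ k) x + pd j (\<lambda>y. B y $ k $ i) x + pd k (\<lambda>y. B y $ i $ j) x = 0"
  shows "courant_bracket (\<lambda>y. gen_shift (B y) (s y)) (\<lambda>y. gen_shift (B y) (r y)) x
    = gen_shift (B x) (courant_bracket s r x)"
proof -
  define dB where "dB l = (\<chi> i j. pd l (\<lambda>y. B y $ i $ j) x)" for l
  have Bskew: "B y $ i $ j = - B y $ j $ i" for y i j
    using arg_cong[OF skew[of y], of "\<lambda>M. M $ j $ i"] by (simp add: transpose_def)
  have pskew: "pd l (\<lambda>y. B y $ i $ j) x = - pd l (\<lambda>y. B y $ j $ i) x" for l i j
    using pd_minus[OF assms(3)[of j i], of l] Bskew[of _ i j] by simp
  have dBskew: "transpose (dB l) = - dB l" for l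
    by (simp add: dB_def transpose_def vec_eq_iff) (subst pskew, simp)
  have sh: "(\<lambda>y. gen_shift (B y) (u y)) differentiable (at x)"
    "anchor (pd l (\<lambda>y. gen_shift (B y) (u y)) x) = anchor (pd l u x)"
    "formpart (pd l (\<lambda>y. gen_shift (B y) (u y)) x)
      = formpart (pd l u x) + (dB l *v anchor (u x) + B x *v anchor (pd l u x))"
    if u: "u differentiable (at x)" for u l
  proof -
    have a: "(\<lambda>y. anchor (u y)) differentiable (at x)" by (rule differentiable_linear[OF bounded_linear_anchor u])
    have f: "(\<lambda>y. formpart (u y)) differentiable (at x)" by (rule differentiable_linear[OF bounded_linear_formpart u])
    note BX = pd_matrix_vector[OF assms(3) a]
    have fb: "(\<lambda>y. formpart (u y) + B y *v anchor (u y)) differentiable (at x)"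
      by (rule differentiable_add[OF f BX(2)])
    show d: "(\<lambda>y. gen_shift (B y) (u y)) differentiable (at x)"
      unfolding differentiable_component_iff
    proof
      fix i show "(\<lambda>y. gen_shift (B y) (u y) $ i) differentiable (at x)"
        using a fb by (cases i) (simp_all add: gen_shift_def differentiable_component_iff)
    qed
    show "anchor (pd l (\<lambda>y. gen_shift (B y) (u y)) x) = anchor (pd l u x)"
      using pd_linear[OF bounded_linear_anchor d, of l] pd_linear[OF bounded_linear_anchor u, of l] by simp
    show "formpart (pd l (\<lambda>y. gen_shift (B y) (u y)) x)
      = formpart (pd l u x) + (dB l *v anchor (u x) + B x *v anchor (pd l u x))"
      using pd_linear[OF bounded_linear_formpart d, of l] pd_linear[OF bounded_linear_formpart u, of l]
        pd_linear[OF bounded_linear_anchor u, of l]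
      by (simp add: pd_add[OF f BX(2)] BX(1) dB_def)
  qed
  let ?X = "anchor (s x)" and ?Y = "anchor (r x)"
  \<comment> \<open>The k-th component of dB contracted with X and Y, written in the three pieces
    that the bracket produces.\<close>
  have dBclosed: "(\<Sum>l\<in>UNIV. ?X $ l *\<^sub>R (dB l *v ?Y)) $ k - (\<Sum>l\<in>UNIV. ?Y $ l *\<^sub>R (dB l *v ?X)) $ k
     + (dB k *v ?X) \<bullet> ?Y = 0" for k
  proof -
    have "(\<Sum>l\<in>UNIV. ?X $ l *\<^sub>R (dB l *v ?Y)) $ k = (\<Sum>l\<in>UNIV. \<Sum>m\<in>UNIV. ?X $ l * ?Y $ m * dB l $ k $ m)"
      by (simp add: matrix_vector_mult_def sum_distrib_left mult_ac)
    moreover have "(\<Sum>l\<in>UNIV. ?Y $ l *\<^sub>R (dB l *v ?X)) $ k = (\<Sum>l\<in>UNIV. \<Sum>m\<in>UNIV. ?X $ l * ?Y $ m * dB m $ k $ l)"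
      by (subst sum.swap) (simp add: matrix_vector_mult_def sum_distrib_left mult_ac)
    moreover have "(dB k *v ?X) \<bullet> ?Y = (\<Sum>l\<in>UNIV. \<Sum>m\<in>UNIV. ?X $ l * ?Y $ m * dB k $ m $ l)"
      by (subst sum.swap) (simp add: matrix_vector_mult_def inner_vec_def sum_distrib_left sum_distrib_right mult_ac)
    ultimately have "(\<Sum>l\<in>UNIV. ?X $ l *\<^sub>R (dB l *v ?Y)) $ k - (\<Sum>l\<in>UNIV. ?Y $ l *\<^sub>R (dB l *v ?X)) $ k
     + (dB k *v ?X) \<bullet> ?Y = (\<Sum>l\<in>UNIV. \<Sum>m\<in>UNIV. ?X $ l * ?Y $ m * (dB l $ k $ m - dB m $ k $ l + dB k $ m $ l))"
      by (simp add: sum.distrib sum_subtractf algebra_simps)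
    also have "\<dots> = 0"
    proof -
      have "dB l $ k $ m - dB m $ k $ l + dB k $ m $ l = 0" for l m
        using closed[of l k m] pskew[of m k l] by (simp add: dB_def)
      then show ?thesis by simp
    qed
    finally show ?thesis .
  qed
  \<comment> \<open>The shift preserves the pairing, so only the derivative of B is left over; the
    two halves from the pairing add up to one full term.\<close>
  have inn: "pairing (pd k (\<lambda>y. gen_shift (B y) (s y)) x) (gen_shift (B x) (r x))
      - pairing (gen_shift (B x) (s x)) (pd k (\<lambda>y. gen_shift (B y) (r y)) x)
    = pairing (pd k s x) (r x) - pairing (s x) (pd k r x) + (dB k *v ?X) \<bullet> ?Y" for k
    using skew_inner[OF skew, of x "anchor (pd k s x)" ?Y] skew_inner[OF skew, of x "anchor (pd k r x)" ?X]
      skew_inner[OF dBskew, of k ?X ?Y]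
    by (simp add: pairing_real sh assms(1,2) inner_add_left algebra_simps)
  show ?thesis
    unfolding courant_bracket_jet[OF sh(1)[OF assms(1)] sh(1)[OF assms(2)]] courant_bracket_jet[OF assms(1,2)]
  proof (rule gen_eqI)
    show "formpart (jet_bracket (gen_shift (B x) (s x)) (\<lambda>l. pd l (\<lambda>y. gen_shift (B y) (s y)) x)
       (gen_shift (B x) (r x)) (\<lambda>l. pd l (\<lambda>y. gen_shift (B y) (r y)) x)) =
      formpart (gen_shift (B x) (jet_bracket (s x) (\<lambda>l. pd l s x) (r x) (\<lambda>l. pd l r x)))"
    proof -
      have lin: "B x *v (\<Sum>l\<in>UNIV. c l *\<^sub>R w l) = (\<Sum>l\<in>UNIV. c l *\<^sub>R (B x *v w l))" for c :: "'n \<Rightarrow> real" and w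
        by (simp add: linear_sum[OF matrix_vector_mul_linear] matrix_vector_mult_scaleR)
      show ?thesis
        unfolding vec_eq_iff
      proof
        fix k
        show "formpart (jet_bracket (gen_shift (B x) (s x)) (\<lambda>l. pd l (\<lambda>y. gen_shift (B y) (s y)) x)
           (gen_shift (B x) (r x)) (\<lambda>l. pd l (\<lambda>y. gen_shift (B y) (r y)) x)) $ k =
          formpart (gen_shift (B x) (jet_bracket (s x) (\<lambda>l. pd l s x) (r x) (\<lambda>l. pd l r x))) $ k"
          using dBclosed[of k] inn[of k]
          unfolding gen_shift_simps formpart_jet_bracket anchor_jet_bracket sh(3)[OF assms(1)] sh(3)[OF assms(2)]
            matrix_vector_mult_diff_distrib lin scaleR_add_right sum.distrib
            vector_add_component vector_minus_component vec_lambda_beta by linarith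
      qed
    qed
  qed (simp add: anchor_jet_bracket sh assms(1,2))
qed

section \<open>Courant isomorphisms covering a local diffeomorphism\<close>

lemma pd_scaleR:
  assumes "f differentiable (at x)" "g differentiable (at x)"
  shows "pd l (\<lambda>x. f x *\<^sub>R g x) x = f x *\<^sub>R pd l g x + pd l f x *\<^sub>R g x"
  using pd_eqI[OF has_derivative_scaleR[OF assms[unfolded frechet_derivative_works]], of l]
  by (simp add: pd_def)

lemma pd_inner:
  fixes f g :: "real^'n::finite \<Rightarrow> 'a::real_inner"
  assumes "f differentiable (at x)" "g differentiable (at x)"
  shows "pd l (\<lambda>x. f x \<bullet> g x) x = f x \<bullet> pd l g x + pd l f x \<bullet> g x"
  using pd_eqI[OF has_derivative_inner[OF assms[unfolded frechet_derivative_works]], of l]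
  by (simp add: pd_def)

lemma pd_commute_vec:
  fixes f :: "real^'n::finite \<Rightarrow> real^'k::finite"
  assumes "open S" "smooth_on S f" "x \<in> S"
  shows "pd k (pd l f) x = pd l (pd k f) x"
proof -
  have "pd k (pd l f) x $ i = pd l (pd k f) x $ i" for i
  proof -
    have c: "pd k (pd l f) x $ i = pd k (pd l (\<lambda>y. f y $ i)) x" for k l
    proof -
      have "pd k (pd l f) x $ i = pd k (\<lambda>y. pd l f y $ i) x"
        by (rule pd_component[OF smooth_on_differentiable[OF smooth_on_pd[OF assms(2)] assms(3)], symmetric])
      also have "\<dots> = pd k (pd l (\<lambda>y. f y $ i)) x"
        by (rule pd_cong[OF assms(1,3)]) (rule pd_component[OF smooth_on_differentiable[OF assms(2)], symmetric])
      finally show ?thesis .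
    qed
    show ?thesis unfolding c
      by (rule pd_commute[OF assms(1) smooth_on_linear[OF assms(1) bounded_linear_coord assms(2)] assms(3)])
  qed
  then show ?thesis by (simp add: vec_eq_iff)
qed

definition jac :: "(real^'n::finite \<Rightarrow> real^'n) \<Rightarrow> real^'n \<Rightarrow> real^'n^'n" where
  "jac h x = (\<chi> i j. pd j h x $ i)"

lemma jac_mult: "jac h x *v u = (\<Sum>k\<in>UNIV. u $ k *\<^sub>R pd k h x)"
  by (simp add: jac_def vec_eq_iff matrix_vector_mult_def mult.commute)

lemma transpose_jac_mult: "(transpose (jac h x) *v w) $ k = pd k h x \<bullet> w"
  by (simp add: jac_def transpose_def matrix_vector_mult_def inner_vec_def)

lemma matrix_inv_cancel:
  fixes A :: "real^'n^'n::finite"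
  assumes "invertible A"
  shows "A ** matrix_inv A = mat 1" "matrix_inv A ** A = mat 1"
  using someI_ex[OF assms[unfolded invertible_def]] by (simp_all add: matrix_inv_def)

text \<open>Naturality of the bracket under a diffeomorphism h with local inverse g. The transported
  sections P and Q are characterised at the source point, covectors by the transposed Jacobian
  acting on the transported side, so that no inverse matrix has to be differentiated.\<close>

lemma courant_bracket_push:
  fixes h g :: "real^'n::finite \<Rightarrow> real^'n" and s r P Q :: "real^'n \<Rightarrow> real^('n + 'n)"
  assumes "open V" "x \<in> V" "smooth_on V h" "\<forall>y\<in>V. g (h y) = y" "g differentiable (at (h x))"
    and d: "s differentiable (at x)" "r differentiable (at x)" "P differentiable (at x)" "Q differentiable (at x)"
    and P: "\<forall>y\<in>V. anchor (P y) = jac h y *v anchor (s y)"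
      "\<forall>y\<in>V. transpose (jac h y) *v formpart (P y) = formpart (s y)"
    and Q: "\<forall>y\<in>V. anchor (Q y) = jac h y *v anchor (r y)"
      "\<forall>y\<in>V. transpose (jac h y) *v formpart (Q y) = formpart (r y)"
  shows "anchor (courant_bracket (\<lambda>z. P (g z)) (\<lambda>z. Q (g z)) (h x)) = jac h x *v anchor (courant_bracket s r x)"
    and "transpose (jac h x) *v formpart (courant_bracket (\<lambda>z. P (g z)) (\<lambda>z. Q (g z)) (h x))
      = formpart (courant_bracket s r x)"
proof -
  have gx: "g (h x) = x" by (rule bspec[OF assms(4,2)])
  have dh: "h differentiable (at x)" by (rule smooth_on_differentiable[OF assms(3,2)])
  \<comment> \<open>The second derivatives of h; their symmetry is the reason why all of them cancel
    in the end.\<close>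
  define hh where "hh l k = pd l (pd k h) x" for l k
  have hh: "hh l k = hh k l" for l k unfolding hh_def by (rule pd_commute_vec[OF assms(1,3,2)])
  have dpd: "pd k h differentiable (at x)" for k by (rule smooth_on_differentiable[OF smooth_on_pd[OF assms(3)] assms(2)])
  have chain: "(\<lambda>z. p (g z)) differentiable (at (h x))"
    "pd l p x = (\<Sum>j\<in>UNIV. pd l h x $ j *\<^sub>R pd j (\<lambda>z. p (g z)) (h x))"
    if "p differentiable (at x)" for p :: "real^'n \<Rightarrow> real^('n + 'n)" and l
  proof -
    show 1: "(\<lambda>z. p (g z)) differentiable (at (h x))"
      by (rule differentiable_chain[OF assms(5)]) (simp add: gx that)
    have "pd l p x = pd l (\<lambda>y. p (g (h y))) x"
      by (rule pd_cong[OF assms(1,2)]) (simp add: assms(4))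
    also have "\<dots> = (\<Sum>j\<in>UNIV. pd l h x $ j *\<^sub>R pd j (\<lambda>z. p (g z)) (h x))"
      by (rule pd_chain[OF dh 1])
    finally show "pd l p x = (\<Sum>j\<in>UNIV. pd l h x $ j *\<^sub>R pd j (\<lambda>z. p (g z)) (h x))" .
  qed
  \<comment> \<open>A derivative in the target along the image of w is the derivative in the source
    along w.\<close>
  have along: "(\<Sum>j\<in>UNIV. v $ j *\<^sub>R L (pd j (\<lambda>z. p (g z)) (h x))) = (\<Sum>l\<in>UNIV. w $ l *\<^sub>R L (pd l p x))"
    if "p differentiable (at x)" "v = jac h x *v w" "linear L"
    for p :: "real^'n \<Rightarrow> real^('n + 'n)" and v w and L :: "real^('n + 'n) \<Rightarrow> real^'n"
  proof -
    have "(\<Sum>l\<in>UNIV. w $ l *\<^sub>R L (pd l p x))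
      = (\<Sum>l\<in>UNIV. \<Sum>j\<in>UNIV. (w $ l * pd l h x $ j) *\<^sub>R L (pd j (\<lambda>z. p (g z)) (h x)))"
      unfolding chain(2)[OF that(1)] by (simp add: linear_sum[OF that(3)] linear_scale[OF that(3)] scaleR_sum_right)
    also have "\<dots> = (\<Sum>j\<in>UNIV. \<Sum>l\<in>UNIV. (w $ l * pd l h x $ j) *\<^sub>R L (pd j (\<lambda>z. p (g z)) (h x)))"
      by (rule sum.swap)
    also have "\<dots> = (\<Sum>j\<in>UNIV. v $ j *\<^sub>R L (pd j (\<lambda>z. p (g z)) (h x)))"
      unfolding that(2) jac_mult by (simp add: scaleR_sum_left)
    finally show ?thesis ..
  qed
  have danc: "anchor (pd l p x) = (\<Sum>k\<in>UNIV. anchor (t x) $ k *\<^sub>R hh l k + anchor (pd l t x) $ k *\<^sub>R pd k h x)"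
    if "p differentiable (at x)" "t differentiable (at x)" "\<forall>y\<in>V. anchor (p y) = jac h y *v anchor (t y)"
    for p t :: "real^'n \<Rightarrow> real^('n + 'n)" and l
  proof -
    have dt: "(\<lambda>y. anchor (t y) $ k) differentiable (at x)" for k
      using that(2) differentiable_component_iff[of t x] by simp
    have "anchor (pd l p x) = pd l (\<lambda>y. anchor (p y)) x" by (rule pd_linear[OF bounded_linear_anchor that(1), symmetric])
    also have "\<dots> = pd l (\<lambda>y. \<Sum>k\<in>UNIV. anchor (t y) $ k *\<^sub>R pd k h y) x"
      by (rule pd_cong[OF assms(1,2)]) (simp add: that(3) jac_mult)
    also have "\<dots> = (\<Sum>k\<in>UNIV. pd l (\<lambda>y. anchor (t y) $ k *\<^sub>R pd k h y) x)"
      by (intro pd_sum differentiable_scaleR dt dpd)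
    also have "\<dots> = (\<Sum>k\<in>UNIV. anchor (t x) $ k *\<^sub>R hh l k + anchor (pd l t x) $ k *\<^sub>R pd k h x)"
    proof (rule sum.cong[OF refl])
      fix k
      have "pd l (\<lambda>y. anchor (t y) $ k) x = anchor (pd l t x) $ k"
        using pd_component[OF that(2), of l "Inl k"] by simp
      then show "pd l (\<lambda>y. anchor (t y) $ k *\<^sub>R pd k h y) x
          = anchor (t x) $ k *\<^sub>R hh l k + anchor (pd l t x) $ k *\<^sub>R pd k h x"
        using pd_scaleR[OF dt dpd, of l k k] by (simp add: hh_def)
    qed
    finally show ?thesis .
  qed
  have dform: "pd k h x \<bullet> formpart (pd l p x) = formpart (pd l t x) $ k - hh l k \<bullet> formpart (p x)"
    if "p differentiable (at x)" "t differentiable (at x)" "\<forall>y\<in>V. transpose (jac h y) *v formpart (p y) = formpart (t y)"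
    for p t :: "real^'n \<Rightarrow> real^('n + 'n)" and l k
  proof -
    have df: "(\<lambda>y. formpart (p y)) differentiable (at x)" by (rule differentiable_linear[OF bounded_linear_formpart that(1)])
    have "formpart (pd l t x) $ k = pd l (\<lambda>y. formpart (t y) $ k) x"
      using pd_component[OF that(2), of l "Inr k"] by simp
    also have "\<dots> = pd l (\<lambda>y. pd k h y \<bullet> formpart (p y)) x"
      by (rule pd_cong[OF assms(1,2)]) (simp add: bspec[OF that(3), symmetric] transpose_jac_mult del: formpart_nth transpose_matrix_vector)
    also have "\<dots> = pd k h x \<bullet> formpart (pd l p x) + hh l k \<bullet> formpart (p x)"
      by (simp add: pd_inner[OF dpd df] pd_linear[OF bounded_linear_formpart that(1)] hh_def)
    finally show ?thesis by simp
  qed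
  let ?s = "\<lambda>z. P (g z)" and ?r = "\<lambda>z. Q (g z)" and ?X = "anchor (s x)" and ?Y = "anchor (r x)"
  have jet: "courant_bracket ?s ?r (h x) = jet_bracket (P x) (\<lambda>l. pd l ?s (h x)) (Q x) (\<lambda>l. pd l ?r (h x))"
    using courant_bracket_jet[OF chain(1)[OF d(3)] chain(1)[OF d(4)]] by (simp add: gx)
  note jet0 = courant_bracket_jet[OF d(1,2)]
  have sym: "(\<Sum>l\<in>UNIV. ?X $ l *\<^sub>R (\<Sum>k\<in>UNIV. ?Y $ k *\<^sub>R hh l k)) = (\<Sum>l\<in>UNIV. ?Y $ l *\<^sub>R (\<Sum>k\<in>UNIV. ?X $ k *\<^sub>R hh l k))"
    unfolding scaleR_sum_right by (subst sum.swap) (simp add: hh mult.commute)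
  have lin: "jac h x *v (\<Sum>l\<in>UNIV. c l *\<^sub>R w l) = (\<Sum>l\<in>UNIV. c l *\<^sub>R (\<Sum>k\<in>UNIV. w l $ k *\<^sub>R pd k h x))" for c :: "'n \<Rightarrow> real" and w
    by (simp add: linear_sum[OF matrix_vector_mul_linear] matrix_vector_mult_scaleR jac_mult)
  show "anchor (courant_bracket ?s ?r (h x)) = jac h x *v anchor (courant_bracket s r x)"
    unfolding jet jet0 anchor_jet_bracket
      along[OF d(4) bspec[OF P(1) assms(2)] linear_anchor] along[OF d(3) bspec[OF Q(1) assms(2)] linear_anchor]
      danc[OF d(4,2) Q(1)] danc[OF d(3,1) P(1)]
      matrix_vector_mult_diff_distrib lin scaleR_add_right sum.distrib sym by simp
  have pair: "(\<Sum>j\<in>UNIV. pd k h x $ j * (pairing (pd j ?s (h x)) (Q x) - pairing (P x) (pd j ?r (h x))))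
     = pairing (pd k P x) (Q x) - pairing (P x) (pd k Q x)" for k
    unfolding chain(2)[OF d(3)] chain(2)[OF d(4)] pairing_sum_left pairing_sum_right
      scalar_mult_eq_scaleR[symmetric] pairing_scale
    by (simp add: right_diff_distrib sum_subtractf)
  \<comment> \<open>Pairing with the column d_k h of the Jacobian reads off the k-th component of
    the pulled-back covector.\<close>
  have form: "pd k h x \<bullet> formpart (courant_bracket ?s ?r (h x)) = formpart (courant_bracket s r x) $ k" for k
  proof -
    let ?a = "formpart (P x)" and ?c = "formpart (Q x)"
    have e1: "pd k h x \<bullet> formpart (courant_bracket ?s ?r (h x)) =
       (\<Sum>l\<in>UNIV. ?X $ l * (formpart (pd l r x) $ k - hh l k \<bullet> ?c)) - (\<Sum>l\<in>UNIV. ?Y $ l * (formpart (pd l s x) $ k - hh l k \<bullet> ?a))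
       + (pairing (pd k P x) (Q x) - pairing (P x) (pd k Q x))"
    proof -
      have "pd k h x \<bullet> (\<chi> j. pairing (pd j ?s (h x)) (Q x) - pairing (P x) (pd j ?r (h x)))
        = pairing (pd k P x) (Q x) - pairing (P x) (pd k Q x)"
        unfolding pair[symmetric] by (simp add: inner_vec_def)
      then show ?thesis
        unfolding jet formpart_jet_bracket
          along[OF d(4) bspec[OF P(1) assms(2)] linear_formpart] along[OF d(3) bspec[OF Q(1) assms(2)] linear_formpart]
          inner_add_right inner_diff_right inner_sum_right inner_scaleR_right
          dform[OF d(4,2) Q(2)] dform[OF d(3,1) P(2)] by simp
    qed
    \<comment> \<open>The pairing in target coordinates is rewritten in source data; the terms with
      second derivatives of h are kept explicit so that they can cancel against those in
      \<open>e1\<close>.\<close>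
    have pr: "2 * pairing (pd k p x) qv = (\<Sum>l\<in>UNIV. anchor tv $ l * (formpart (pd k u x) $ l - hh l k \<bullet> formpart (p x))
        + (anchor (u x) $ l * (hh l k \<bullet> formpart qv) + anchor (pd k u x) $ l * formpart tv $ l))"
      if "p differentiable (at x)" "u differentiable (at x)" "\<forall>y\<in>V. anchor (p y) = jac h y *v anchor (u y)"
        "\<forall>y\<in>V. transpose (jac h y) *v formpart (p y) = formpart (u y)"
        "anchor qv = jac h x *v anchor tv" "transpose (jac h x) *v formpart qv = formpart tv"
      for p u :: "real^'n \<Rightarrow> real^('n + 'n)" and qv tv
    proof -
      have f1: "formpart (pd k p x) \<bullet> anchor qv = (\<Sum>l\<in>UNIV. anchor tv $ l * (formpart (pd k u x) $ l - hh l k \<bullet> formpart (p x)))"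
        unfolding that(5) jac_mult inner_sum_right inner_scaleR_right
        by (simp add: inner_commute[of "formpart (pd k p x)"] dform[OF that(1,2,4)] hh[of k])
      have q: "pd l h x \<bullet> formpart qv = formpart tv $ l" for l
        using arg_cong[OF that(6), of "\<lambda>v. v $ l"] by (simp only: transpose_jac_mult)
      have f2: "formpart qv \<bullet> anchor (pd k p x) = (\<Sum>l\<in>UNIV. anchor (u x) $ l * (hh l k \<bullet> formpart qv) + anchor (pd k u x) $ l * formpart tv $ l)"
        unfolding danc[OF that(1-3)] inner_sum_right inner_add_right inner_scaleR_right
        by (simp only: inner_commute[of "formpart qv"] q hh[of k])
      show ?thesis unfolding pairing_real sum.distrib[symmetric] f1 f2 by (simp add: sum.distrib)
    qed
    have pr1: "2 * pairing (pd k P x) (Q x) = (\<Sum>l\<in>UNIV. ?Y $ l * (formpart (pd k s x) $ l - hh l k \<bullet> ?a)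
        + (?X $ l * (hh l k \<bullet> ?c) + anchor (pd k s x) $ l * formpart (r x) $ l))"
      by (rule pr[OF d(3,1) P bspec[OF Q(1) assms(2)] bspec[OF Q(2) assms(2)]])
    have pr2: "2 * pairing (P x) (pd k Q x) = (\<Sum>l\<in>UNIV. ?X $ l * (formpart (pd k r x) $ l - hh l k \<bullet> ?c)
        + (?Y $ l * (hh l k \<bullet> ?a) + anchor (pd k r x) $ l * formpart (s x) $ l))"
      unfolding pairing_commute[of "P x"] by (rule pr[OF d(4,2) Q bspec[OF P(1) assms(2)] bspec[OF P(2) assms(2)]])
    have e2: "formpart (courant_bracket s r x) $ k = (\<Sum>l\<in>UNIV. ?X $ l * formpart (pd l r x) $ k) - (\<Sum>l\<in>UNIV. ?Y $ l * formpart (pd l s x) $ k)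
       + (pairing (pd k s x) (r x) - pairing (s x) (pd k r x))"
      unfolding jet0 formpart_jet_bracket by simp
    have p0: "2 * pairing (pd k s x) (r x) = (\<Sum>l\<in>UNIV. formpart (pd k s x) $ l * ?Y $ l + formpart (r x) $ l * anchor (pd k s x) $ l)"
      "2 * pairing (s x) (pd k r x) = (\<Sum>l\<in>UNIV. formpart (s x) $ l * anchor (pd k r x) $ l + formpart (pd k r x) $ l * ?X $ l)"
      by (simp_all add: pairing_sum)
    have "2 * (pd k h x \<bullet> formpart (courant_bracket ?s ?r (h x))) = 2 * formpart (courant_bracket s r x) $ k"
      unfolding e1 e2 distrib_left right_diff_distrib[of 2] pr1 pr2 p0 sum_distrib_left
        sum.distrib[symmetric] sum_subtractf[symmetric]
      by (rule sum.cong[OF refl]) (simp add: algebra_simps)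
    then show ?thesis by simp
  qed
  then show "transpose (jac h x) *v formpart (courant_bracket ?s ?r (h x)) = formpart (courant_bracket s r x)"
    unfolding vec_eq_iff transpose_jac_mult by blast
qed

section \<open>Smoothness of inverse matrices and of inverse maps\<close>

lemma smooth_on_det:
  fixes A :: "real^'n::finite \<Rightarrow> real^'k::finite^'k"
  assumes "open S" "\<And>i j. smooth_on S (\<lambda>x. A x $ i $ j)"
  shows "smooth_on S (\<lambda>x. det (A x))"
  unfolding det_def
  by (intro smooth_on_sum smooth_on_mult smooth_on_const smooth_on_prod assms)

text \<open>Cramer's rule, applied to the columns of the inverse, exhibits its entries as quotients
  of determinants, which are polynomial in the entries of A.\<close>

lemma smooth_on_matrix_inv:
  fixes A :: "real^'n::finite \<Rightarrow> real^'k::finite^'k"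
  assumes "open S" "\<And>i j. smooth_on S (\<lambda>x. A x $ i $ j)" "\<And>x. x \<in> S \<Longrightarrow> invertible (A x)"
  shows "smooth_on S (\<lambda>x. matrix_inv (A x) $ i $ j)"
proof (rule smooth_on_cong[OF assms(1)])
  show "smooth_on S (\<lambda>x. det (\<chi> a b. if b = i then axis j 1 $ a else A x $ a $ b) / det (A x))"
  proof (rule smooth_on_divide[OF assms(1)])
    show "det (A x) \<noteq> 0" if "x \<in> S" for x using assms(3)[OF that] by (simp add: invertible_det_nz)
    show "smooth_on S (\<lambda>x. det (\<chi> a b. if b = i then axis j 1 $ a else A x $ a $ b))"
    proof (rule smooth_on_det[OF assms(1)])
      show "smooth_on S (\<lambda>x. (\<chi> a b. if b = i then axis j 1 $ a else A x $ a $ b) $ a $ b)" for a b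
        by (cases "b = i") (simp_all add: smooth_on_const assms(2))
    qed
  qed (rule smooth_on_det[OF assms(1,2)])
  fix x assume x: "x \<in> S"
  have nz: "det (A x) \<noteq> 0" using assms(3)[OF x] by (simp add: invertible_det_nz)
  have "A x *v (matrix_inv (A x) *v axis j 1) = axis j 1"
    by (simp add: matrix_vector_mul_assoc matrix_inv_cancel[OF assms(3)[OF x]])
  then have "matrix_inv (A x) *v axis j 1 = (\<chi> i. det (\<chi> a b. if b = i then axis j 1 $ a else A x $ a $ b) / det (A x))"
    using cramer[OF nz] by blast
  then have "(matrix_inv (A x) *v axis j 1) $ i = det (\<chi> a b. if b = i then axis j 1 $ a else A x $ a $ b) / det (A x)"
    by simp
  then show "det (\<chi> a b. if b = i then axis j 1 $ a else A x $ a $ b) / det (A x) = matrix_inv (A x) $ i $ j"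
    by (simp add: matrix_vector_mult_basis column_def)
qed

lemma jac_derivative:
  assumes "h differentiable (at x)"
  shows "(h has_derivative (\<lambda>u. jac h x *v u)) (at x)"
  unfolding jac_mult by (rule has_derivative_pd[OF assms])

lemma smooth_on_jac:
  assumes "open S" "smooth_on S h"
  shows "smooth_on S (\<lambda>x. jac h x $ i $ j)"
  unfolding jac_def using smooth_on_linear[OF assms(1) bounded_linear_coord smooth_on_pd[OF assms(2)]] by simp

text \<open>Invariance of domain makes the image open, and the inverse g has derivative (Dh)^-1 o g.
  This formula contains g undifferentiated, so order k for g yields order k for Dg, hence order k +
  1 for g.\<close>

lemma smooth_inverse:
  fixes h :: "real^'n::finite \<Rightarrow> real^'n"
  assumes "open V" "smooth_on V h" "inj_on h V" "\<And>x. x \<in> V \<Longrightarrow> invertible (jac h x)"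
  shows "open (h ` V)" "smooth_on (h ` V) (inv_into V h)"
proof -
  let ?g = "inv_into V h" and ?W = "h ` V"
  have cont: "continuous_on V h" by (rule smooth_on_continuous[OF assms(2)])
  show W: "open ?W" by (rule invariance_of_domain[OF cont assms(1,3)])
  have gh: "?g (h x) = x" if "x \<in> V" for x by (rule inv_into_f_f[OF assms(3) that])
  have gV: "?g ` ?W \<subseteq> V" using gh by auto
  have der: "(?g has_derivative (\<lambda>u. matrix_inv (jac h (?g z)) *v u)) (at z)" if z: "z \<in> ?W" for z
  proof -
    obtain x where x: "x \<in> V" "z = h x" using z by blast
    have "(\<lambda>u. jac h x *v u) \<circ> (\<lambda>u. matrix_inv (jac h x) *v u) = id"
      by (simp add: fun_eq_iff matrix_vector_mul_assoc matrix_inv_cancel[OF assms(4)[OF x(1)]])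
    from has_derivative_inverse_strong[OF assms(1) x(1) cont gh jac_derivative[OF smooth_on_differentiable[OF assms(2) x(1)]] this]
    show ?thesis by (simp add: x(2) gh[OF x(1)])
  qed
  have pdg: "pd l ?g z $ i = matrix_inv (jac h (?g z)) $ i $ l" if "z \<in> ?W" for l z i
    using pd_eqI[OF der[OF that], of l] by (simp add: matrix_vector_mult_basis column_def)
  show "smooth_on ?W ?g"
    unfolding smooth_on_def
  proof
    fix k show "Cdiff k ?W ?g"
    proof (induction k)
      case 0
      have "isCont ?g z" if "z \<in> ?W" for z by (rule has_derivative_continuous[OF der[OF that]])
      then show ?case by (simp add: continuous_at_imp_continuous_on)
    next
      case (Suc k)
      have "Cdiff k ?W (pd l ?g)" for l
        unfolding Cdiff_component_iff[OF W]
      proof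
        fix i
        show "Cdiff k ?W (\<lambda>z. pd l ?g z $ i)"
        proof (rule Cdiff_cong[OF W])
          show "Cdiff k ?W (\<lambda>z. matrix_inv (jac h (?g z)) $ i $ l)"
            by (rule Cdiff_compose[OF W assms(1) gV smooth_on_matrix_inv[OF assms(1) smooth_on_jac[OF assms(1,2)] assms(4)] Suc.IH])
        qed (simp add: pdg)
      qed
      then show ?case using differentiableI[OF der] by simp
    qed
  qed
qed

section \<open>The bundle map composed of a B-field and a push-forward\<close>

definition gen_iso :: "real^'n::finite^'n \<Rightarrow> real^'n^'n \<Rightarrow> real^('n + 'n)^('n + 'n)" where
  "gen_iso A B = matrix (\<lambda>u. gen_push A (gen_shift B u))"

lemma linear_gen_push_shift: "linear (\<lambda>u. gen_push A (gen_shift B u))"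
proof (rule linearI)
  show "gen_push A (gen_shift B (u + v)) = gen_push A (gen_shift B u) + gen_push A (gen_shift B v)" for u v
    by (rule gen_eqI) (simp_all add: gen_push_def matrix_vector_right_distrib)
  show "gen_push A (gen_shift B (c *\<^sub>R u)) = c *\<^sub>R gen_push A (gen_shift B u)" for c u
    by (rule gen_eqI)
      (simp_all add: gen_push_def matrix_vector_right_distrib matrix_vector_mult_scaleR scaleR_add_right)
qed

lemma gen_iso_mult: "gen_iso A B *v u = gen_push A (gen_shift B u)"
  unfolding gen_iso_def by (rule fun_cong[OF matrix_vector_mul(2)[OF linear_gen_push_shift]])

lemma anchor_gen_iso: "anchor (gen_iso A B *v u) = A *v anchor u"
  by (simp add: gen_iso_mult gen_push_def)

lemma formpart_gen_iso:
  assumes "invertible A"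
  shows "transpose A *v formpart (gen_iso A B *v u) = formpart u + B *v anchor u"
proof -
  have "transpose A ** transpose (matrix_inv A) = mat 1"
    using matrix_inv_cancel(2)[OF assms] by (simp add: matrix_transpose_mul[symmetric] transpose_mat)
  then show ?thesis
    by (simp add: gen_iso_mult gen_push_def matrix_vector_mul_assoc del: transpose_matrix_vector)
qed

lemma transpose_mult_eqD:
  fixes A :: "real^'n::finite^'n"
  assumes "invertible A" "transpose A *v u = transpose A *v v"
  shows "u = v"
proof -
  have "transpose (matrix_inv A) ** transpose A = mat 1"
    using matrix_inv_cancel(1)[OF assms(1)] by (simp add: matrix_transpose_mul[symmetric] transpose_mat)
  then show ?thesis using arg_cong[OF assms(2), of "\<lambda>w. transpose (matrix_inv A) *v w"]
    by (simp add: matrix_vector_mul_assoc del: transpose_matrix_vector)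
qed

text \<open>The Jacobian and its inverse transpose cancel in the pairing of a covector with a
  vector; the two contributions of B cancel by skewness.\<close>

lemma pairing_gen_iso:
  assumes "invertible A" "transpose B = - B"
  shows "pairing (gen_iso A B *v u) (gen_iso A B *v v) = pairing u v"
proof -
  have "formpart (gen_iso A B *v u) \<bullet> anchor (gen_iso A B *v v) = (formpart u + B *v anchor u) \<bullet> anchor v" for u v
    unfolding formpart_gen_iso[OF assms(1), symmetric, of u B] anchor_gen_iso
    by (metis dot_lmul_matrix transpose_matrix_vector)
  then show ?thesis
    using skew_inner[OF assms(2), of "anchor u" "anchor v"] by (simp add: pairing_real inner_add_left)
qed

lemma smooth_on_gen_iso:
  assumes "open S" "\<And>i j. smooth_on S (\<lambda>x. A x $ i $ j)" "\<And>i j. smooth_on S (\<lambda>x. B x $ i $ j)"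
    "\<And>x. x \<in> S \<Longrightarrow> invertible (A x)"
  shows "smooth_on S (\<lambda>x. gen_iso (A x) (B x) $ i $ j)"
proof -
  define c where "c = anchor (axis j (1::real))"
  define d where "d = formpart (axis j (1::real))"
  have "gen_iso (A x) (B x) $ i $ j = (gen_iso (A x) (B x) *v axis j 1) $ i" for x
    by (simp add: matrix_vector_mult_basis column_def)
  then have eq: "gen_iso (A x) (B x) $ i $ j = mk_gen (A x *v c) (transpose (matrix_inv (A x)) *v (d + B x *v c)) $ i" for x
    by (simp add: gen_iso_mult gen_push_def c_def d_def)
  show ?thesis unfolding eq
  proof (cases i)
    case (Inl k)
    show "smooth_on S (\<lambda>x. mk_gen (A x *v c) (transpose (matrix_inv (A x)) *v (d + B x *v c)) $ i)"
      unfolding Inl mk_gen_nth matrix_vector_mult_def vec_lambda_beta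
      by (intro smooth_on_sum smooth_on_mult smooth_on_const assms)
  next
    case (Inr k)
    show "smooth_on S (\<lambda>x. mk_gen (A x *v c) (transpose (matrix_inv (A x)) *v (d + B x *v c)) $ i)"
      unfolding Inr mk_gen_nth matrix_vector_mult_def vec_lambda_beta transpose_def vector_add_component
      by (intro smooth_on_sum smooth_on_mult smooth_on_add smooth_on_const smooth_on_matrix_inv assms)
  qed
qed

lemma smooth_on_matrix_vector:
  fixes A :: "real^'n::finite \<Rightarrow> real^'k::finite^'m::finite"
  assumes "open S" "\<And>i j. smooth_on S (\<lambda>x. A x $ i $ j)" "smooth_on S s"
  shows "smooth_on S (\<lambda>x. A x *v s x)"
  unfolding smooth_on_component_iff[OF assms(1)] matrix_vector_mult_def vec_lambda_beta
  using assms(2) smooth_on_linear[OF assms(1) bounded_linear_coord assms(3)]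
  by (intro allI smooth_on_sum smooth_on_mult assms(1)) auto

theorem courant_iso_push_shift:
  fixes h :: "real^'n::finite \<Rightarrow> real^'n" and B :: "real^'n \<Rightarrow> real^'n^'n"
  assumes "open V" "smooth_on V h" "inj_on h V" and inv: "\<And>x. x \<in> V \<Longrightarrow> invertible (jac h x)"
    and B: "\<And>i j. smooth_on V (\<lambda>x. B x $ i $ j)" and skew: "\<And>x. transpose (B x) = - B x"
    and closed: "\<And>x i j k. x \<in> V \<Longrightarrow> pd i (\<lambda>y. B y $ j $ k) x + pd j (\<lambda>y. B y $ k $ i) x + pd k (\<lambda>y. B y $ i $ j) x = 0"
  shows "courant_iso V (h ` V) h (\<lambda>x. gen_iso (jac h x) (B x))"
proof -
  let ?g = "inv_into V h" and ?\<Phi> = "\<lambda>x. gen_iso (jac h x) (B x)"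
  note W = smooth_inverse[OF assms(1-3) inv]
  have gh: "?g (h x) = x" if "x \<in> V" for x by (rule inv_into_f_f[OF assms(3) that])
  have sm: "smooth_on V (\<lambda>x. ?\<Phi> x $ i $ j)" for i j
    by (rule smooth_on_gen_iso[OF assms(1) smooth_on_jac[OF assms(1,2)] B inv])
  have "invertible (?\<Phi> x)" if x: "x \<in> V" for x
  proof -
    have "u = 0" if "?\<Phi> x *v u = 0" for u
    proof -
      have "pairing u v = 0" for v
        using pairing_gen_iso[OF inv[OF x] skew, of x u v] that by simp
      then show ?thesis by (rule pairing_nondegenerate)
    qed
    then show ?thesis
      unfolding invertible_left_inverse using matrix_left_invertible_ker by blast
  qed
  moreover have "anchor (?\<Phi> x *v u) = frechet_derivative h (at x) (anchor u)" if "x \<in> V" for x u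
    using frechet_derivative_at[OF jac_derivative[OF smooth_on_differentiable[OF assms(2) that]]]
    by (simp add: anchor_gen_iso)
  moreover have "courant_bracket (push_section V h ?\<Phi> s) (push_section V h ?\<Phi> r) y
                = push_section V h ?\<Phi> (courant_bracket s r) y"
    if s: "smooth_on V s" and r: "smooth_on V r" and y: "y \<in> h ` V" for s r y
  proof -
    obtain x where x: "x \<in> V" "y = h x" using y by blast
    let ?P = "\<lambda>x. ?\<Phi> x *v s x" and ?Q = "\<lambda>x. ?\<Phi> x *v r x"
    let ?s = "\<lambda>x. gen_shift (B x) (s x)" and ?r = "\<lambda>x. gen_shift (B x) (r x)"
    have smooth_shift: "smooth_on V (\<lambda>x. gen_shift (B x) (u x))" if "smooth_on V u" for u
      unfolding smooth_on_component_iff[OF assms(1)]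
    proof
      fix i
      note a = smooth_on_linear[OF assms(1) bounded_linear_anchor that]
      note Ba = smooth_on_add[OF assms(1) smooth_on_linear[OF assms(1) bounded_linear_formpart that]
          smooth_on_matrix_vector[OF assms(1) B a]]
      show "smooth_on V (\<lambda>x. gen_shift (B x) (u x) $ i)"
      proof (cases i)
        case (Inl k)
        then show ?thesis
          using smooth_on_linear[OF assms(1) bounded_linear_coord a, of k] by (simp add: gen_shift_def)
      next
        case (Inr k)
        show ?thesis unfolding Inr gen_shift_def mk_gen_nth
          by (rule smooth_on_linear[OF assms(1) bounded_linear_coord Ba])
      qed
    qed
    note d = smooth_on_differentiable[OF smooth_shift[OF s] x(1)] smooth_on_differentiable[OF smooth_shift[OF r] x(1)]
      smooth_on_differentiable[OF smooth_on_matrix_vector[OF assms(1) sm s] x(1)]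
      smooth_on_differentiable[OF smooth_on_matrix_vector[OF assms(1) sm r] x(1)]
    have "smooth_on (h ` V) ?g" by (rule smooth_inverse[OF assms(1-3)]) (rule inv)
    then have dg: "?g differentiable (at (h x))" by (rule smooth_on_differentiable) (rule imageI[OF x(1)])
    have shift: "courant_bracket ?s ?r x = gen_shift (B x) (courant_bracket s r x)"
      by (rule courant_bracket_shift[OF smooth_on_differentiable[OF s x(1)] smooth_on_differentiable[OF r x(1)]
            smooth_on_differentiable[OF B x(1)] skew closed[OF x(1)]])
    \<comment> \<open>On transported sections \<open>gen_iso\<close> acts as a pure push-forward of
      the shifted sections, so the two bracket identities can be chained.\<close>
    have rel: "\<forall>y\<in>V. anchor (?\<Phi> y *v u y) = jac h y *v anchor (gen_shift (B y) (u y))"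
      "\<forall>y\<in>V. transpose (jac h y) *v formpart (?\<Phi> y *v u y) = formpart (gen_shift (B y) (u y))"
      for u :: "real^'n \<Rightarrow> real^('n + 'n)"
      by (simp_all add: anchor_gen_iso formpart_gen_iso inv del: transpose_matrix_vector)
    have gh': "\<forall>y\<in>V. ?g (h y) = y" using gh by blast
    note push = courant_bracket_push[OF assms(1) x(1) assms(2) gh' dg d rel(1)[of s] rel(2)[of s] rel(1)[of r] rel(2)[of r]]
    have "courant_bracket (\<lambda>z. ?P (?g z)) (\<lambda>z. ?Q (?g z)) (h x) = ?\<Phi> x *v courant_bracket s r x"
    proof (rule gen_eqI)
      show "anchor (courant_bracket (\<lambda>z. ?P (?g z)) (\<lambda>z. ?Q (?g z)) (h x)) = anchor (?\<Phi> x *v courant_bracket s r x)"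
        by (simp add: push(1) shift anchor_gen_iso)
      show "formpart (courant_bracket (\<lambda>z. ?P (?g z)) (\<lambda>z. ?Q (?g z)) (h x)) = formpart (?\<Phi> x *v courant_bracket s r x)"
        by (rule transpose_mult_eqD[OF inv[OF x(1)]]) (simp add: push(2) shift formpart_gen_iso inv[OF x(1)] del: transpose_matrix_vector)
    qed
    then show ?thesis by (simp add: push_section_def[abs_def] x(2) gh[OF x(1)])
  qed
  ultimately show ?thesis
    unfolding courant_iso_def
    using assms(2,3) W(2) sm pairing_gen_iso[OF inv skew] by (auto simp: bij_betw_def)
qed

section \<open>Integrating the infinitesimal equation\<close>

text \<open>The negative of the zeroth-order part of the Dorfman bracket with b: for a section w,
  that bracket is the derivative of w along the anchor of b, minus \<open>gen_ad\<close> of the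
  partial derivatives of b applied to w.\<close>

definition gen_ad :: "('n::finite \<Rightarrow> 'a::real_normed_field ^ ('n + 'n)) \<Rightarrow> 'a ^ ('n + 'n) \<Rightarrow> 'a ^ ('n + 'n)" where
  "gen_ad db w = dir_sum w db - mk_gen 0 (\<chi> i. 2 * pairing (db i) w)"

lemma pairing_dir_sum: "pairing (dir_sum w db) v = (\<Sum>l\<in>UNIV. w $ Inl l * pairing (db l) v)"
  by (simp add: dir_sum_def pairing_sum_left pairing_scale)

lemma pairing_form: "pairing (mk_gen 0 \<zeta>) v = 1/2 * (\<Sum>i\<in>UNIV. \<zeta> $ i * v $ Inl i)"
  by (simp add: pairing_sum)

lemma pairing_gen_ad: "pairing (gen_ad db u) v = pairing (dir_sum u db) v - pairing (dir_sum v db) u"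
proof -
  have "1/2 * (\<Sum>i\<in>UNIV. (2 * pairing (db i) u) * v $ Inl i) = (\<Sum>i\<in>UNIV. v $ Inl i * pairing (db i) u)"
    by (simp add: sum_distrib_left mult_ac)
  then show ?thesis
    by (simp add: gen_ad_def pairing_diff pairing_form pairing_dir_sum)
qed

text \<open>Thus \<open>gen_ad\<close> lies in the orthogonal Lie algebra of the pairing; this is
  what keeps matrix coefficients constant along rays below.\<close>

lemma gen_ad_skew: "pairing (gen_ad db u) v = - pairing u (gen_ad db v)"
  unfolding pairing_commute[of u] pairing_gen_ad by simp

lemma euler_linear:
  assumes "bounded_linear L" "f differentiable (at x)"
  shows "euler (\<lambda>x. L (f x)) x = L (euler f x)"
  using bounded_linear.linear[OF assms(1)]
  by (simp add: euler_def pd_linear[OF assms] linear_sum linear_scale)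

lemma euler_inner:
  fixes f g :: "real^'n::finite \<Rightarrow> 'a::real_inner"
  assumes "f differentiable (at x)" "g differentiable (at x)"
  shows "euler (\<lambda>x. f x \<bullet> g x) x = f x \<bullet> euler g x + euler f x \<bullet> g x"
  by (simp add: euler_def pd_inner[OF assms] inner_sum_right inner_sum_left distrib_left sum.distrib)

lemma euler_cong:
  assumes "open S" "x \<in> S" "\<And>y. y \<in> S \<Longrightarrow> f y = g y"
  shows "euler f x = euler g x"
proof -
  have "pd l f x = pd l g x" for l by (rule pd_cong[OF assms(1,2)]) (rule assms(3))
  then show ?thesis by (simp add: euler_def)
qed

lemma pd_pairing:
  fixes f g :: "real^'n::finite \<Rightarrow> 'a::real_normed_field ^ ('n + 'n)"
  assumes "f differentiable (at x)" "g differentiable (at x)"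
  shows "pd l (\<lambda>y. pairing (f y) (g y)) x = pairing (pd l f x) (g x) + pairing (f x) (pd l g x)"
proof -
  have c: "(\<lambda>y. f y $ a) differentiable (at x)" "(\<lambda>y. g y $ a) differentiable (at x)" for a
    using assms differentiable_component_iff by blast+
  have m: "(\<lambda>y. f y $ Inr l * g y $ Inl l) differentiable (at x)" "(\<lambda>y. g y $ Inr l * f y $ Inl l) differentiable (at x)" for l
    by (intro differentiable_mult c)+
  have s: "(\<lambda>y. \<Sum>l\<in>UNIV. f y $ Inr l * g y $ Inl l + g y $ Inr l * f y $ Inl l) differentiable (at x)"
    by (intro differentiable_sum finite ballI differentiable_add m)
  have "pd l (\<lambda>y. pairing (f y) (g y)) x = 1/2 * pd l (\<lambda>y. \<Sum>l\<in>UNIV. f y $ Inr l * g y $ Inl l + g y $ Inr l * f y $ Inl l) x"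
    unfolding pairing_sum using pd_mult[of "\<lambda>y. 1/2" x, OF _ s, of l] by simp
  also have "pd l (\<lambda>y. \<Sum>l\<in>UNIV. f y $ Inr l * g y $ Inl l + g y $ Inr l * f y $ Inl l) x
    = (\<Sum>k\<in>UNIV. pd l (\<lambda>y. f y $ Inr k * g y $ Inl k + g y $ Inr k * f y $ Inl k) x)"
    by (intro pd_sum differentiable_add m)
  also have "\<dots> = (\<Sum>k\<in>UNIV. (pd l f x $ Inr k * g x $ Inl k + g x $ Inr k * pd l f x $ Inl k)
        + (f x $ Inr k * pd l g x $ Inl k + pd l g x $ Inr k * f x $ Inl k))"
    by (intro sum.cong refl)
      (simp add: pd_add[OF m] pd_mult[OF c(1) c(2)] pd_mult[OF c(2) c(1)] pd_component[OF assms(1)] pd_component[OF assms(2)])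
  finally show ?thesis by (simp add: pairing_sum sum.distrib distrib_left)
qed

lemma euler_pairing:
  fixes f g :: "real^'n::finite \<Rightarrow> real ^ ('n + 'n)"
  assumes "f differentiable (at x)" "g differentiable (at x)"
  shows "euler (\<lambda>y. pairing (f y) (g y)) x = pairing (euler f x) (g x) + pairing (f x) (euler g x)"
  unfolding euler_def pd_pairing[OF assms] pairing_sum_left pairing_sum_right
  by (simp add: scalar_mult_eq_scaleR[symmetric] pairing_scale distrib_left sum.distrib)

lemma pd_matrix_vector':
  fixes B :: "real^'n::finite \<Rightarrow> real^'k::finite^'m::finite" and X :: "real^'n \<Rightarrow> real^'k"
  assumes "B differentiable (at x)" "X differentiable (at x)"
  shows "pd l (\<lambda>y. B y *v X y) x = pd l B x *v X x + B x *v pd l X x"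
proof -
  have B: "(\<lambda>y. B y $ i) differentiable (at x)" for i using assms(1) differentiable_component_iff by blast
  have c: "(\<lambda>y. B y $ i $ j) differentiable (at x)" for i j
    by (rule differentiable_linear[OF bounded_linear_coord B])
  have "(\<chi> i j. pd l (\<lambda>y. B y $ i $ j) x) = pd l B x"
    by (simp add: vec_eq_iff pd_component[OF B] pd_component[OF assms(1)])
  then show ?thesis using pd_matrix_vector(1)[OF c assms(2), of l] by simp
qed

lemma matrix_sum_left: "(\<Sum>i\<in>I. A i) *v w = (\<Sum>i\<in>I. A i *v w)"
  for A :: "'i \<Rightarrow> real^'k::finite^'m::finite"
  by (induction I rule: infinite_finite_induct) (simp_all add: matrix_vector_mult_add_rdistrib)

lemma euler_matrix_vector:
  fixes B :: "real^'n::finite \<Rightarrow> real^'k::finite^'m::finite" and X :: "real^'n \<Rightarrow> real^'k"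
  assumes "B differentiable (at x)" "X differentiable (at x)"
  shows "euler (\<lambda>y. B y *v X y) x = euler B x *v X x + B x *v euler X x"
  unfolding euler_def pd_matrix_vector'[OF assms] matrix_sum_left linear_sum[OF matrix_vector_mul_linear]
  by (simp add: scaleR_add_right sum.distrib matrix_vector_mult_scaleR scaleR_matrix_vector_assoc)

lemma smooth_on_compose_vec:
  fixes b :: "real^'n::finite \<Rightarrow> real^'k::finite" and h :: "real^'n \<Rightarrow> real^'n"
  assumes "open S" "open T" "h ` S \<subseteq> T" "smooth_on T b" "smooth_on S h"
  shows "smooth_on S (\<lambda>x. b (h x))"
  unfolding smooth_on_component_iff[OF assms(1)]
  using smooth_on_compose[OF assms(1-3) smooth_on_linear[OF assms(2) bounded_linear_coord assms(4)] assms(5)] by blast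

lemma euler_pd_vec:
  fixes v w :: "real^'n::finite \<Rightarrow> real^'k::finite"
  assumes "open S" "smooth_on S v" "x \<in> S" "w differentiable (at x)"
    and "\<And>y. y \<in> S \<Longrightarrow> euler v y = v y + w y"
  shows "euler (pd l v) x = pd l w x"
proof -
  have "euler (pd l v) x $ i = pd l w x $ i" for i
  proof -
    have dv: "v differentiable (at y)" if "y \<in> S" for y by (rule smooth_on_differentiable[OF assms(2) that])
    have "euler (pd l (\<lambda>y. v y $ i)) x + (- 1 + 1) * pd l (\<lambda>y. v y $ i) x = pd l (\<lambda>y. w y $ i) x"
      by (rule euler_pd[OF assms(1) smooth_on_linear[OF assms(1) bounded_linear_coord assms(2)] assms(3)])
         (simp add: euler_component[OF dv] assms(5))
    moreover have "euler (pd l (\<lambda>y. v y $ i)) x = euler (\<lambda>y. pd l v y $ i) x"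
      by (rule euler_cong[OF assms(1,3)]) (rule pd_component[OF dv])
    ultimately show ?thesis
      by (simp add: euler_component[OF smooth_on_differentiable[OF smooth_on_pd[OF assms(2)] assms(3)]] pd_component[OF assms(4)])
  qed
  then show ?thesis by (simp add: vec_eq_iff)
qed

lemma invertible_jac_near_identity:
  fixes h :: "real^'n::finite \<Rightarrow> real^'n"
  assumes "\<And>l i. \<bar>pd l h x $ i - axis l 1 $ i\<bar> \<le> 1 / (2 * (real CARD('n))\<^sup>2)"
  shows "invertible (jac h x)"
proof -
  have "u = 0" if "jac h x *v u = 0" for u
  proof -
    let ?N = "real CARD('n)"
    have "\<bar>u $ i\<bar> \<le> ?N * (norm u * (1 / (2 * ?N\<^sup>2)))" for i
    proof -
      have "u $ i = (\<Sum>l\<in>UNIV. u $ l * axis l 1 $ i) - (jac h x *v u) $ i"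
        using arg_cong[OF basis_expansion[of u], of "\<lambda>v. v $ i"] by (simp add: that)
      also have "\<dots> = - (\<Sum>l\<in>UNIV. u $ l * (pd l h x $ i - axis l 1 $ i))"
        by (simp add: jac_mult right_diff_distrib sum_subtractf)
      finally have "\<bar>u $ i\<bar> = \<bar>\<Sum>l\<in>UNIV. u $ l * (pd l h x $ i - axis l 1 $ i)\<bar>" by simp
      also have "\<dots> \<le> (\<Sum>l\<in>(UNIV::'n set). norm u * (1 / (2 * ?N\<^sup>2)))"
        by (rule order_trans[OF sum_abs sum_mono])
           (unfold abs_mult, intro mult_mono component_le_norm_cart assms, auto)
      finally show ?thesis by simp
    qed
    from norm_le_card[OF this] have "norm u \<le> 1/2 * norm u" by (simp add: power2_eq_square)
    then show "u = 0" by simp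
  qed
  then show ?thesis unfolding invertible_left_inverse using matrix_left_invertible_ker by blast
qed

text \<open>Along the flow, \<open>gen_iso\<close> satisfies the linear equation generated by \<open>gen_ad\<close>, so it conjugates
  \<open>J \<circ> h\<close> to a tensor whose Euler derivative vanishes.\<close>

theorem isomorphic_to_constant_of_infinitesimal:
  fixes J :: "real^'n::finite \<Rightarrow> real^('n + 'n)^('n + 'n)" and b :: "real^'n \<Rightarrow> real^('n + 'n)"
  assumes "smooth_on (ball 0 1) b" "b 0 = 0" "\<And>l. pd l b 0 = 0"
    and J: "smooth_on (ball 0 1) J" "J 0 ** J 0 = - mat 1" "\<And>u v. pairing (J 0 *v u) (J 0 *v v) = pairing u v"
    and inf: "\<And>y w. y \<in> ball 0 1 \<Longrightarrow> (\<Sum>j\<in>UNIV. (y $ j + b y $ Inl j) *\<^sub>R (pd j J y *v w))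
      = gen_ad (\<lambda>l. pd l b y) (J y *v w) - J y *v gen_ad (\<lambda>l. pd l b y) w"
  shows "isomorphic_to_constant_near_0 (ball 0 1) J"
proof -
  let ?T = "ball (0::real^'n) 1"
  have 0: "0 \<in> ?T" by simp
  have db: "b differentiable (at y)" if "y \<in> ?T" for y by (rule smooth_on_differentiable[OF assms(1) that])
  have pdX: "pd l (\<lambda>y. anchor (b y)) y = anchor (pd l b y)" if "y \<in> ?T" for l y
    by (rule pd_linear[OF bounded_linear_anchor db[OF that]])
  have smX: "smooth_on ?T (\<lambda>y. anchor (b y))" by (rule smooth_on_linear[OF open_ball bounded_linear_anchor assms(1)])
  obtain r h where r: "0 < r" "r \<le> 1/4" and smh: "smooth_on (ball 0 r) h" and h0: "h 0 = 0" "\<And>l. pd l h 0 = axis l 1"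
    and hnorm: "\<And>x. x \<in> ball 0 r \<Longrightarrow> norm (h x) \<le> 2 * norm x"
    and hnear: "\<And>x l i. x \<in> ball 0 r \<Longrightarrow> \<bar>pd l h x $ i - axis l 1 $ i\<bar> \<le> 1 / (2 * (real CARD('n))\<^sup>2)"
    and heul: "\<And>x. x \<in> ball 0 r \<Longrightarrow> euler h x = h x + anchor (b (h x))"
    by (rule euler_flow[OF smX]) (use assms(2,3) pdX[OF 0] in auto)
  let ?S = "ball (0::real^'n) r"
  have zero: "0 \<in> ?S" using r by simp
  have hT: "h ` ?S \<subseteq> ?T" using hnorm r by fastforce
  have hxT: "h x \<in> ?T" if "x \<in> ?S" for x using hT that by blast
  have dh: "h differentiable (at x)" if "x \<in> ?S" for x by (rule smooth_on_differentiable[OF smh that])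
  have smD: "smooth_on ?S (pd k h)" for k by (rule smooth_on_pd[OF smh])
  have dD: "pd k h differentiable (at x)" if "x \<in> ?S" for x k by (rule smooth_on_differentiable[OF smD that])
  have inv: "invertible (jac h x)" if "x \<in> ?S" for x
    by (rule invertible_jac_near_identity) (rule hnear[OF that])
  have smbh: "smooth_on ?S (\<lambda>x. b (h x))" by (rule smooth_on_compose_vec[OF open_ball open_ball hT assms(1) smh])
  have dbh: "(\<lambda>x. b (h x)) differentiable (at x)" if "x \<in> ?S" for x by (rule smooth_on_differentiable[OF smbh that])
  have pdbh: "pd l (\<lambda>x. b (h x)) x = (\<Sum>m\<in>UNIV. pd l h x $ m *\<^sub>R pd m b (h x))" if "x \<in> ?S" for l x
    by (rule pd_chain[OF dh[OF that] db[OF hxT[OF that]]])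
  have eulD: "euler (pd k h) x = (\<Sum>m\<in>UNIV. pd k h x $ m *\<^sub>R anchor (pd m b (h x)))" if x: "x \<in> ?S" for k x
  proof -
    have "euler (pd k h) x = pd k (\<lambda>x. anchor (b (h x))) x"
      by (rule euler_pd_vec[OF open_ball smh x differentiable_linear[OF bounded_linear_anchor dbh[OF x]]]) (rule heul)
    then show ?thesis by (simp add: pd_linear[OF bounded_linear_anchor dbh[OF x]] pdbh[OF x])
  qed
  \<comment> \<open>The components of the pull-back of \<xi> along h. They inherit the vanishing
    1-jet from b, which makes the equation for \<theta> solvable.\<close>
  define w where "w i x = formpart (b (h x)) \<bullet> pd i h x" for i x
  have smw: "smooth_on ?S (w i)" for i
    unfolding w_def inner_vec_def inner_real_def
    by (intro smooth_on_sum smooth_on_mult open_ball smooth_on_linear[OF open_ball bounded_linear_coord]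
        smD smooth_on_linear[OF open_ball bounded_linear_formpart smbh])
  have pdw: "pd l (w i) x = formpart (b (h x)) \<bullet> pd l (pd i h) x
      + (\<Sum>m\<in>UNIV. pd l h x $ m *\<^sub>R formpart (pd m b (h x))) \<bullet> pd i h x" if x: "x \<in> ?S" for l i x
    unfolding w_def
    by (simp add: pd_inner[OF differentiable_linear[OF bounded_linear_formpart dbh[OF x]] dD[OF x]]
        pd_linear[OF bounded_linear_formpart dbh[OF x]] pdbh[OF x])
  have "\<exists>u. smooth_on ?S u \<and> u 0 = 0 \<and> (\<forall>l. pd l u 0 = 0) \<and> (\<forall>x\<in>?S. euler u x = u x + w i x)" for i
  proof -
    have "w i 0 = 0" by (simp add: w_def h0 assms(2))
    moreover have "pd l (w i) 0 = 0" for l by (simp add: pdw[OF zero] h0 assms(2,3))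
    ultimately show ?thesis
      by (rule_tac euler_quadratic_solution[OF smw _ _ r(1), of i]) blast+
  qed
  then obtain \<theta> where \<theta>: "\<And>i. smooth_on ?S (\<theta> i)" "\<And>i l. pd l (\<theta> i) 0 = 0"
    "\<And>i x. x \<in> ?S \<Longrightarrow> euler (\<theta> i) x = \<theta> i x + w i x" by metis
  \<comment> \<open>The sign is such that B applied to a vector field is its contraction with
    d\<theta>; exactness yields closedness.\<close>
  define B where "B x = (\<chi> i l. pd l (\<theta> i) x - pd i (\<theta> l) x)" for x
  have smB: "smooth_on ?S (\<lambda>x. B x $ i $ l)" for i l
    unfolding B_def by (simp add: smooth_on_diff smooth_on_pd \<theta>(1))
  have skewB: "transpose (B x) = - B x" for x by (simp add: B_def vec_eq_iff transpose_def)
  have B0: "B 0 = 0" by (simp add: B_def vec_eq_iff \<theta>(2))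
  have d\<theta>: "pd l (\<theta> i) differentiable (at x)" if "x \<in> ?S" for l i x
    by (rule smooth_on_differentiable[OF smooth_on_pd[OF \<theta>(1)] that])
  have pdB: "pd k (\<lambda>x. B x $ i $ l) x = pd k (pd l (\<theta> i)) x - pd k (pd i (\<theta> l)) x" if "x \<in> ?S" for k i l x
    using pd_diff[OF d\<theta>[OF that] d\<theta>[OF that], of k l i i l] by (simp add: B_def)
  have closed: "pd i (\<lambda>y. B y $ j $ k) x + pd j (\<lambda>y. B y $ k $ i) x + pd k (\<lambda>y. B y $ i $ j) x = 0"
    if x: "x \<in> ?S" for x i j k
    unfolding pdB[OF x]
    using pd_commute[OF open_ball \<theta>(1) x, of i k j] pd_commute[OF open_ball \<theta>(1) x, of i j k]
      pd_commute[OF open_ball \<theta>(1) x, of j k i] by simp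
  \<comment> \<open>Differentiating E \<theta>_i = \<theta>_i + w_i removes the zeroth-order term,
    and antisymmetrising removes the second derivatives of h. What remains says that E B is the
    pull-back of d\<xi>.\<close>
  have eulB: "euler (\<lambda>x. B x $ k $ i) x = (\<Sum>m\<in>UNIV. pd i h x $ m *\<^sub>R formpart (pd m b (h x))) \<bullet> pd k h x
      - (\<Sum>m\<in>UNIV. pd k h x $ m *\<^sub>R formpart (pd m b (h x))) \<bullet> pd i h x" if x: "x \<in> ?S" for k i x
  proof -
    have e: "euler (pd l (\<theta> i)) x = pd l (w i) x" for l i
      using euler_pd[OF open_ball \<theta>(1) x, of i "-1" "w i" l] \<theta>(3) by simp
    have "euler (\<lambda>x. B x $ k $ i) x = pd i (w k) x - pd k (w i) x"
      using euler_diff[OF d\<theta>[OF x] d\<theta>[OF x], of i k k i] by (simp add: B_def e)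
    then show ?thesis by (simp add: pdw[OF x] pd_commute_vec[OF open_ball smh x, of i k])
  qed
  define \<Phi> where "\<Phi> x = gen_iso (jac h x) (B x)" for x
  have sm\<Phi>: "smooth_on ?S (\<lambda>x. \<Phi> x $ i $ j)" for i j
    unfolding \<Phi>_def by (rule smooth_on_gen_iso[OF open_ball smooth_on_jac[OF open_ball smh] smB inv])
  have sm\<Phi>v: "smooth_on ?S (\<lambda>x. \<Phi> x *v v)" for v
    by (rule smooth_on_matrix_vector[OF open_ball sm\<Phi> smooth_on_const])
  have d\<Phi>v: "(\<lambda>x. \<Phi> x *v v) differentiable (at x)" if "x \<in> ?S" for x v
    by (rule smooth_on_differentiable[OF sm\<Phi>v that])
  have eul\<Phi>: "euler (\<lambda>x. \<Phi> x *v v) x = gen_ad (\<lambda>l. pd l b (h x)) (\<Phi> x *v v)" if x: "x \<in> ?S" for x v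
  proof -
    let ?p = "\<lambda>x. \<Phi> x *v v" and ?D = "\<lambda>m. pd m b (h x)"
    have pa: "anchor (?p y) = (\<Sum>k\<in>UNIV. anchor v $ k *\<^sub>R pd k h y)" for y
      by (simp add: \<Phi>_def anchor_gen_iso jac_mult)
    have pf: "pd k h y \<bullet> formpart (?p y) = formpart v $ k + (B y *v anchor v) $ k" if "y \<in> ?S" for y k
      using arg_cong[OF formpart_gen_iso[OF inv[OF that], of "B y" v], of "\<lambda>u. u $ k"]
      unfolding \<Phi>_def[symmetric] transpose_jac_mult vector_add_component .
    have anc: "anchor (euler ?p x) = anchor (gen_ad ?D (?p x))"
    proof -
      have "anchor (euler ?p x) = euler (\<lambda>x. anchor (?p x)) x"
        by (rule euler_linear[OF bounded_linear_anchor d\<Phi>v[OF x], symmetric])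
      also have "\<dots> = (\<Sum>k\<in>UNIV. euler (\<lambda>y. anchor v $ k *\<^sub>R pd k h y) x)"
        unfolding pa by (rule euler_sum) (intro differentiable_scaleR differentiable_const dD[OF x])
      also have "\<dots> = (\<Sum>k\<in>UNIV. anchor v $ k *\<^sub>R euler (pd k h) x)"
        by (intro sum.cong refl euler_linear[OF bounded_linear_scaleR_right] dD[OF x])
      also have "\<dots> = (\<Sum>k\<in>UNIV. \<Sum>m\<in>UNIV. (anchor v $ k * pd k h x $ m) *\<^sub>R anchor (?D m))"
        by (simp add: eulD[OF x] scaleR_sum_right)
      also have "\<dots> = (\<Sum>m\<in>UNIV. anchor (?p x) $ m *\<^sub>R anchor (?D m))"
        unfolding pa by (subst sum.swap) (simp add: scaleR_sum_left)
      finally show ?thesis by (simp add: gen_ad_def dir_sum_def scalar_mult_eq_scaleR)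
    qed
    \<comment> \<open>Covectors are tested on the columns of the invertible Jacobian: there the form
      part of \<Phi> v is the fixed component of v plus B applied to its vector part, which has a
      known Euler derivative.\<close>
    have "pd k h x \<bullet> formpart (euler ?p x) = pd k h x \<bullet> formpart (gen_ad ?D (?p x))" for k
    proof -
      have dB: "(\<lambda>y. B y $ k $ i * anchor v $ i) differentiable (at x)" "(\<lambda>y. B y $ k $ i) differentiable (at x)" for i
        by (intro differentiable_mult differentiable_const smooth_on_differentiable[OF smB x])+
      have "euler (\<lambda>y. pd k h y \<bullet> formpart (?p y)) x = euler (\<lambda>y. \<Sum>i\<in>UNIV. B y $ k $ i * anchor v $ i) x"
      proof -
        have "euler (\<lambda>y. pd k h y \<bullet> formpart (?p y)) x = euler (\<lambda>y. (\<Sum>i\<in>UNIV. B y $ k $ i * anchor v $ i) - (- formpart v $ k)) x"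
        proof (rule euler_cong[OF open_ball x])
          fix y assume "y \<in> ?S"
          moreover have "(B y *v anchor v) $ k = (\<Sum>i\<in>UNIV. B y $ k $ i * anchor v $ i)"
            by (simp add: matrix_vector_mult_def)
          ultimately show "pd k h y \<bullet> formpart (?p y) = (\<Sum>i\<in>UNIV. B y $ k $ i * anchor v $ i) - (- formpart v $ k)"
            using pf by simp
        qed
        also have "\<dots> = euler (\<lambda>y. \<Sum>i\<in>UNIV. B y $ k $ i * anchor v $ i) x - euler (\<lambda>y. - formpart v $ k) x"
          by (intro euler_diff differentiable_sum finite ballI dB differentiable_const)
        finally show ?thesis by (simp add: euler_def)
      qed
      also have "\<dots> = (\<Sum>i\<in>UNIV. euler (\<lambda>y. B y $ k $ i) x * anchor v $ i)"
        by (subst euler_sum) (simp_all add: dB euler_linear[OF bounded_linear_mult_left dB(2)])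
      also have "\<dots> = (\<Sum>i\<in>UNIV. anchor v $ i * euler (\<lambda>y. B y $ k $ i) x)"
        by (simp only: mult.commute)
      also have "\<dots> = (\<Sum>m\<in>UNIV. anchor (?p x) $ m *\<^sub>R formpart (?D m)) \<bullet> pd k h x
         - (\<Sum>m\<in>UNIV. pd k h x $ m *\<^sub>R formpart (?D m)) \<bullet> anchor (?p x)"
      proof -
        have "(\<Sum>i\<in>UNIV. anchor v $ i *\<^sub>R (\<Sum>m\<in>UNIV. pd i h x $ m *\<^sub>R formpart (?D m)))
          = (\<Sum>m\<in>UNIV. anchor (?p x) $ m *\<^sub>R formpart (?D m))"
          unfolding pa scaleR_sum_right by (subst sum.swap) (simp add: scaleR_sum_left)
        moreover have "(\<Sum>i\<in>UNIV. anchor v $ i * ((\<Sum>m\<in>UNIV. pd i h x $ m *\<^sub>R formpart (?D m)) \<bullet> pd k h x))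
           = (\<Sum>i\<in>UNIV. anchor v $ i *\<^sub>R (\<Sum>m\<in>UNIV. pd i h x $ m *\<^sub>R formpart (?D m))) \<bullet> pd k h x"
          by (simp add: inner_sum_left)
        moreover have "(\<Sum>i\<in>UNIV. anchor v $ i * ((\<Sum>m\<in>UNIV. pd k h x $ m *\<^sub>R formpart (?D m)) \<bullet> pd i h x))
           = (\<Sum>m\<in>UNIV. pd k h x $ m *\<^sub>R formpart (?D m)) \<bullet> anchor (?p x)"
          unfolding pa by (simp add: inner_sum_right)
        ultimately show ?thesis
          unfolding eulB[OF x] right_diff_distrib sum_subtractf by simp
      qed
      finally have L: "euler (\<lambda>y. pd k h y \<bullet> formpart (?p y)) x = (\<Sum>m\<in>UNIV. anchor (?p x) $ m *\<^sub>R formpart (?D m)) \<bullet> pd k h x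
         - (\<Sum>m\<in>UNIV. pd k h x $ m *\<^sub>R formpart (?D m)) \<bullet> anchor (?p x)" .
      have df: "(\<lambda>y. formpart (?p y)) differentiable (at x)" by (rule differentiable_linear[OF bounded_linear_formpart d\<Phi>v[OF x]])
      have "euler (\<lambda>y. pd k h y \<bullet> formpart (?p y)) x = pd k h x \<bullet> formpart (euler ?p x) + euler (pd k h) x \<bullet> formpart (?p x)"
        unfolding euler_inner[OF dD[OF x] df] euler_linear[OF bounded_linear_formpart d\<Phi>v[OF x]] ..
      moreover have "pd k h x \<bullet> formpart (gen_ad ?D (?p x)) = pd k h x \<bullet> (\<Sum>m\<in>UNIV. anchor (?p x) $ m *\<^sub>R formpart (?D m))
          - (\<Sum>m\<in>UNIV. pd k h x $ m *\<^sub>R formpart (?D m)) \<bullet> anchor (?p x) - euler (pd k h) x \<bullet> formpart (?p x)"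
      proof -
        have "pd k h x \<bullet> (\<chi> i. 2 * pairing (?D i) (?p x))
          = (\<Sum>m\<in>UNIV. pd k h x $ m * (formpart (?D m) \<bullet> anchor (?p x) + formpart (?p x) \<bullet> anchor (?D m)))"
        proof -
          have "2 * pairing (?D i) (?p x) = formpart (?D i) \<bullet> anchor (?p x) + formpart (?p x) \<bullet> anchor (?D i)" for i
            by (simp add: pairing_real)
          then show ?thesis by (simp add: inner_vec_def[of "pd k h x"])
        qed
        also have "\<dots> = (\<Sum>m\<in>UNIV. pd k h x $ m *\<^sub>R formpart (?D m)) \<bullet> anchor (?p x) + euler (pd k h) x \<bullet> formpart (?p x)"
          unfolding eulD[OF x] by (simp add: inner_sum_left distrib_left sum.distrib inner_commute[of "formpart (?p x)"])
        finally show ?thesis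
          by (simp add: gen_ad_def dir_sum_def scalar_mult_eq_scaleR inner_diff_right del: formpart_nth)
      qed
      ultimately show ?thesis using L by (simp add: inner_commute[of "pd k h x"])
    qed
    then have form: "transpose (jac h x) *v formpart (euler ?p x) = transpose (jac h x) *v formpart (gen_ad ?D (?p x))"
      unfolding vec_eq_iff transpose_jac_mult by blast
    show ?thesis by (rule gen_eqI[OF anc transpose_mult_eqD[OF inv[OF x] form]])
  qed
  have orth: "pairing (\<Phi> x *v u) (\<Phi> x *v v) = pairing u v" if "x \<in> ?S" for x u v
    unfolding \<Phi>_def by (rule pairing_gen_iso[OF inv[OF that] skewB])
  have \<Phi>0: "\<Phi> 0 *v u = u" for u
  proof (rule gen_eqI)
    have j: "jac h 0 = mat 1" by (simp add: jac_def h0 vec_eq_iff mat_def axis_def)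
    show "anchor (\<Phi> 0 *v u) = anchor u" by (simp add: \<Phi>_def anchor_gen_iso j)
    show "formpart (\<Phi> 0 *v u) = formpart u"
      using formpart_gen_iso[OF inv[OF zero], of "B 0" u] by (simp add: \<Phi>_def j B0 transpose_mat)
  qed
  have dJ: "J differentiable (at y)" if "y \<in> ?T" for y by (rule smooth_on_differentiable[OF J(1) that])
  have smJc: "smooth_on ?T (\<lambda>y. J y $ i $ j)" for i j
    using smooth_on_linear[OF open_ball bounded_linear_coord smooth_on_linear[OF open_ball bounded_linear_coord J(1)]] .
  have inter: "J (h x) *v (\<Phi> x *v v) = \<Phi> x *v (J 0 *v v)" if x: "x \<in> ?S" for x v
  proof -
    have Fconst: "pairing (\<Phi> x *v u) (J (h x) *v (\<Phi> x *v v)) = pairing u (J 0 *v v)" for u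
    proof -
      let ?p = "\<lambda>x. \<Phi> x *v u" and ?q = "\<lambda>x. \<Phi> x *v v"
      define F where "F y = pairing (?p y) (J (h y) *v ?q y)" for y
      have smq: "smooth_on ?S (\<lambda>y. J (h y) *v ?q y)"
        by (rule smooth_on_matrix_vector[OF open_ball smooth_on_compose[OF open_ball open_ball hT smJc smh] sm\<Phi>v])
      have smF: "smooth_on ?S F"
        unfolding F_def pairing_sum
        by (intro smooth_on_mult smooth_on_const smooth_on_sum smooth_on_add open_ball
            smooth_on_linear[OF open_ball bounded_linear_coord sm\<Phi>v] smooth_on_linear[OF open_ball bounded_linear_coord smq])
      \<comment> \<open>Both arguments of the pairing are moved by the same skew operator, so E F =
        0. Written as a bound with factor 0, this lets \<open>euler_bound_0\<close> identify F with
        its value at the centre, where \<Phi> is the identity.\<close>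
      have "\<bar>euler F y\<bar> \<le> 0 * norm y" if y: "y \<in> ?S" for y
      proof -
        let ?ad = "gen_ad (\<lambda>l. pd l b (h y))"
        have dJh: "(\<lambda>y. J (h y)) differentiable (at y)" by (rule differentiable_chain[OF dh[OF y] dJ[OF hxT[OF y]]])
        have "pd l (\<lambda>y. J (h y)) y = (\<Sum>j\<in>UNIV. pd l h y $ j *\<^sub>R pd j J (h y))" for l
          by (rule pd_chain[OF dh[OF y] dJ[OF hxT[OF y]]])
        then have "euler (\<lambda>y. J (h y)) y = (\<Sum>l\<in>UNIV. \<Sum>j\<in>UNIV. (y $ l * pd l h y $ j) *\<^sub>R pd j J (h y))"
          by (simp add: euler_def scaleR_sum_right)
        also have "\<dots> = (\<Sum>j\<in>UNIV. euler h y $ j *\<^sub>R pd j J (h y))"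
          by (subst sum.swap) (simp add: euler_def scaleR_sum_left)
        \<comment> \<open>The chain rule contracts DJ with E h. The equation of the flow turns this
          into the vector y + X y at the image point, exactly the direction that occurs in
          \<open>inf\<close>.\<close>
        finally have "euler (\<lambda>y. J (h y)) y *v ?q y = (\<Sum>j\<in>UNIV. (h y $ j + b (h y) $ Inl j) *\<^sub>R (pd j J (h y) *v ?q y))"
          by (simp add: matrix_sum_left heul[OF y] scaleR_matrix_vector_assoc)
        then have "euler (\<lambda>y. J (h y) *v ?q y) y = ?ad (J (h y) *v ?q y)"
          by (simp add: euler_matrix_vector[OF dJh d\<Phi>v[OF y]] inf[OF hxT[OF y]] eul\<Phi>[OF y])
        then have "euler F y = pairing (?ad (?p y)) (J (h y) *v ?q y) + pairing (?p y) (?ad (J (h y) *v ?q y))"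
          unfolding F_def by (simp add: euler_pairing[OF d\<Phi>v[OF y] smooth_on_differentiable[OF smq y]] eul\<Phi>[OF y])
        then show ?thesis by (simp add: gen_ad_skew)
      qed
      from euler_bound_0[OF smF this x] have "F x = F 0" by simp
      then show ?thesis by (simp add: F_def \<Phi>0 h0)
    qed
    \<comment> \<open>As \<Phi> x is onto, testing against its image suffices.\<close>
    have "pairing (J (h x) *v (\<Phi> x *v v) - \<Phi> x *v (J 0 *v v)) z = 0" for z
    proof -
      have "invertible (\<Phi> x)"
      proof -
        have "y = 0" if "\<Phi> x *v y = 0" for y
          by (rule pairing_nondegenerate) (use orth[OF x, of y] that in simp)
        then show ?thesis unfolding invertible_left_inverse using matrix_left_invertible_ker by blast
      qed
      then have "\<Phi> x *v (matrix_inv (\<Phi> x) *v z) = z" by (simp add: matrix_vector_mul_assoc matrix_inv_cancel)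
      then obtain u where "z = \<Phi> x *v u" by metis
      then show ?thesis
        using Fconst[of u] orth[OF x, of u "J 0 *v v"]
        by (simp add: pairing_diff pairing_commute[of _ "\<Phi> x *v u"])
    qed
    then have "J (h x) *v (\<Phi> x *v v) - \<Phi> x *v (J 0 *v v) = 0" by (rule pairing_nondegenerate)
    then show ?thesis by simp
  qed
  have injh: "inj_on h ?S"
  proof (rule inj_onI)
    fix x y assume xy: "x \<in> ?S" "y \<in> ?S" "h x = h y"
    have "norm (h x - h y - (x - y)) \<le> 1/2 * norm (x - y)"
      by (rule near_identity_lipschitz[OF convex_ball dh hnear xy(1,2)])
    then show "x = y" using xy(3) by (simp add: norm_minus_commute)
  qed
  have "open (h ` ?S)" by (rule smooth_inverse(1)[OF open_ball smh injh inv])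
  moreover have "0 \<in> h ` ?S" using zero h0(1) by force
  ultimately obtain \<rho>' where \<rho>': "0 < \<rho>'" "ball 0 \<rho>' \<subseteq> h ` ?S" by (rule openE)
  \<comment> \<open>The image of h contains a ball; the cap 1 keeps that ball inside the domain of
    J.\<close>
  define \<rho> where "\<rho> = min \<rho>' 1"
  have \<rho>: "0 < \<rho>" "ball 0 \<rho> \<subseteq> h ` ?S" "ball 0 \<rho> \<subseteq> ?T" using \<rho>' by (auto simp: \<rho>_def)
  \<comment> \<open>J has to be considered on a ball, whereas the constant structure may live on any
    open set; hence V is taken as the preimage of the ball.\<close>
  define V where "V = ?S \<inter> h -` ball 0 \<rho>"
  have V: "open V" "V \<subseteq> ?S" "h ` V = ball 0 \<rho>"
  proof -
    show "open V" unfolding V_def by (rule continuous_open_preimage[OF smooth_on_continuous[OF smh] open_ball open_ball])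
    show "V \<subseteq> ?S" by (auto simp: V_def)
    show "h ` V = ball 0 \<rho>" using \<rho>(2) unfolding V_def by blast
  qed
  have iso: "courant_iso V (h ` V) h \<Phi>"
    unfolding \<Phi>_def
  proof (rule courant_iso_push_shift[OF V(1) smooth_on_subset[OF smh V(2)] inj_on_subset[OF injh V(2)]])
    show "smooth_on V (\<lambda>x. B x $ i $ j)" for i j by (rule smooth_on_subset[OF smB V(2)])
  qed (use V(2) inv skewB closed in blast)+
  have "matrix_inv (\<Phi> x) ** J (h x) ** \<Phi> x = J 0" if x: "x \<in> V" for x
  proof -
    have i: "invertible (\<Phi> x)" using iso x unfolding courant_iso_def by blast
    have xS: "x \<in> ?S" using x V(2) by blast
    have "(matrix_inv (\<Phi> x) ** J (h x) ** \<Phi> x) *v v = J 0 *v v" for v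
    proof -
      have "(matrix_inv (\<Phi> x) ** J (h x) ** \<Phi> x) *v v = matrix_inv (\<Phi> x) *v (J (h x) *v (\<Phi> x *v v))"
        by (simp add: matrix_vector_mul_assoc matrix_mul_assoc)
      also have "\<dots> = (matrix_inv (\<Phi> x) ** \<Phi> x) *v (J 0 *v v)"
        unfolding inter[OF xS] by (simp only: matrix_vector_mul_assoc matrix_mul_assoc)
      finally show ?thesis by (simp add: matrix_inv_cancel[OF i])
    qed
    then show ?thesis by (simp add: matrix_eq)
  qed
  then have "gc_isomorphic (ball 0 \<rho>) J V (\<lambda>x. J 0)"
    unfolding gc_isomorphic_def using iso V(3) by auto
  moreover have "gc_structure_on V (\<lambda>x. J 0)" by (rule gc_structure_constant[OF J(2,3) V(1)])
  moreover have "constant_on_set V (\<lambda>x. J 0)" by (auto simp: constant_on_set_def)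
  ultimately show ?thesis
    unfolding isomorphic_to_constant_near_0_def using \<rho>(1,3) V(1) by blast
qed

section \<open>The real section of a primitive\<close>

definition cvec :: "real^'k::finite \<Rightarrow> complex^'k" where
  "cvec u = (\<chi> a. complex_of_real (u $ a))"

lemma cvec_nth [simp]: "cvec u $ a = complex_of_real (u $ a)"
  by (simp add: cvec_def)

lemma cvec_simps: "cvec (u + v) = cvec u + cvec v" "cvec (u - v) = cvec u - cvec v" "cvec (- u) = - cvec u"
  "cvec (c *\<^sub>R u) = c *\<^sub>R cvec u" "cvec 0 = 0"
  by (simp_all add: vec_eq_iff complex_eq_iff)

lemma bounded_linear_cvec: "bounded_linear (cvec :: real^'k::finite \<Rightarrow> complex^'k)"
proof -
  have "linear (cvec :: real^'k \<Rightarrow> complex^'k)"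
    by (rule linearI) (simp_all add: cvec_simps)
  then show ?thesis by (simp add: linear_conv_bounded_linear)
qed

lemma cmat_cvec: "cmat A *v cvec u = cvec (A *v u)"
  by (simp add: cmat_def map_matrix_def vec_eq_iff matrix_vector_mult_def)

lemma pairing_cvec: "pairing (cvec u) (cvec v) = complex_of_real (pairing u v)"
  by (simp add: pairing_sum)

lemma dir_sum_cvec: "dir_sum (cvec s) (\<lambda>l. cvec (dr l)) = cvec (dir_sum s dr)"
  by (simp add: dir_sum_def vec_eq_iff)

lemma mk_gen_cvec: "mk_gen 0 (\<chi> i. complex_of_real (f i)) = cvec (mk_gen 0 (\<chi> i. f i))"
  by (rule gen_eqI) (simp_all add: vec_eq_iff)

lemma gen_ad_cvec: "gen_ad (\<lambda>l. cvec (db l)) (cvec w) = cvec (gen_ad db w)"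
proof -
  have "(mk_gen 0 (\<chi> i. 2 * pairing (cvec (db i)) (cvec w))) = cvec (mk_gen 0 (\<chi> i. 2 * pairing (db i) w))"
    using mk_gen_cvec[of "\<lambda>i. 2 * pairing (db i) w"] by (simp add: pairing_cvec)
  then show ?thesis by (simp add: gen_ad_def cvec_simps(2) dir_sum_cvec)
qed

lemma jet_bracket_cvec: "jet_bracket (cvec s) (\<lambda>l. cvec (ds l)) (cvec r) (\<lambda>l. cvec (dr l)) = cvec (jet_bracket s ds r dr)"
proof -
  have "(mk_gen 0 (\<chi> i. pairing (cvec (ds i)) (cvec r) - pairing (cvec s) (cvec (dr i))))
    = cvec (mk_gen 0 (\<chi> i. pairing (ds i) r - pairing s (dr i)))"
    using mk_gen_cvec[of "\<lambda>i. pairing (ds i) r - pairing s (dr i)"] by (simp add: pairing_cvec)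
  then show ?thesis by (simp add: jet_bracket_def cvec_simps(1,2) dir_sum_cvec)
qed

text \<open>Linearity is stated for differences with a scalar because, for the scalar i, this is the
  shape of \<open>eig\<close> and of its derivatives.\<close>

lemma dir_sum_linear:
  "dir_sum (s - c *s s') d = dir_sum s d - c *s dir_sum s' d"
  "dir_sum s (\<lambda>l. d l - c *s d' l) = dir_sum s d - c *s dir_sum s d'"
  by (simp_all add: dir_sum_def vec_eq_iff sum_subtractf sum_distrib_left algebra_simps)

lemma gen_ad_linear: "gen_ad db (u - c *s v) = gen_ad db u - c *s gen_ad db v"
proof -
  have "(mk_gen 0 (\<chi> i. 2 * pairing (db i) (u - c *s v)))
    = mk_gen 0 (\<chi> i. 2 * pairing (db i) u) - c *s mk_gen 0 (\<chi> i. 2 * pairing (db i) v)"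
    by (simp add: vec_eq_iff mk_gen_def pairing_diff pairing_scale algebra_simps split: sum.split)
  then show ?thesis by (simp add: gen_ad_def dir_sum_linear vec_eq_iff algebra_simps)
qed

lemma jet_bracket_linear:
  "jet_bracket (s - c *s s') (\<lambda>l. ds l - c *s ds' l) r dr = jet_bracket s ds r dr - c *s jet_bracket s' ds' r dr"
  "jet_bracket s ds (r - c *s r') (\<lambda>l. dr l - c *s dr' l) = jet_bracket s ds r dr - c *s jet_bracket s ds r' dr'"
proof -
  have "(mk_gen 0 (\<chi> i. pairing (ds i - c *s ds' i) r - pairing (s - c *s s') (dr i)))
    = mk_gen 0 (\<chi> i. pairing (ds i) r - pairing s (dr i)) - c *s mk_gen 0 (\<chi> i. pairing (ds' i) r - pairing s' (dr i))"
    by (simp add: vec_eq_iff mk_gen_def pairing_diff pairing_scale algebra_simps split: sum.split)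
  then show "jet_bracket (s - c *s s') (\<lambda>l. ds l - c *s ds' l) r dr = jet_bracket s ds r dr - c *s jet_bracket s' ds' r dr"
    by (simp add: jet_bracket_def dir_sum_linear vec_eq_iff algebra_simps)
  have "(mk_gen 0 (\<chi> i. pairing (ds i) (r - c *s r') - pairing s (dr i - c *s dr' i)))
    = mk_gen 0 (\<chi> i. pairing (ds i) r - pairing s (dr i)) - c *s mk_gen 0 (\<chi> i. pairing (ds i) r' - pairing s (dr' i))"
    by (simp add: vec_eq_iff mk_gen_def pairing_diff pairing_scale algebra_simps split: sum.split)
  then show "jet_bracket s ds (r - c *s r') (\<lambda>l. dr l - c *s dr' l) = jet_bracket s ds r dr - c *s jet_bracket s ds r' dr'"
    by (simp add: jet_bracket_def dir_sum_linear vec_eq_iff algebra_simps)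
qed

lemma pairing_scaleR: "pairing (c *\<^sub>R u) v = c * pairing u v"
  for u v :: "real^('n::finite + 'n)"
  by (simp add: scalar_mult_eq_scaleR[symmetric] pairing_scale)

lemma pairing_dir_sum_right: "pairing v (dir_sum w db) = (\<Sum>l\<in>UNIV. w $ Inl l * pairing v (db l))"
  by (simp add: dir_sum_def pairing_sum_right pairing_scale)

text \<open>The projection \<open>u \<mapsto> u - iJu\<close> onto the \<open>+i\<close>-eigenspace, without the factor \<open>1/2\<close>.\<close>

definition eig :: "real^'k^'k \<Rightarrow> real^'k::finite \<Rightarrow> complex^'k" where
  "eig A u = cvec u - \<i> *s cvec (A *v u)"

lemma eig_add: "eig A (u + v) = eig A u + eig A v"
  by (simp add: eig_def cvec_simps matrix_vector_right_distrib vec_eq_iff algebra_simps)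

lemma eig_scale: "eig A (c *\<^sub>R u) = complex_of_real c *s eig A u"
  by (simp add: eig_def vec_eq_iff matrix_vector_mult_scaleR algebra_simps)

lemma eig_mult:
  assumes "A ** A = - mat 1"
  shows "eig A (A *v u) = \<i> *s eig A u"
proof -
  have "A *v (A *v u) = - u" using assms by (simp add: matrix_vector_mul_assoc matrix_vector_mult_uminus)
  then show ?thesis by (simp add: eig_def vec_eq_iff algebra_simps)
qed

lemma cmat_eig: "cmat A *v eig A u = eig A (A *v u)"
proof -
  have "cmat A *v (v - c *s w) = cmat A *v v - c *s (cmat A *v w)" for v w and c :: complex
    by (simp add: vec_eq_iff matrix_vector_mult_def sum_subtractf sum_distrib_left algebra_simps)
  then show ?thesis by (simp add: eig_def cmat_cvec)
qed

lemma eig_in_Lfib: "A ** A = - mat 1 \<Longrightarrow> eig A u \<in> Lfib A"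
  by (simp add: Lfib_def cmat_eig eig_mult)

text \<open>For a real matrix the eigenvalue equation makes the imaginary part of v equal to -A
  applied to its real part.\<close>

lemma Lfib_eig:
  assumes "v \<in> Lfib A"
  shows "v = eig A (\<chi> a. Re (v $ a))"
proof -
  have "Re ((cmat A *v v) $ a) = (A *v (\<chi> a. Re (v $ a))) $ a" for a
    by (simp add: matrix_vector_mult_def cmat_def map_matrix_def)
  moreover have "Re ((cmat A *v v) $ a) = - Im (v $ a)" for a using assms by (simp add: Lfib_def)
  ultimately have "(A *v (\<chi> a. Re (v $ a))) $ a = - Im (v $ a)" for a by simp
  then show ?thesis by (simp add: eig_def vec_eq_iff complex_eq_iff)
qed

lemma covector_eig:
  assumes "covector_on (Lfib A) \<beta>" "A ** A = - mat 1"
  shows "\<beta> (eig A u) = (\<Sum>a\<in>UNIV. complex_of_real (u $ a) * \<beta> (eig A (axis a 1)))"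
proof -
  have L: "eig A u \<in> Lfib A" for u by (rule eig_in_Lfib[OF assms(2)])
  have add: "\<beta> (eig A (u + v)) = \<beta> (eig A u) + \<beta> (eig A v)" for u v
    unfolding eig_add using assms(1) L by (simp add: covector_on_def)
  have sc: "\<beta> (eig A (c *\<^sub>R u)) = complex_of_real c * \<beta> (eig A u)" for c u
    unfolding eig_scale using assms(1) L by (simp add: covector_on_def)
  have "\<beta> (eig A (\<Sum>a\<in>I. u $ a *\<^sub>R axis a 1)) = (\<Sum>a\<in>I. complex_of_real (u $ a) * \<beta> (eig A (axis a 1)))" for I
  proof (induction I rule: infinite_finite_induct)
    case (infinite I)
    then show ?case using sc[of 0 0] by simp
  next
    case empty
    then show ?case using sc[of 0 0] by simp
  next
    case (insert a I)
    then show ?case by (simp add: add sc)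
  qed
  from this[of UNIV] show ?thesis using basis_expansion[of u] by (simp add: scalar_mult_eq_scaleR)
qed

primrec swap_sum :: "'a + 'b \<Rightarrow> 'b + 'a" where
  "swap_sum (Inl i) = Inr i"
| "swap_sum (Inr i) = Inl i"

lemma pairing_axis_swap: "pairing u (axis a 1) = 1/2 * u $ swap_sum a"
  by (cases a) (simp_all add: pairing_axis)

lemma pairing_expand: "pairing u v = (\<Sum>a\<in>UNIV. v $ a * pairing u (axis a 1))"
  for u v :: "real^('n::finite + 'n)"
proof -
  have "pairing u v = pairing u (\<Sum>a\<in>UNIV. v $ a *s axis a 1)" by (simp add: basis_expansion)
  then show ?thesis by (simp only: pairing_sum_right pairing_scale)
qed

lemma smooth_on_eig:
  assumes "open S" "smooth_on S J" "smooth_on S s"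
  shows "smooth_on S (\<lambda>x. eig (J x) (s x))"
proof -
  have c: "smooth_on S (\<lambda>x. J x $ i $ j)" for i j
    using smooth_on_linear[OF assms(1) bounded_linear_coord smooth_on_linear[OF assms(1) bounded_linear_coord assms(2)]] .
  have "bounded_linear (\<lambda>v::complex^'b. \<i> *s v)"
  proof -
    have "linear (\<lambda>v::complex^'b. \<i> *s v)" by (rule linearI) (simp_all add: vec_eq_iff algebra_simps)
    then show ?thesis by (simp add: linear_conv_bounded_linear)
  qed
  then show ?thesis
    unfolding eig_def
    using smooth_on_linear[OF assms(1) _ smooth_on_linear[OF assms(1) bounded_linear_cvec smooth_on_matrix_vector[OF assms(1) c assms(3)]]]
    by (intro smooth_on_diff assms(1) smooth_on_linear[OF assms(1) bounded_linear_cvec assms(3)]) blast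
qed

lemma pd_eig:
  fixes J :: "real^'n::finite \<Rightarrow> real^'k::finite^'k"
  assumes "J differentiable (at x)" "s differentiable (at x)"
  shows "pd l (\<lambda>y. eig (J y) (s y)) x = cvec (pd l s x) - \<i> *s cvec (pd l (\<lambda>y. J y *v s y) x)"
proof -
  have "linear (\<lambda>v::complex^'k. \<i> *s v)" by (rule linearI) (simp_all add: vec_eq_iff algebra_simps)
  then have bl: "bounded_linear (\<lambda>v::complex^'k. \<i> *s v)" by (simp add: linear_conv_bounded_linear)
  have "(\<lambda>y. J y $ i) differentiable (at x)" for i by (rule differentiable_linear[OF bounded_linear_coord assms(1)])
  then have dc: "(\<lambda>y. J y $ i $ j) differentiable (at x)" for i j
    by (rule differentiable_linear[OF bounded_linear_coord])
  note dJ = pd_matrix_vector(2)[OF dc assms(2)]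
  note d1 = differentiable_linear[OF bounded_linear_cvec dJ] and d0 = differentiable_linear[OF bounded_linear_cvec assms(2)]
  show ?thesis
    unfolding eig_def
    by (simp add: pd_diff[OF d0 differentiable_linear[OF bl d1]] pd_linear[OF bl d1] pd_linear[OF bounded_linear_cvec dJ]
        pd_linear[OF bounded_linear_cvec assms(2)])
qed

text \<open>At t = 1 the derivative is one-sided; the ray rule holds within any set of times and
  therefore covers this endpoint.\<close>

lemma Jdot1_euler:
  fixes J :: "real^'n::finite \<Rightarrow> real ^ ('n + 'n) ^ ('n + 'n)"
  assumes "J differentiable (at x)"
  shows "Jdot1 J x = euler J x"
proof -
  have d: "((\<lambda>t. J (t *\<^sub>R x)) has_vector_derivative (\<Sum>l\<in>UNIV. x $ l *\<^sub>R pd l J (1 *\<^sub>R x))) (at 1 within cbox 0 1)"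
    by (rule ray_derivative) (simp add: assms)
  show ?thesis
    using vector_derivative_within_cbox[OF _ _ d] by (simp add: Jdot1_def Jt_def euler_def)
qed

text \<open>The real section \<open>b\<close> with \<open>\<langle>b, \<cdot>\<rangle> = (i/2) \<beta>\<close> on \<open>L\<close>. Twisting by \<open>i\<close> is what makes the
  infinitesimal action of \<open>b\<close> on \<open>J\<close> equal to \<open>-\<close> the Euler derivative of \<open>J\<close>, since \<open>\<beta>\<close>
  itself yields the product of that derivative with \<open>J\<close>.\<close>

definition dual_section :: "(real^'n::finite \<Rightarrow> real ^ ('n + 'n) ^ ('n + 'n)) \<Rightarrow>
    (real^'n \<Rightarrow> complex ^ ('n + 'n) \<Rightarrow> complex) \<Rightarrow> real^'n \<Rightarrow> real ^ ('n + 'n)" where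
  "dual_section J \<beta> x = (\<chi> a. - Im (\<beta> x (eig (J x) (axis (swap_sum a) 1))))"

text \<open>The definition of b prescribes the imaginary part of \<beta> on \<open>eig\<close> of a
  real vector u. Replacing u by Ju multiplies \<open>eig\<close> by i, which supplies the real
  part.\<close>

lemma pairing_dual_section:
  fixes J :: "real^'n::finite \<Rightarrow> real ^ ('n + 'n) ^ ('n + 'n)"
  assumes "covector_on (Lfib (J x)) (\<beta> x)" "J x ** J x = - mat 1" "v \<in> Lfib (J x)"
  shows "\<beta> x v = - 2 * \<i> * pairing (cvec (dual_section J \<beta> x)) v"
proof -
  let ?b = "dual_section J \<beta> x" and ?A = "J x"
  have sw: "swap_sum (swap_sum a) = a" for a :: "'n + 'n" by (cases a) simp_all
  \<comment> \<open>Pairing with a basis vector returns half of the opposite coordinate; this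
    accounts for the factor 2 and for \<open>swap_sum\<close>.\<close>
  have real: "2 * pairing ?b u = - Im (\<beta> x (eig ?A u))" for u
    unfolding covector_eig[OF assms(1,2), of u] pairing_expand[of ?b u] pairing_axis_swap
    by (simp add: dual_section_def sw sum_distrib_left sum_negf[symmetric] Im_sum)
  obtain u where u: "v = eig ?A u" using Lfib_eig[OF assms(3)] by blast
  have "\<beta> x (eig ?A (?A *v u)) = \<i> * \<beta> x v"
    using assms(1,3) by (simp add: eig_mult[OF assms(2)] u[symmetric] covector_on_def)
  then have "2 * pairing ?b (?A *v u) = - Re (\<beta> x v)" using real[of "?A *v u"] by simp
  moreover have "2 * pairing ?b u = - Im (\<beta> x v)" using real[of u] by (simp add: u)
  moreover have "pairing (cvec ?b) v = complex_of_real (pairing ?b u) - \<i> * complex_of_real (pairing ?b (?A *v u))"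
    by (simp add: u eig_def pairing_diff pairing_scale pairing_cvec)
  ultimately show ?thesis by (simp add: complex_eq_iff)
qed

text \<open>The real part vanishes by orthogonality and the imaginary part by skewness.\<close>

lemma pairing_isotropic:
  assumes "A ** A = - mat 1" "\<And>u v. pairing (A *v u) (A *v v) = pairing u v"
  shows "pairing (eig A u) (eig A v) = 0"
  using skew_of_orthogonal[OF assms, of u v] assms(2)[of u v]
  by (simp add: eig_def pairing_diff pairing_scale pairing_cvec complex_eq_iff)

text \<open>Closedness of L under the bracket. The real part of the expansion is [s, r] - [Js, Jr],
  the imaginary part is -R with R = [Js, r] + [s, Jr]; integrability makes the real part -JR, so the
  sum is -i times \<open>eig\<close> of R.\<close>

lemma courant_bracket_eig:
  fixes J :: "real^'n::finite \<Rightarrow> real ^ ('n + 'n) ^ ('n + 'n)"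
  assumes "gc_structure_on V J" "open V" "smooth_on V J" "smooth_on V s" "smooth_on V r" "x \<in> V"
  shows "courant_bracket (\<lambda>y. eig (J y) (s y)) (\<lambda>y. eig (J y) (r y)) x \<in> Lfib (J x)"
proof -
  have JJ: "J x ** J x = - mat 1" using assms(1,6) by (simp add: gc_structure_on_def)
  have c: "smooth_on V (\<lambda>x. J x $ i $ j)" for i j
    using smooth_on_linear[OF assms(2) bounded_linear_coord smooth_on_linear[OF assms(2) bounded_linear_coord assms(3)]] .
  note dJ = smooth_on_differentiable[OF assms(3,6)] and ds = smooth_on_differentiable[OF assms(4,6)]
    and dr = smooth_on_differentiable[OF assms(5,6)]
  note dJs = smooth_on_differentiable[OF smooth_on_matrix_vector[OF assms(2) c assms(4)] assms(6)]
  note dJr = smooth_on_differentiable[OF smooth_on_matrix_vector[OF assms(2) c assms(5)] assms(6)]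
  let ?R0 = "courant_bracket s r x" and ?R1 = "courant_bracket (\<lambda>y. J y *v s y) (\<lambda>y. J y *v r y) x"
    and ?R2 = "courant_bracket (\<lambda>y. J y *v s y) r x + courant_bracket s (\<lambda>y. J y *v r y) x"
  have "?R1 - ?R0 - J x *v ?R2 = 0"
    using assms(1,4-6) unfolding gc_structure_on_def by blast
  then have R1: "?R1 = ?R0 + J x *v ?R2" by (simp add: algebra_simps)
  have "courant_bracket (\<lambda>y. eig (J y) (s y)) (\<lambda>y. eig (J y) (r y)) x
    = jet_bracket (eig (J x) (s x)) (\<lambda>l. cvec (pd l s x) - \<i> *s cvec (pd l (\<lambda>y. J y *v s y) x))
       (eig (J x) (r x)) (\<lambda>l. cvec (pd l r x) - \<i> *s cvec (pd l (\<lambda>y. J y *v r y) x))"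
    using courant_bracket_jet[OF smooth_on_differentiable[OF smooth_on_eig[OF assms(2,3,4)] assms(6)]
        smooth_on_differentiable[OF smooth_on_eig[OF assms(2,3,5)] assms(6)]]
    by (simp add: pd_eig[OF dJ ds] pd_eig[OF dJ dr])
  also have "\<dots> = cvec ?R0 - \<i> *s cvec (courant_bracket s (\<lambda>y. J y *v r y) x)
      - \<i> *s (cvec (courant_bracket (\<lambda>y. J y *v s y) r x) - \<i> *s cvec ?R1)"
    unfolding eig_def jet_bracket_linear jet_bracket_cvec courant_bracket_jet[OF ds dr] courant_bracket_jet[OF dJs dr]
      courant_bracket_jet[OF ds dJr] courant_bracket_jet[OF dJs dJr]
    by (simp add: vec_eq_iff algebra_simps)
  also have "\<dots> = (- \<i>) *s eig (J x) ?R2"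
    unfolding R1 eig_def by (simp add: vec_eq_iff algebra_simps)
  finally have eq: "courant_bracket (\<lambda>y. eig (J y) (s y)) (\<lambda>y. eig (J y) (r y)) x = (- \<i>) *s eig (J x) ?R2" .
  have lin: "cmat (J x) *v (c *s v) = c *s (cmat (J x) *v v)" for c v
    by (simp add: vec_eq_iff matrix_vector_mult_def sum_distrib_left mult_ac)
  show ?thesis unfolding eq Lfib_def mem_Collect_eq lin cmat_eig eig_mult[OF JJ] by (simp add: vec_eq_iff)
qed

text \<open>The equation for \<beta> is tested on \<open>eig\<close> of two constant vectors e and
  f, and its real part is taken. Derivatives of b enter through \<open>gen_ad\<close>, and
  derivatives of the eigensections through the derivative of J along b. As e and f are arbitrary
  real vectors, nondegeneracy turns the scalar identity into one between endomorphisms.\<close>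

theorem infinitesimal_of_primitive:
  fixes J :: "real^'n::finite \<Rightarrow> real ^ ('n + 'n) ^ ('n + 'n)"
  assumes gc: "gc_structure_on V J" and V: "open V" and J: "smooth_on V J"
    and \<beta>: "Ldual_section V J \<beta>"
    and d\<beta>: "\<And>\<sigma> \<tau> x. L_section V J \<sigma> \<Longrightarrow> L_section V J \<tau> \<Longrightarrow> x \<in> V \<Longrightarrow> dL \<beta> \<sigma> \<tau> x = omega_dot1 J x (\<sigma> x) (\<tau> x)"
  shows "smooth_on V (dual_section J \<beta>)"
    and "x \<in> V \<Longrightarrow> (\<Sum>j\<in>UNIV. (x $ j + dual_section J \<beta> x $ Inl j) *\<^sub>R (pd j J x *v w))
      = gen_ad (\<lambda>l. pd l (dual_section J \<beta>) x) (J x *v w) - J x *v gen_ad (\<lambda>l. pd l (dual_section J \<beta>) x) w"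
proof -
  let ?b = "dual_section J \<beta>"
  have JJ: "J y ** J y = - mat 1" if "y \<in> V" for y using gc that by (simp add: gc_structure_on_def)
  have JJv: "J y *v (J y *v u) = - u" if "y \<in> V" for y u
    using JJ[OF that] by (simp add: matrix_vector_mul_assoc matrix_vector_mult_uminus)
  have orth: "pairing (J y *v u) (J y *v v) = pairing u v" if "y \<in> V" for y u v
    using gc that by (simp add: gc_structure_on_def)
  have skew: "pairing (J y *v u) v = - pairing u (J y *v v)" if "y \<in> V" for y u v
    by (rule skew_of_orthogonal[OF JJ[OF that] orth[OF that]])
  have Lsec: "L_section V J (\<lambda>y. eig (J y) e)" for e
    unfolding L_section_def using smooth_on_eig[OF V J smooth_on_const] eig_in_Lfib[OF JJ] by blast
  have cov: "covector_on (Lfib (J y)) (\<beta> y)" if "y \<in> V" for y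
    using \<beta> that by (simp add: Ldual_section_def)
  show smb: "smooth_on V ?b"
    unfolding smooth_on_component_iff[OF V]
  proof
    fix a
    have "smooth_on V (\<lambda>y. \<beta> y (eig (J y) (axis (swap_sum a) 1)))"
      using \<beta> Lsec by (simp add: Ldual_section_def)
    from smooth_on_minus[OF V smooth_on_linear[OF V bounded_linear_Im this]]
    show "smooth_on V (\<lambda>x. ?b x $ a)" by (simp add: dual_section_def)
  qed
  assume x: "x \<in> V"
  let ?db = "\<lambda>l. pd l ?b x" and ?D = "euler J x" and ?K = "\<Sum>j\<in>UNIV. ?b x $ Inl j *\<^sub>R pd j J x"
  let ?M = "gen_ad ?db"
  have db: "?b differentiable (at x)" by (rule smooth_on_differentiable[OF smb x])
  have dJ: "J differentiable (at x)" by (rule smooth_on_differentiable[OF J x])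
  have dJv: "(\<lambda>y. J y *v v) differentiable (at x)" for v
  proof -
    have c: "smooth_on V (\<lambda>x. J x $ i $ j)" for i j
      using smooth_on_linear[OF V bounded_linear_coord smooth_on_linear[OF V bounded_linear_coord J]] .
    show ?thesis by (rule smooth_on_differentiable[OF smooth_on_matrix_vector[OF V c smooth_on_const] x])
  qed
  have pJv: "pd l (\<lambda>y. J y *v v) x = pd l J x *v v" for l v
    using pd_matrix_vector'[OF dJ differentiable_const, of l v] by simp
  have pskew: "pairing (pd l J x *v u) v = - pairing u (pd l J x *v v)" for l u v
  proof -
    have "pd l (\<lambda>y. pairing (J y *v u) v + pairing u (J y *v v)) x = pd l (\<lambda>y. 0) x"
      by (rule pd_cong[OF V x]) (simp add: skew)
    moreover have "pd l (\<lambda>y. pairing (J y *v u) v + pairing u (J y *v v)) x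
      = pd l (\<lambda>y. pairing (J y *v u) v) x + pd l (\<lambda>y. pairing u (J y *v v)) x"
      unfolding pairing_real
      by (intro pd_add differentiable_mult differentiable_const differentiable_add differentiable_inner
          differentiable_linear[OF bounded_linear_anchor dJv] differentiable_linear[OF bounded_linear_formpart dJv])
    ultimately show ?thesis
      by (simp add: pd_pairing[OF dJv differentiable_const] pd_pairing[OF differentiable_const dJv] pJv)
  qed
  have Dapp: "?D *v u = (\<Sum>l\<in>UNIV. x $ l *\<^sub>R (pd l J x *v u))" for u
    by (simp add: euler_def matrix_sum_left scaleR_matrix_vector_assoc)
  have Kapp: "?K *v u = (\<Sum>l\<in>UNIV. ?b x $ Inl l *\<^sub>R (pd l J x *v u))" for u
    by (simp add: matrix_sum_left scaleR_matrix_vector_assoc)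
  have Dskew: "pairing (?D *v u) v = - pairing u (?D *v v)" for u v
    unfolding Dapp pairing_sum_left pairing_sum_right scalar_mult_eq_scaleR[symmetric] pairing_scale pskew
    by (simp add: sum_negf)
  have DJ: "?D *v (J x *v u) + J x *v (?D *v u) = 0" for u
  proof -
    have "pd l J x *v (J x *v u) + J x *v (pd l J x *v u) = 0" for l
    proof -
      have "pd l (\<lambda>y. J y *v (J y *v u)) x = pd l (\<lambda>y. - u) x"
        by (rule pd_cong[OF V x]) (simp add: JJv)
      then show ?thesis using pd_matrix_vector'[OF dJ dJv, of l u] by (simp add: pJv)
    qed
    then have "(\<Sum>l\<in>UNIV. x $ l *\<^sub>R (pd l J x *v (J x *v u) + J x *v (pd l J x *v u))) = 0" by simp
    then show ?thesis
      by (simp add: Dapp scaleR_add_right sum.distrib linear_sum[OF matrix_vector_mul_linear] matrix_vector_mult_scaleR)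
  qed
  have key: "?K *v e + ?D *v e = ?M (J x *v e) - J x *v ?M e" for e
  proof -
    \<comment> \<open>Moving everything onto the first slot by skewness of J and of its Euler
      derivative, the real part of the tested equation becomes <\<alpha> + J \<gamma>, f> =
      0.\<close>
    let ?\<alpha> = "2 *\<^sub>R (?K *v e) - 2 *\<^sub>R ?M (J x *v e) + ?D *v e" and ?\<gamma> = "2 *\<^sub>R ?M e + ?D *v (J x *v e)"
    have "pairing (?\<alpha> + J x *v ?\<gamma>) f = 0" for f
    proof -
      let ?\<sigma> = "\<lambda>y. eig (J y) e" and ?\<tau> = "\<lambda>y. eig (J y) f" and ?cb = "\<lambda>y. cvec (?b y)"
      let ?d\<sigma> = "\<lambda>l. pd l ?\<sigma> x" and ?d\<tau> = "\<lambda>l. pd l ?\<tau> x" and ?cdb = "\<lambda>l. cvec (?db l)"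
      have d\<sigma>: "?\<sigma> differentiable (at x)" and d\<tau>: "?\<tau> differentiable (at x)"
        by (rule smooth_on_differentiable[OF smooth_on_eig[OF V J smooth_on_const] x])+
      have pdeig: "pd l (\<lambda>y. eig (J y) u) x = - \<i> *s cvec (pd l J x *v u)" for l u
        using pd_eig[OF dJ differentiable_const, of l u] by (simp add: pJv cvec_simps)
      have dcb: "?cb differentiable (at x)" by (rule differentiable_linear[OF bounded_linear_cvec db])
      have pcb: "pd l ?cb x = ?cdb l" for l by (rule pd_linear[OF bounded_linear_cvec db])
      \<comment> \<open>On L the form \<beta> is a multiple of the pairing with b, so its
        derivatives along a section obey the product rule for the pairing.\<close>
      have vf: "vf_apply (\<lambda>y. anchor (\<rho> y)) (\<lambda>y. \<beta> y (eig (J y) u)) x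
        = - 2 * \<i> * (pairing (dir_sum (\<rho> x) ?cdb) (eig (J x) u) + pairing (?cb x) (dir_sum (\<rho> x) (\<lambda>l. pd l (\<lambda>y. eig (J y) u) x)))"
        for \<rho> :: "real^'n \<Rightarrow> complex^('n + 'n)" and u
      proof -
        have de: "(\<lambda>y. eig (J y) u) differentiable (at x)"
          by (rule smooth_on_differentiable[OF smooth_on_eig[OF V J smooth_on_const] x])
        have bl: "bounded_linear (\<lambda>z::complex. - 2 * \<i> * z)" by (rule bounded_linear_mult_right)
        have dp: "(\<lambda>y. pairing (?cb y) (eig (J y) u)) differentiable (at x)"
        proof -
          have "(\<lambda>y. ?cb y $ a) differentiable (at x)" "(\<lambda>y. eig (J y) u $ a) differentiable (at x)" for a
            by (rule differentiable_linear[OF bounded_linear_coord dcb]) (rule differentiable_linear[OF bounded_linear_coord de])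
          then show ?thesis unfolding pairing_sum
            by (intro differentiable_mult differentiable_const differentiable_sum finite ballI differentiable_add)
        qed
        have pd\<beta>: "pd l (\<lambda>y. \<beta> y (eig (J y) u)) x
          = - 2 * \<i> * (pairing (?cdb l) (eig (J x) u) + pairing (?cb x) (pd l (\<lambda>y. eig (J y) u) x))" for l
        proof -
          have "pd l (\<lambda>y. \<beta> y (eig (J y) u)) x = pd l (\<lambda>y. - 2 * \<i> * pairing (?cb y) (eig (J y) u)) x"
            by (rule pd_cong[OF V x]) (rule pairing_dual_section[OF cov JJ eig_in_Lfib[OF JJ]])
          also have "\<dots> = - 2 * \<i> * pd l (\<lambda>y. pairing (?cb y) (eig (J y) u)) x"
            by (rule pd_linear[OF bl dp])
          finally show ?thesis by (simp only: pd_pairing[OF dcb de] pcb)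
        qed
        show ?thesis
          unfolding vf_apply_def pd\<beta> pairing_dir_sum pairing_dir_sum_right anchor_nth sum.distrib[symmetric] sum_distrib_left
          by (intro sum.cong refl) (simp add: algebra_simps)
      qed
      \<comment> \<open>Differentiated isotropy merges the two halves of the 1-form in the bracket
        into twice <d_i \<sigma>, \<tau>>; paired with b, it becomes the derivative of \<sigma>
        along b.\<close>
      have iso: "pairing (?d\<sigma> i) (?\<tau> x) + pairing (?\<sigma> x) (?d\<tau> i) = 0" for i
      proof -
        have "pd i (\<lambda>y. pairing (?\<sigma> y) (?\<tau> y)) x = pd i (\<lambda>y. 0) x"
          by (rule pd_cong[OF V x]) (rule pairing_isotropic[OF JJ orth])
        then show ?thesis by (simp add: pd_pairing[OF d\<sigma> d\<tau>])
      qed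
      have brL: "courant_bracket ?\<sigma> ?\<tau> x \<in> Lfib (J x)"
        by (rule courant_bracket_eig[OF gc V J smooth_on_const smooth_on_const x])
      have br: "pairing (?cb x) (courant_bracket ?\<sigma> ?\<tau> x)
        = pairing (?cb x) (dir_sum (?\<sigma> x) ?d\<tau>) - pairing (?cb x) (dir_sum (?\<tau> x) ?d\<sigma>) + pairing (dir_sum (?cb x) ?d\<sigma>) (?\<tau> x)"
      proof -
        have "pairing (?cb x) (mk_gen 0 (\<chi> i. pairing (?d\<sigma> i) (?\<tau> x) - pairing (?\<sigma> x) (?d\<tau> i)))
          = 1/2 * (\<Sum>i\<in>UNIV. (pairing (?d\<sigma> i) (?\<tau> x) - pairing (?\<sigma> x) (?d\<tau> i)) * ?cb x $ Inl i)"
          unfolding pairing_commute[of "?cb x"] pairing_form by simp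
        also have "\<dots> = 1/2 * (\<Sum>i\<in>UNIV. (2 * pairing (?d\<sigma> i) (?\<tau> x)) * ?cb x $ Inl i)"
        proof -
          have eq2: "pairing (?d\<sigma> i) (?\<tau> x) - pairing (?\<sigma> x) (?d\<tau> i) = 2 * pairing (?d\<sigma> i) (?\<tau> x)" for i
            using iso[of i] by (simp add: add_eq_0_iff)
          show ?thesis by (simp only: eq2)
        qed
        also have "\<dots> = pairing (dir_sum (?cb x) ?d\<sigma>) (?\<tau> x)"
          unfolding pairing_dir_sum sum_distrib_left by (intro sum.cong refl) (simp add: algebra_simps)
        finally show ?thesis
          unfolding courant_bracket_jet[OF d\<sigma> d\<tau>] jet_bracket_def by (simp only: pairing_add pairing_diff)
      qed
      have "dL \<beta> ?\<sigma> ?\<tau> x = - 2 * \<i> * (pairing (gen_ad ?cdb (?\<sigma> x)) (?\<tau> x) - pairing (dir_sum (?cb x) ?d\<sigma>) (?\<tau> x))"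
        unfolding dL_def vf pairing_dual_section[where J = J and \<beta> = \<beta> and x = x, OF cov[OF x] JJ[OF x] brL] pairing_gen_ad
          pairing_commute[of "dir_sum (?\<tau> x) ?cdb"] br
        by (simp add: algebra_simps)
      moreover have "dL \<beta> ?\<sigma> ?\<tau> x = pairing (?\<sigma> x) (cmat ?D *v ?\<tau> x)"
        using d\<beta>[OF Lsec Lsec x, of e f] by (simp add: omega_dot1_def Jdot1_euler[OF dJ])
      ultimately have main: "pairing (?\<sigma> x) (cmat ?D *v ?\<tau> x)
         = - 2 * \<i> * (pairing (gen_ad ?cdb (?\<sigma> x)) (?\<tau> x) - pairing (dir_sum (?cb x) ?d\<sigma>) (?\<tau> x))" by simp
      have cD: "cmat ?D *v ?\<tau> x = cvec (?D *v f) - \<i> *s cvec (?D *v (J x *v f))"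
      proof -
        have "cmat ?D *v (v - c *s w) = cmat ?D *v v - c *s (cmat ?D *v w)" for v w and c :: complex
          by (simp add: vec_eq_iff matrix_vector_mult_def sum_subtractf sum_distrib_left algebra_simps)
        then show ?thesis by (simp add: eig_def cmat_cvec)
      qed
      have ad: "gen_ad ?cdb (?\<sigma> x) = cvec (?M e) - \<i> *s cvec (?M (J x *v e))"
        unfolding eig_def gen_ad_linear gen_ad_cvec ..
      have dd: "dir_sum (?cb x) ?d\<sigma> = - \<i> *s cvec (?K *v e)"
      proof -
        have "dir_sum (?cb x) ?d\<sigma> = (\<Sum>l\<in>UNIV. complex_of_real (?b x $ Inl l) *s (- \<i> *s cvec (pd l J x *v e)))"
          by (simp add: dir_sum_def pdeig)
        then show ?thesis
          unfolding Kapp by (simp add: vec_eq_iff sum_distrib_left algebra_simps sum_negf)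
      qed
      have "Re (pairing (?\<sigma> x) (cmat ?D *v ?\<tau> x)) = pairing e (?D *v f) - pairing (J x *v e) (?D *v (J x *v f))"
        unfolding cD unfolding eig_def by (simp add: pairing_diff pairing_scale pairing_cvec)
      moreover have "Re (- 2 * \<i> * (pairing (gen_ad ?cdb (?\<sigma> x)) (?\<tau> x) - pairing (dir_sum (?cb x) ?d\<sigma>) (?\<tau> x)))
        = - 2 * pairing (?M e) (J x *v f) - 2 * pairing (?M (J x *v e)) f + 2 * pairing (?K *v e) f"
        unfolding ad dd unfolding eig_def
        by (simp add: pairing_diff pairing_scale pairing_minus pairing_cvec algebra_simps)
      ultimately have "pairing e (?D *v f) - pairing (J x *v e) (?D *v (J x *v f))
        = - 2 * pairing (?M e) (J x *v f) - 2 * pairing (?M (J x *v e)) f + 2 * pairing (?K *v e) f"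
        using main by simp
      then show ?thesis
        using Dskew[of e f] Dskew[of "J x *v e" "J x *v f"] skew[OF x, of "?M e" f] skew[OF x, of "?D *v (J x *v e)" f]
        by (simp add: pairing_add pairing_diff matrix_vector_right_distrib matrix_vector_mult_scaleR
            pairing_scaleR)
    qed
    then have "?\<alpha> + J x *v ?\<gamma> = 0" by (rule pairing_nondegenerate)
    \<comment> \<open>Differentiating J^2 = -1 shows that D anticommutes with J, so J D J = D; the
      two occurrences of D e then add up and a factor 2 can be divided out.\<close>
    moreover have "J x *v (?D *v (J x *v e)) = ?D *v e"
    proof -
      have "J x *v (?D *v (J x *v e)) = - (?D *v (- e))"
        using DJ[of "J x *v e"] by (simp add: JJv[OF x] add_eq_0_iff)
      also have "\<dots> = ?D *v e"
        using matrix_vector_mult_scaleR[of ?D "-1" e] by simp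
      finally show ?thesis .
    qed
    moreover have "2 *\<^sub>R k - 2 *\<^sub>R m + d + (2 *\<^sub>R j + d) = 2 *\<^sub>R (k + d - (m - j))"
      for k m d j :: "real^('n + 'n)"
      by (simp add: scaleR_2 algebra_simps)
    ultimately have "2 *\<^sub>R (?K *v e + ?D *v e - (?M (J x *v e) - J x *v ?M e)) = 0"
      by (simp only: matrix_vector_right_distrib matrix_vector_mult_scaleR)
    then show ?thesis by simp
  qed
  show "(\<Sum>j\<in>UNIV. (x $ j + ?b x $ Inl j) *\<^sub>R (pd j J x *v w)) = ?M (J x *v w) - J x *v ?M w"
    using key[of w] unfolding Kapp Dapp by (simp add: scaleR_add_left sum.distrib add.commute)
qed

text \<open>The 1-jet condition concerns coefficients in some frame of the dual of L. On
  \<open>eig\<close> of a constant vector the frame covectors are smooth functions, so the product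
  rule transfers the vanishing 1-jet to \<beta> evaluated there and hence to the components of
  b.\<close>

lemma dual_section_jet:
  fixes J :: "real^'n::finite \<Rightarrow> real ^ ('n + 'n) ^ ('n + 'n)"
  assumes "open V" "smooth_on V J" "\<And>y. y \<in> V \<Longrightarrow> J y ** J y = - mat 1" "jet1_vanishes_at_0 V J \<beta>"
  shows "dual_section J \<beta> 0 = 0" "(dual_section J \<beta>) differentiable (at 0) \<Longrightarrow> pd l (dual_section J \<beta>) 0 = 0"
proof -
  obtain W \<epsilon> and c :: "'n \<Rightarrow> real^'n \<Rightarrow> complex" where W: "open W" "0 \<in> W" "W \<subseteq> V" and fr: "Ldual_frame W J \<epsilon>"
    and \<beta>: "\<And>x v. x \<in> W \<Longrightarrow> v \<in> Lfib (J x) \<Longrightarrow> \<beta> x v = (\<Sum>k\<in>UNIV. c k x * \<epsilon> k x v)"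
    and c0: "\<And>k. c k 0 = 0" "\<And>k. (c k has_derivative (\<lambda>_. 0)) (at 0)"
    using assms(4) unfolding jet1_vanishes_at_0_def by blast
  let ?f = "\<lambda>e y. \<beta> y (eig (J y) e)"
  have L: "eig (J y) e \<in> Lfib (J y)" if "y \<in> W" for y e
    by (rule eig_in_Lfib[OF assms(3)]) (use that W in blast)
  have f0: "?f e 0 = 0" for e using \<beta>[OF W(2) L[OF W(2)]] by (simp add: c0)
  have fD: "(?f e has_derivative (\<lambda>_. 0)) (at 0)" for e
  proof -
    have sec: "L_section W J (\<lambda>y. eig (J y) e)"
      unfolding L_section_def using smooth_on_eig[OF W(1) smooth_on_subset[OF assms(2) W(3)] smooth_on_const] L by blast
    have "((\<lambda>y. c k y * \<epsilon> k y (eig (J y) e)) has_derivative (\<lambda>_. 0)) (at 0)" for k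
    proof -
      have "smooth_on W (\<lambda>y. \<epsilon> k y (eig (J y) e))"
        using fr sec unfolding Ldual_frame_def Ldual_section_def by blast
      from smooth_on_differentiable[OF this W(2)]
      have "((\<lambda>y. \<epsilon> k y (eig (J y) e)) has_derivative frechet_derivative (\<lambda>y. \<epsilon> k y (eig (J y) e)) (at 0)) (at 0)"
        by (simp add: frechet_derivative_works)
      from has_derivative_mult[OF c0(2)[of k] this] show ?thesis by (simp add: c0)
    qed
    then have "((\<lambda>y. \<Sum>k\<in>UNIV. c k y * \<epsilon> k y (eig (J y) e)) has_derivative (\<lambda>u. \<Sum>k\<in>(UNIV::'n set). 0)) (at 0)"
      by (intro has_derivative_sum)
    then have "((\<lambda>y. \<Sum>k\<in>UNIV. c k y * \<epsilon> k y (eig (J y) e)) has_derivative (\<lambda>_. 0)) (at 0)" by simp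
    then show ?thesis
      by (rule has_derivative_transform_within_open[OF _ W(1,2)]) (simp add: \<beta> L)
  qed
  show "dual_section J \<beta> 0 = 0" by (simp add: dual_section_def vec_eq_iff f0)
  assume d: "(dual_section J \<beta>) differentiable (at 0)"
  have "pd l (dual_section J \<beta>) 0 $ a = 0" for a
  proof -
    have "((\<lambda>y. - Im (?f (axis (swap_sum a) 1) y)) has_derivative (\<lambda>_. - Im 0)) (at 0)"
      by (rule has_derivative_minus[OF bounded_linear.has_derivative[OF bounded_linear_Im fD]])
    from pd_eqI[OF this, of l] show ?thesis
      using pd_component[OF d, of l a] by (simp add: dual_section_def)
  qed
  then show "pd l (dual_section J \<beta>) 0 = 0" by (simp add: vec_eq_iff)
qed

theorem theorem7p3:
  fixes M :: "'m topology"
    and \<A> :: "('m, 'n::finite) chart set"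
    and \<J> :: "('m, 'n) chart \<Rightarrow> real^'n \<Rightarrow> real ^ ('n + 'n) ^ ('n + 'n)"
    and U :: "'m set"
    and \<phi> :: "'m \<Rightarrow> real^'n"
    and J :: "real^'n \<Rightarrow> real ^ ('n + 'n) ^ ('n + 'n)"
  assumes "smooth_manifold M \<A>"
    and "gc_structure_manifold \<A> \<J>"
    and "(U, \<phi>) \<in> \<A>"
    and "\<phi> ` U = ball 0 1"
    and "J = \<J> (U, \<phi>)"
    and "\<exists>\<beta>. Ldual_section (ball 0 1) J \<beta> \<and>
          (\<forall>\<sigma> \<tau>. L_section (ball 0 1) J \<sigma> \<longrightarrow> L_section (ball 0 1) J \<tau> \<longrightarrow>
             (\<forall>x \<in> ball 0 1. dL \<beta> \<sigma> \<tau> x = omega_dot1 J x (\<sigma> x) (\<tau> x))) \<and>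
          jet1_vanishes_at_0 (ball 0 1) J \<beta>"
  shows "isomorphic_to_constant_near_0 (ball 0 1) J"
proof -
  have gc: "gc_structure_on (ball 0 1) J"
    using assms(2-5) unfolding gc_structure_manifold_def by fastforce
  have smJ: "smooth_on (ball 0 1) J"
    using gc by (simp add: gc_structure_on_def smooth_on_component_iff)
  have JJ: "J y ** J y = - mat 1" and orth: "pairing (J y *v u) (J y *v v) = pairing u v"
    if "y \<in> ball 0 1" for y u v
    using gc that by (simp_all add: gc_structure_on_def)
  obtain \<beta> where \<beta>: "Ldual_section (ball 0 1) J \<beta>"
    "\<And>\<sigma> \<tau> x. L_section (ball 0 1) J \<sigma> \<Longrightarrow> L_section (ball 0 1) J \<tau> \<Longrightarrow> x \<in> ball 0 1 \<Longrightarrow>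
       dL \<beta> \<sigma> \<tau> x = omega_dot1 J x (\<sigma> x) (\<tau> x)"
    "jet1_vanishes_at_0 (ball 0 1) J \<beta>"
    using assms(6) by blast
  note b = infinitesimal_of_primitive[OF gc open_ball smJ \<beta>(1,2)]
  have 0: "0 \<in> ball (0::real^'n) 1" by simp
  show ?thesis
  proof (rule isomorphic_to_constant_of_infinitesimal[of "dual_section J \<beta>"])
    show "smooth_on (ball 0 1) (dual_section J \<beta>)" by (rule b(1))
    then show "pd l (dual_section J \<beta>) 0 = 0" for l
      by (intro dual_section_jet(2)[OF open_ball smJ JJ \<beta>(3)] smooth_on_differentiable[OF _ 0])
    show "dual_section J \<beta> 0 = 0" by (rule dual_section_jet(1)[OF open_ball smJ JJ \<beta>(3)])
  qed (use smJ JJ[OF 0] orth[OF 0] b(2) in blast)+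
qed

end
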